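(* Let $V$ be a spectrally negative Lévy process which is not the opposite of a subordinator, with Laplace exponent $\Psi_V$, let $V^{\uparrow}$ be $V$ conditioned to stay positive (starting from $0$), and let $I(V^{\uparrow}) := \int_0^{+\infty} e^{-V^{\uparrow}(t)}\,dt$. Let $$\sigma := \sup\left\{\alpha\geq 0 : \lim_{\lambda\to+\infty}\lambda^{-\alpha}\Psi_V(\lambda)=\infty\right\},\qquad \beta := \inf\left\{\alpha\geq 0 : \lim_{\lambda\to+\infty}\lambda^{-\alpha}\Psi_V(\lambda)=0\right\}$$ (one always has $1\leq\sigma\leq\beta\leq 2$). Then $$\forall \beta'>\beta,\quad \lim_{x\to 0} x^{1/(\beta'-1)}\log\left(\mathbb{P}\left(I(V^{\uparrow})\leq x\right)\right) = -\infty,$$ and, if $\sigma>1$, $$\forall \sigma'\in]1,\sigma[,\quad \lim_{x\to 0} x^{1/(\sigma'-1)}\log\left(\mathbb{P}\left(I(V^{\uparrow})\leq x\right)\right) = 0.$$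
   Context: Convention: $\log 0=-\infty$; limits as $x\to 0$ are over $x>0$. A spectrally negative Lévy process is a real-valued càdlàg Lévy process $V$ with $V(0)=0$ and no positive jumps. Its Laplace exponent $\Psi_V$ is given by $\mathbb{E}[e^{\lambda V(t)}] = e^{t\Psi_V(\lambda)}$ for $t,\lambda \geq 0$. If $V$ drifts to $-\infty$ (i.e. $V(t)\to-\infty$ a.s.), $\kappa := \inf\{\lambda>0 : \Psi_V(\lambda)=0\}$; otherwise $\kappa := 0$. Write $V_x := x+V$. Scale function: $W:[0,+\infty[\to[0,+\infty[$ is the continuous increasing function with $\int_0^{+\infty} e^{-\lambda x}W(x)\,dx = 1/\Psi_V(\lambda)$ for all $\lambda>\kappa$. $V$ conditioned to stay positive: for $x>0$, $V^{\uparrow}_x$ is the Markov process started from $x$, with values in $]0,+\infty[$ and infinite lifetime, whose transition semigroup is $p^{\uparrow}_t(x,dy) := \frac{W(y)}{W(x)}\,\mathbb{P}\left(V_x(t)\in dy,\ \inf_{[0,t]}V_x>0\right)$. $V^{\uparrow}=V^{\uparrow}_0$ is the process started from $0$ obtained as the limit in distribution of $V^{\uparrow}_x$ as $x\to 0+$; it is a Feller process whose transition laws restricted to $]0,+\infty[$ are given by $p^{\uparrow}_t$. *)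

theory Defs
  imports "HOL-Probability.Probability"
begin

section \<open>Spectrally negative Levy processes\<close>

text \<open>Processes are functions \<open>X :: real \<Rightarrow> 'a \<Rightarrow> real\<close>; only times \<open>t \<ge> 0\<close> are meaningful.\<close>

definition cadlag :: "(real \<Rightarrow> real) \<Rightarrow> bool" where
  "cadlag f \<longleftrightarrow>
     (\<forall>t\<ge>0. (f \<longlongrightarrow> f t) (at_right t)) \<and> (\<forall>t>0. \<exists>l. (f \<longlongrightarrow> l) (at_left t))"

definition levy_process :: "'a measure \<Rightarrow> (real \<Rightarrow> 'a \<Rightarrow> real) \<Rightarrow> bool" where
  "levy_process M X \<longleftrightarrow>
     prob_space M \<and>
     (\<forall>t\<ge>0. X t \<in> borel_measurable M) \<and>
     (\<forall>\<omega>\<in>space M. cadlag (\<lambda>t. X t \<omega>)) \<and>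
     (AE \<omega> in M. X 0 \<omega> = 0) \<and>
     (\<forall>n. \<forall>t :: nat \<Rightarrow> real. 0 \<le> t 0 \<longrightarrow> incseq t \<longrightarrow>
        prob_space.indep_vars M (\<lambda>_. borel) (\<lambda>i \<omega>. X (t (Suc i)) \<omega> - X (t i) \<omega>) {..<n}) \<and>
     (\<forall>s\<ge>0. \<forall>t\<ge>0. distr M borel (\<lambda>\<omega>. X (s + t) \<omega> - X s \<omega>) = distr M borel (X t))"

definition spectrally_negative_levy :: "'a measure \<Rightarrow> (real \<Rightarrow> 'a \<Rightarrow> real) \<Rightarrow> bool" where
  "spectrally_negative_levy M V \<longleftrightarrow>
     levy_process M V \<and> (AE \<omega> in M. \<forall>t>0. V t \<omega> \<le> Lim (at_left t) (\<lambda>s. V s \<omega>))"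

definition subordinator :: "'a measure \<Rightarrow> (real \<Rightarrow> 'a \<Rightarrow> real) \<Rightarrow> bool" where
  "subordinator M X \<longleftrightarrow> levy_process M X \<and> (AE \<omega> in M. mono_on {0..} (\<lambda>t. X t \<omega>))"

text \<open>The expectation is a Bochner integral, which is \<open>0\<close> for a non-integrable function; since the
  right-hand side is positive, the equation includes finiteness of the exponential moments.
  Values of \<open>\<Psi>\<close> at negative arguments are irrelevant.\<close>

definition laplace_exponent ::
    "'a measure \<Rightarrow> (real \<Rightarrow> 'a \<Rightarrow> real) \<Rightarrow> (real \<Rightarrow> real) \<Rightarrow> bool" where
  "laplace_exponent M V \<Psi> \<longleftrightarrow>
     (\<forall>t\<ge>0. \<forall>\<theta>\<ge>0. (\<integral>\<omega>. exp (\<theta> * V t \<omega>) \<partial>M) = exp (t * \<Psi> \<theta>))"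

definition kappa :: "'a measure \<Rightarrow> (real \<Rightarrow> 'a \<Rightarrow> real) \<Rightarrow> (real \<Rightarrow> real) \<Rightarrow> real" where
  "kappa M V \<Psi> =
     (if AE \<omega> in M. filterlim (\<lambda>t. V t \<omega>) at_bot at_top
      then Inf {\<theta>. 0 < \<theta> \<and> \<Psi> \<theta> = 0} else 0)"

text \<open>``Increasing'' is meant in the weak sense: for \<open>V t = c * t\<close> the scale function is the
  constant \<open>1 / c\<close>. Values of \<open>W\<close> at negative arguments are irrelevant.\<close>

definition scale_function ::
    "'a measure \<Rightarrow> (real \<Rightarrow> 'a \<Rightarrow> real) \<Rightarrow> (real \<Rightarrow> real) \<Rightarrow> (real \<Rightarrow> real) \<Rightarrow> bool" where
  "scale_function M V \<Psi> W \<longleftrightarrow>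
     continuous_on {0..} W \<and> mono_on {0..} W \<and> (\<forall>x\<ge>0. 0 \<le> W x) \<and>
     (\<forall>\<theta>>kappa M V \<Psi>. (LINT x:{0..}|lborel. exp (- \<theta> * x) * W x) = 1 / \<Psi> \<theta>)"

definition sigma_exponent :: "(real \<Rightarrow> real) \<Rightarrow> real" where
  "sigma_exponent \<Psi> =
     Sup {\<alpha>. 0 \<le> \<alpha> \<and> filterlim (\<lambda>u. u powr (- \<alpha>) * \<Psi> u) at_top at_top}"

definition beta_exponent :: "(real \<Rightarrow> real) \<Rightarrow> real" where
  "beta_exponent \<Psi> =
     Inf {\<alpha>. 0 \<le> \<alpha> \<and> ((\<lambda>u. u powr (- \<alpha>) * \<Psi> u) \<longlongrightarrow> 0) at_top}"

section \<open>Markov processes\<close>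

definition natural_sigma :: "'b measure \<Rightarrow> (real \<Rightarrow> 'b \<Rightarrow> real) \<Rightarrow> real \<Rightarrow> 'b measure" where
  "natural_sigma N Y s =
     sigma (space N) {Y u -` A \<inter> space N | u A. 0 \<le> u \<and> u \<le> s \<and> A \<in> sets borel}"

text \<open>A cadlag process with values in \<open>S\<close>, started from \<open>x\<close>, with infinite lifetime and
  transition semigroup \<open>P t y (dz)\<close> on \<open>S\<close>.\<close>

definition markov_process ::
    "'b measure \<Rightarrow> real set \<Rightarrow> (real \<Rightarrow> real \<Rightarrow> real measure) \<Rightarrow> real
      \<Rightarrow> (real \<Rightarrow> 'b \<Rightarrow> real) \<Rightarrow> bool" where
  "markov_process N S P x Y \<longleftrightarrow>
     prob_space N \<and>
     (\<forall>t\<ge>0. Y t \<in> borel_measurable N) \<and>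
     (\<forall>\<omega>\<in>space N. cadlag (\<lambda>t. Y t \<omega>)) \<and>
     (\<forall>t\<ge>0. \<forall>\<omega>\<in>space N. Y t \<omega> \<in> S) \<and>
     (AE \<omega> in N. Y 0 \<omega> = x) \<and>
     (\<forall>s\<ge>0. \<forall>h\<ge>0. \<forall>B\<in>sets borel. AE \<omega> in N.
        real_cond_exp N (natural_sigma N Y s) (indicator (Y (s + h) -` B \<inter> space N)) \<omega>
          = measure (P h (Y s \<omega>)) B)"

text \<open>The Feller property on \<open>[0, \<infinity>)\<close>: the semigroup acts on the continuous functions vanishing at
  infinity, and is strongly continuous there (for such semigroups, pointwise convergence as
  \<open>t \<rightarrow> 0\<close> is equivalent to uniform convergence). The integrals are restricted to \<open>[0, \<infinity>)\<close> because
  \<open>f\<close> is arbitrary, possibly non-measurable, on the negative half-line.\<close>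

definition feller_semigroup :: "(real \<Rightarrow> real \<Rightarrow> real measure) \<Rightarrow> bool" where
  "feller_semigroup P \<longleftrightarrow>
     (\<forall>f :: real \<Rightarrow> real. continuous_on {0..} f \<longrightarrow> (f \<longlongrightarrow> 0) at_top \<longrightarrow>
        (\<forall>t\<ge>0. continuous_on {0..} (\<lambda>x. LINT y:{0..}|P t x. f y) \<and>
                ((\<lambda>x. LINT y:{0..}|P t x. f y) \<longlongrightarrow> 0) at_top) \<and>
        (\<forall>x\<ge>0. ((\<lambda>t. LINT y:{0..}|P t x. f y) \<longlongrightarrow> f x) (at_right 0)))"

text \<open>Convergence in distribution of the processes \<open>X x\<close> (on \<open>N x\<close>) to \<open>Y\<close> (on \<open>N'\<close>) along the
  filter \<open>F\<close>, in the sense of finite-dimensional distributions. Functions on \<open>real \<Rightarrow> real\<close> carry the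
  product topology, so \<open>f\<close> composed with restriction to a finite \<open>J\<close> ranges over all bounded
  continuous functions of the coordinates in \<open>J\<close>.\<close>

definition converges_in_fdd ::
    "(real \<Rightarrow> 'b measure) \<Rightarrow> (real \<Rightarrow> real \<Rightarrow> 'b \<Rightarrow> real) \<Rightarrow> 'c measure \<Rightarrow> (real \<Rightarrow> 'c \<Rightarrow> real)
      \<Rightarrow> real filter \<Rightarrow> bool" where
  "converges_in_fdd N X N' Y F \<longleftrightarrow>
     (\<forall>J. finite J \<longrightarrow> J \<subseteq> {0..} \<longrightarrow>
       (\<forall>f :: (real \<Rightarrow> real) \<Rightarrow> real. continuous_on UNIV f \<longrightarrow> bounded (range f) \<longrightarrow>
          ((\<lambda>x. \<integral>\<omega>. f (\<lambda>t\<in>J. X x t \<omega>) \<partial>(N x)) \<longlongrightarrow> (\<integral>\<omega>. f (\<lambda>t\<in>J. Y t \<omega>) \<partial>N')) F))"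

section \<open>Conditioning to stay positive\<close>

text \<open>The measure \<open>B \<mapsto> P (x + V t \<in> B, inf of x + V over [0, t] > 0)\<close>.\<close>

definition killed_law :: "'a measure \<Rightarrow> (real \<Rightarrow> 'a \<Rightarrow> real) \<Rightarrow> real \<Rightarrow> real \<Rightarrow> real measure" where
  "killed_law M V t x =
     distr (density M (indicator {\<omega> \<in> space M. 0 < (INF s\<in>{0..t}. x + V s \<omega>)})) borel
       (\<lambda>\<omega>. x + V t \<omega>)"

text \<open>The killed law is carried by \<open>(0, \<infinity>)\<close>; the indicator only makes the density measurable
  irrespective of the values of \<open>W\<close> at negative arguments.\<close>

definition up_kernel ::
    "'a measure \<Rightarrow> (real \<Rightarrow> 'a \<Rightarrow> real) \<Rightarrow> (real \<Rightarrow> real) \<Rightarrow> real \<Rightarrow> real \<Rightarrow> real measure" where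
  "up_kernel M V W t x =
     density (killed_law M V t x) (\<lambda>y. ennreal (W y / W x) * indicator {0<..} y)"

text \<open>For \<open>x > 0\<close>, \<open>Vup x\<close> (on \<open>N x\<close>) is \<open>V\<close> conditioned to stay positive and started from \<open>x\<close>, and
  \<open>Vup 0\<close> (on \<open>N 0\<close>) is their limit in distribution as \<open>x \<rightarrow> 0+\<close>. The latter is a Feller process
  on \<open>[0, \<infinity>)\<close> whose transition laws are \<open>up_kernel\<close> on \<open>(0, \<infinity>)\<close>; from \<open>0\<close> they are necessarily
  the one-dimensional laws of \<open>Vup 0\<close>.\<close>

definition conditioned_to_stay_positive ::
    "'a measure \<Rightarrow> (real \<Rightarrow> 'a \<Rightarrow> real) \<Rightarrow> (real \<Rightarrow> real)
      \<Rightarrow> (real \<Rightarrow> 'b measure) \<Rightarrow> (real \<Rightarrow> real \<Rightarrow> 'b \<Rightarrow> real) \<Rightarrow> bool" where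
  "conditioned_to_stay_positive M V W N Vup \<longleftrightarrow>
     (\<forall>x>0. markov_process (N x) {0<..} (up_kernel M V W) x (Vup x)) \<and>
     converges_in_fdd N Vup (N 0) (Vup 0) (at_right 0) \<and>
     (let P = (\<lambda>t x. if x = 0 then distr (N 0) borel (Vup 0 t) else up_kernel M V W t x)
      in markov_process (N 0) {0..} P 0 (Vup 0) \<and> feller_semigroup P)"

section \<open>The exponential functional\<close>

definition exp_functional :: "(real \<Rightarrow> 'b \<Rightarrow> real) \<Rightarrow> 'b \<Rightarrow> ennreal" where
  "exp_functional Y \<omega> = (\<integral>\<^sup>+ t\<in>{0..}. ennreal (exp (- Y t \<omega>)) \<partial>lborel)"

text \<open>Logarithm with the convention \<open>log 0 = -\<infinity>\<close> (whereas \<open>ln 0 = 0\<close> in the library).\<close>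

definition log0 :: "real \<Rightarrow> ereal" where
  "log0 p = (if p = 0 then - \<infinity> else ereal (ln p))"

end

theory Submission
  imports Defs "HOL-Real_Asymp.Real_Asymp"
begin

text \<open>The process \<open>V\<close> conditioned to stay positive is the h-transform, with \<open>h = W\<close>, of \<open>V\<close> killed
  when it leaves \<open>(0, \<infinity>)\<close>. Only its skeleton chains on time grids are needed, and the process started
  from \<open>0\<close> is reached by convergence of the finite-dimensional distributions.

  Upper bound: \<open>I \<le> x\<close> forces the conditioned process above \<open>2\<close> before time \<open>16 x\<close>. Having no positive
  jumps, on fine grids it visits \<open>[1/2, 3/4]\<close> first; from there the h-transform costs only the factor
  \<open>W (5/4) / W (1/2)\<close>, and an exponential supermartingale of \<open>V\<close> gives the bound
  \<open>exp (- l/4 + 16 x \<Psi> l)\<close>, which is optimised over \<open>l\<close> using \<open>\<Psi> l \<le> l powr b\<close>.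

  Lower bound: the weight \<open>W (x + V t)\<close> and the event of survival are increasing in the increments of
  \<open>V\<close>, so by Harris' inequality the conditioned process at a fixed time stochastically dominates \<open>V\<close>.
  The Paley-Zygmund inequality together with \<open>\<Psi> (2 l) \<le> 4 \<Psi> l + O(l)\<close> then shows that it reaches a
  height \<open>y\<close> of order \<open>ln (1/x)\<close> by time \<open>x/2\<close> with the required probability. From height \<open>y\<close> the law
  of its path is at least \<open>W 1 / W y\<close> times that of the path from \<open>1\<close> shifted up by \<open>y - 1\<close>, and the
  exponential functional started from \<open>1\<close> has finite expectation.\<close>

section \<open>Cadlag functions\<close>

text \<open>The hypotheses give the law of the conditioned process only through its transition
  kernels and a limit of finite-dimensional distributions. Each estimate is therefore made for an
  expectation of products over a grid, with bounds that survive refinement of the mesh, and stopping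
  times become recursions over grid steps. The absence of positive jumps enters in one quantitative
  form: for increments over the mesh \<open>t / n\<close>, \<open>n\<close> times their exponential
  moment above any fixed \<open>e > 0\<close> tends to \<open>0\<close>. The detour through
  \<open>[1/2, 3/4]\<close> is forced because \<open>W x\<close> may vanish as
  \<open>x \<rightarrow> 0\<close>: a factor \<open>1 / W x\<close> may stand only before terms that
  vanish with the mesh. When \<open>\<sigma> < \<beta>\<close> the function \<open>\<Psi>\<close>
  need not behave like a power, so in the lower bound \<open>\<Psi> (2 * l)\<close> is controlled at
  a dyadic \<open>l\<close> selected by minimality. The finite expectation of the functional has two
  sources: if \<open>\<Psi> l \<le> 0\<close> for some \<open>l > 0\<close>, an exponential moment
  decays; otherwise the visits to each unit strip are counted by last exits.\<close>

lemma cadlag_locally_split: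
  assumes f: "cadlag f" and c: "0 \<le> c" and e: "0 < e"
  obtains r l where "r > 0" "\<And>u. 0 \<le> u \<Longrightarrow> u < c \<Longrightarrow> c - r < u \<Longrightarrow> \<bar>f u - l\<bar> < e"
    "\<And>u. c \<le> u \<Longrightarrow> u < c + r \<Longrightarrow> \<bar>f u - f c\<bar> < e" "0 < c \<Longrightarrow> l = Lim (at_left c) f"
proof -
  have "(f \<longlongrightarrow> f c) (at_right c)" using f c by (auto simp: cadlag_def)
  then have "eventually (\<lambda>u. dist (f u) (f c) < e) (at_right c)" using e by (rule tendstoD)
  then obtain b where b: "b > c" "\<And>y. c < y \<Longrightarrow> y < b \<Longrightarrow> dist (f y) (f c) < e"
    by (auto simp: eventually_at_right[of c "c+1"])
  show thesis
  proof (cases "c = 0")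
    case True
    show ?thesis
      by (rule that[of "b - c" 0]) (use b True e in \<open>auto simp: dist_real_def\<close>, (metis abs_0 diff_self le_less))
  next
    case False
    then obtain l where l: "(f \<longlongrightarrow> l) (at_left c)" using f c unfolding cadlag_def by force
    have lim: "Lim (at_left c) f = l" by (rule tendsto_Lim) (use l in auto)
    have "eventually (\<lambda>u. dist (f u) l < e) (at_left c)" using l e by (rule tendstoD)
    then obtain a where a: "a < c" "\<And>y. a < y \<Longrightarrow> y < c \<Longrightarrow> dist (f y) l < e"
      by (auto simp: eventually_at_left[of "c-1" c])
    show ?thesis
    proof (rule that[of "min (b - c) (c - a)" l])
      fix u assume "c \<le> u" "u < c + min (b - c) (c - a)"
      then show "\<bar>f u - f c\<bar> < e" using b(2)[of u] e by (cases "u = c") (auto simp: dist_real_def)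
    qed (use a b lim in \<open>auto simp: dist_real_def\<close>)
  qed
qed

text \<open>Cover \<open>[0, T]\<close> by balls in which \<open>f\<close> is close to its left
  limit on one side of the centre and to its central value on the other, and take a Lebesgue number.
  An increment across the centre can only lose by the jump, so upward moves stay below
  \<open>e\<close>; downward moves are unrestricted.\<close>

lemma cadlag_increments_le:
  assumes f: "cadlag f" and neg: "\<And>t. t > 0 \<Longrightarrow> f t \<le> Lim (at_left t) f" and e: "0 < e"
  obtains d where "d > 0" "\<And>u v. 0 \<le> u \<Longrightarrow> u \<le> v \<Longrightarrow> v \<le> T \<Longrightarrow> v - u < d \<Longrightarrow> f v - f u \<le> e"
proof -
  have "\<exists>r>0. \<forall>u v. 0 \<le> u \<longrightarrow> u \<le> v \<longrightarrow> u \<in> ball c r \<longrightarrow> v \<in> ball c r \<longrightarrow> f v - f u \<le> e"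
    if c: "c \<in> {0..T}" for c
  proof -
    obtain r l where r: "r > 0" "\<And>u. 0 \<le> u \<Longrightarrow> u < c \<Longrightarrow> c - r < u \<Longrightarrow> \<bar>f u - l\<bar> < e / 2"
      "\<And>u. c \<le> u \<Longrightarrow> u < c + r \<Longrightarrow> \<bar>f u - f c\<bar> < e / 2" "0 < c \<Longrightarrow> l = Lim (at_left c) f"
      using cadlag_locally_split[OF f, of c "e/2"] c e by auto
    have "f v - f u \<le> e" if uv: "0 \<le> u" "u \<le> v" "u \<in> ball c r" "v \<in> ball c r" for u v
    proof -
      have "c - r < u" "c - r < v" "u < c + r" "v < c + r" using uv by (auto simp: dist_real_def)
      moreover have "0 < c \<Longrightarrow> f c \<le> l" using r(4) neg by auto
      ultimately show ?thesis
        using r(2)[of u] r(3)[of u] r(2)[of v] r(3)[of v] uv by argo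
    qed
    then show ?thesis using r(1) by blast
  qed
  then obtain r where r: "\<And>c. c \<in> {0..T} \<Longrightarrow> r c > 0"
    "\<And>c u v. c \<in> {0..T} \<Longrightarrow> 0 \<le> u \<Longrightarrow> u \<le> v \<Longrightarrow> u \<in> ball c (r c) \<Longrightarrow> v \<in> ball c (r c) \<Longrightarrow> f v - f u \<le> e"
    by metis
  have "{0..T} \<subseteq> \<Union> ((\<lambda>c. ball c (r c)) ` {0..T})" using r(1) by force
  from Heine_Borel_lemma[OF compact_Icc this] obtain d where d: "d > 0"
    "\<And>x. x \<in> {0..T} \<Longrightarrow> \<exists>G\<in>(\<lambda>c. ball c (r c)) ` {0..T}. ball x d \<subseteq> G" by blast
  show thesis
  proof (rule that[of d])
    fix u v assume uv: "0 \<le> u" "u \<le> v" "v \<le> T" "v - u < d"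
    then obtain c where c: "c \<in> {0..T}" "ball u d \<subseteq> ball c (r c)" using d(2)[of u] by auto
    have "u \<in> ball u d" "v \<in> ball u d" using uv d(1) by (auto simp: dist_real_def)
    then show "f v - f u \<le> e" using r(2)[OF c(1) uv(1,2)] c(2) by blast
  qed (rule d(1))
qed

lemma cadlag_bounded:
  assumes f: "cadlag f"
  shows "\<exists>B. \<forall>s\<in>{0..T}. \<bar>f s\<bar> \<le> B"
proof -
  have "\<exists>r>0. \<exists>B. \<forall>u. 0 \<le> u \<longrightarrow> u \<in> ball c r \<longrightarrow> \<bar>f u\<bar> \<le> B" if c: "c \<in> {0..T}" for c
  proof -
    obtain r l where r: "r > 0" "\<And>u. 0 \<le> u \<Longrightarrow> u < c \<Longrightarrow> c - r < u \<Longrightarrow> \<bar>f u - l\<bar> < 1"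
      "\<And>u. c \<le> u \<Longrightarrow> u < c + r \<Longrightarrow> \<bar>f u - f c\<bar> < 1"
      using cadlag_locally_split[OF f, of c 1] c by (metis atLeastAtMost_iff zero_less_one)
    have "\<bar>f u\<bar> \<le> \<bar>l\<bar> + \<bar>f c\<bar> + 1" if u: "0 \<le> u" "u \<in> ball c r" for u
    proof -
      have "c - r < u" "u < c + r" using u by (auto simp: dist_real_def)
      then show ?thesis using r(2)[of u] r(3)[of u] u by argo
    qed
    then show ?thesis using r(1) by blast
  qed
  then obtain r B where r: "\<And>c. c \<in> {0..T} \<Longrightarrow> r c > 0"
    "\<And>c u. c \<in> {0..T} \<Longrightarrow> 0 \<le> u \<Longrightarrow> u \<in> ball c (r c) \<Longrightarrow> \<bar>f u\<bar> \<le> B c"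
    by metis
  have cov: "{0..T} \<subseteq> (\<Union>c\<in>{0..T}. ball c (r c))" using r(1) by force
  obtain C where C: "C \<subseteq> {0..T}" "finite C" "{0..T} \<subseteq> (\<Union>c\<in>C. ball c (r c))"
    by (rule compactE_image[OF compact_Icc _ cov]) auto
  have "\<bar>f s\<bar> \<le> (\<Sum>c\<in>C. \<bar>B c\<bar>)" if s: "s \<in> {0..T}" for s
  proof -
    obtain c where c: "c \<in> C" "s \<in> ball c (r c)" using C(3) s by blast
    then have "\<bar>f s\<bar> \<le> \<bar>B c\<bar>" using r(2)[of c s] C(1) s by force
    also have "\<dots> \<le> (\<Sum>c\<in>C. \<bar>B c\<bar>)" using c C(2) by (intro member_le_sum) auto
    finally show ?thesis .
  qed
  then show ?thesis by blast
qed

text \<open>Rounding up keeps the grid points at or to the right of \<open>s\<close> and within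
  \<open>h n\<close> of it, so right continuity is exactly what the limit uses.\<close>

lemma tendsto_ceiling_grid:
  fixes s :: real and g :: "real \<Rightarrow> real"
  assumes h: "\<And>n. h n > 0" "h \<longlonglongrightarrow> 0"
    and g: "(g \<longlongrightarrow> g s) (at_right s)"
  shows "(\<lambda>n. g (of_int \<lceil>s / h n\<rceil> * h n)) \<longlonglongrightarrow> g s"
proof -
  let ?s = "\<lambda>n. of_int \<lceil>s / h n\<rceil> * h n"
  have lb: "s \<le> ?s n" for n using h(1)[of n] by (metis le_of_int_ceiling pos_divide_le_eq)
  have "?s n \<le> (s / h n + 1) * h n" for n
    using h(1)[of n] by (intro mult_right_mono) (linarith, simp)
  moreover have "(s / h n + 1) * h n = s + h n" for n
    using h(1)[of n] by (simp add: distrib_right)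
  ultimately have ub: "?s n \<le> s + h n" for n by simp
  have "(\<lambda>n. s + h n) \<longlonglongrightarrow> s + 0" by (intro tendsto_intros h)
  then have lim: "?s \<longlonglongrightarrow> s"
    by (intro tendsto_sandwich[of "\<lambda>_. s" ?s _ "\<lambda>n. s + h n" s]) (use lb ub in auto)
  show ?thesis
  proof (rule tendstoI)
    fix e :: real assume e: "e > 0"
    have "eventually (\<lambda>u. dist (g u) (g s) < e) (at_right s)" using g e by (rule tendstoD)
    then obtain b where b: "b > s" "\<And>y. s < y \<Longrightarrow> y < b \<Longrightarrow> dist (g y) (g s) < e"
      by (auto simp: eventually_at_right[of s "s+1"])
    have "eventually (\<lambda>n. ?s n < b) sequentially" using lim b(1) by (rule order_tendstoD)
    then show "eventually (\<lambda>n. dist (g (?s n)) (g s) < e) sequentially"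
    proof eventually_elim
      case (elim n)
      then show ?case using b(2)[of "?s n"] lb[of n] e by (cases "?s n = s") auto
    qed
  qed
qed

text \<open>The nontrivial direction rounds each \<open>s\<close> up to the dyadic grid and lets the
  mesh shrink. The weak inequality survives this limit, and \<open>s \<le> t\<close> keeps the
  rounded index at most \<open>2^n\<close>.\<close>

lemma le_INF_cadlag_iff_dyadic:
  fixes c :: real
  assumes f: "cadlag f" and t: "t > 0"
  shows "c \<le> (INF s\<in>{0..t}. f s) \<longleftrightarrow> (\<forall>n. \<forall>k\<le>2^n. c \<le> f (real k * (t / 2^n)))"
proof
  assume L: "c \<le> (INF s\<in>{0..t}. f s)"
  obtain B where "\<And>s. s \<in> {0..t} \<Longrightarrow> \<bar>f s\<bar> \<le> B" using cadlag_bounded[OF f] by blast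
  then have bdd: "bdd_below (f ` {0..t})" by (intro bdd_belowI2[of _ "- B"]) force
  show "\<forall>n. \<forall>k\<le>2^n. c \<le> f (real k * (t / 2^n))"
  proof safe
    fix n k :: nat assume k: "k \<le> 2 ^ n"
    have "real k \<le> 2 ^ n" using k by (metis of_nat_le_iff of_nat_numeral of_nat_power)
    then have "real k * (t / 2^n) \<le> 2^n * (t / 2^n)" using t by (intro mult_right_mono) auto
    then have "real k * (t / 2^n) \<in> {0..t}" using t by auto
    then show "c \<le> f (real k * (t / 2^n))" using L cINF_lower[OF bdd] by (meson order_trans)
  qed
next
  assume R: "\<forall>n. \<forall>k\<le>2^n. c \<le> f (real k * (t / 2^n))"
  have "c \<le> f s" if s: "s \<in> {0..t}" for s
  proof -
    let ?h = "\<lambda>n. t / 2^n"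
    have "(\<lambda>n. f (of_int \<lceil>s / ?h n\<rceil> * ?h n)) \<longlonglongrightarrow> f s"
    proof (rule tendsto_ceiling_grid)
      show "?h \<longlonglongrightarrow> 0" by real_asymp
      show "(f \<longlongrightarrow> f s) (at_right s)" using f s by (auto simp: cadlag_def)
    qed (use t in auto)
    moreover have "c \<le> f (of_int \<lceil>s / ?h n\<rceil> * ?h n)" for n
    proof -
      let ?k = "nat \<lceil>s / ?h n\<rceil>"
      have "0 \<le> s / ?h n" using s t by auto
      moreover have "s / ?h n \<le> 2^n" using s t by (simp add: field_simps)
      ultimately have "real ?k = of_int \<lceil>s / ?h n\<rceil>" "?k \<le> 2^n"
        by (auto simp: of_nat_nat nat_le_iff ceiling_le_iff)
      then show ?thesis using R by metis
    qed
    ultimately show ?thesis by (intro LIMSEQ_le_const) auto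
  qed
  then show "c \<le> (INF s\<in>{0..t}. f s)" using t by (intro cINF_greatest) auto
qed

section \<open>Riemann sums of right-continuous functions\<close>

lemma integrable_indicator_Ioc:
  fixes a b c :: real
  shows "integrable lborel (\<lambda>s. c * indicator {a<..b} s)"
proof (cases "a \<le> b")
  case True
  then show ?thesis by (intro integrable_mult_right integrable_real_indicator) auto
qed auto

text \<open>The step functions taking the value of \<open>g\<close> at the right end of each cell
  converge pointwise by right continuity, and the bound \<open>B\<close> gives dominated
  convergence.\<close>

lemma riemann_sum_tendsto:
  fixes g :: "real \<Rightarrow> real"
  assumes T: "T > 0" and g: "\<And>s. s \<ge> 0 \<Longrightarrow> (g \<longlongrightarrow> g s) (at_right s)"
    and bd: "\<And>s. s \<ge> 0 \<Longrightarrow> 0 \<le> g s \<and> g s \<le> B"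
    and r: "filterlim r at_top sequentially" "\<And>n. r n > (0::nat)"
  shows "(\<lambda>n. ennreal (\<Sum>k=1..r n. g (real k * (T / r n)) * (T / r n)))
     \<longlonglongrightarrow> (\<integral>\<^sup>+s\<in>{0..T}. ennreal (g s) \<partial>lborel)"
proof -
  let ?h = "\<lambda>n. T / real (r n)"
  let ?s = "\<lambda>n s. of_int \<lceil>s / ?h n\<rceil> * ?h n"
  let ?g = "\<lambda>n s. g (?s n s) * indicator {0..T} s"
  have hp: "?h n > 0" for n using T r(2) by auto
  have h0: "?h \<longlonglongrightarrow> 0"
    by (intro tendsto_divide_0[OF tendsto_const] filterlim_at_top_imp_at_infinity
        filterlim_compose[OF filterlim_real_sequentially r(1)])
  have lim: "(\<lambda>n. ?g n s) \<longlonglongrightarrow> g s * indicator {0..T} s" for s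
  proof (cases "s \<in> {0..T}")
    case True
    then show ?thesis using tendsto_ceiling_grid[where h="?h" and g=g and s=s, OF hp h0 g[of s]] by auto
  qed auto
  \<comment> \<open>The composition factors through the integer-valued ceiling, on which every
    function is measurable; the limit inherits measurability below.\<close>
  have meas_n[measurable]: "(\<lambda>s. ?g n s) \<in> borel_measurable borel" for n
  proof -
    have "(\<lambda>s. \<lceil>s / ?h n\<rceil>) \<in> measurable borel (count_space UNIV)" by measurable
    moreover have "(\<lambda>i::int. g (of_int i * ?h n)) \<in> measurable (count_space UNIV) borel" by simp
    ultimately have "(\<lambda>s. g (?s n s)) \<in> borel_measurable borel" by (rule measurable_compose)
    then show ?thesis by measurable
  qed
  have sge: "?s n s \<ge> 0" if "s \<ge> 0" for n s
  proof -
    have "0 \<le> s / ?h n" using that hp[of n] by (intro divide_nonneg_pos)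
    then have "0 \<le> \<lceil>s / ?h n\<rceil>" by linarith
    then show ?thesis using hp[of n] by (intro mult_nonneg_nonneg) auto
  qed
  have meas[measurable]: "(\<lambda>s. g s * indicator {0..T} s) \<in> borel_measurable borel"
    using lim by (rule borel_measurable_LIMSEQ_real) simp
  have B0: "0 \<le> B" using bd[of 0] by auto
  have intB: "integrable lborel (\<lambda>s. B * indicator {0..T} s)"
    using T by (intro integrable_mult_right integrable_real_indicator) (auto simp: emeasure_lborel_Icc_eq)
  have int: "(\<lambda>n. LINT s|lborel. ?g n s) \<longlonglongrightarrow> (LINT s|lborel. g s * indicator {0..T} s)"
  proof (rule integral_dominated_convergence[where w="\<lambda>s. B * indicator {0..T} s"])
    show "AE s in lborel. (\<lambda>n. ?g n s) \<longlonglongrightarrow> g s * indicator {0..T} s" using lim by auto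
    show "AE s in lborel. norm (?g n s) \<le> B * indicator {0..T} s" for n
      using bd[OF sge] by (auto simp: indicator_def)
    show "integrable lborel (\<lambda>s. B * indicator {0..T} s)" by (rule intB)
  qed auto
  have sumeq: "(LINT s|lborel. ?g n s) = (\<Sum>k=1..r n. g (real k * ?h n) * ?h n)" for n
  proof -
    \<comment> \<open>The half-open cells miss \<open>s = 0\<close>, which belongs to the closed
      interval; this single point is discarded by the almost-everywhere congruence further
      down.\<close>
    have eq: "?g n s = (\<Sum>k=1..r n. g (real k * ?h n) * indicator {real (k-1) * ?h n<..real k * ?h n} s)"
      if s0: "s \<noteq> 0" for s
    proof (cases "s \<in> {0..T}")
      case True
      let ?k = "nat \<lceil>s / ?h n\<rceil>"
      have sp: "0 < s / ?h n" using True s0 hp[of n] by (metis atLeastAtMost_iff divide_pos_pos order_le_imp_less_or_eq)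
      have "r n * ?h n = T" using r(2)[of n] by simp
      then have "s / ?h n \<le> r n" using True hp[of n] by (metis atLeastAtMost_iff pos_divide_le_eq)
      then have k: "real ?k = of_int \<lceil>s / ?h n\<rceil>" "?k \<le> r n" "1 \<le> ?k"
        using sp by (auto simp: nat_le_iff ceiling_le_iff, linarith)
      have ind: "s \<in> {real (k-1) * ?h n<..real k * ?h n} \<longleftrightarrow> k = ?k" if k1: "k \<in> {1..r n}" for k
      proof -
        have "s \<in> {real (k-1) * ?h n<..real k * ?h n} \<longleftrightarrow> real (k - 1) < s / ?h n \<and> s / ?h n \<le> real k"
          using hp[of n] by (simp only: greaterThanAtMost_iff pos_less_divide_eq pos_divide_le_eq)
        also have "\<dots> \<longleftrightarrow> \<lceil>s / ?h n\<rceil> = int k"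
          using k1 by (subst ceiling_eq_iff) (auto simp: of_nat_diff)
        also have "\<dots> \<longleftrightarrow> k = ?k" using k1 by auto
        finally show ?thesis .
      qed
      have "(\<Sum>k=1..r n. g (real k * ?h n) * indicator {real (k-1) * ?h n<..real k * ?h n} s)
          = (\<Sum>k\<in>{1..r n}. if k = ?k then g (real k * ?h n) else 0)"
        using ind by (intro sum.cong) (auto simp: indicator_def)
      also have "\<dots> = g (real ?k * ?h n)" using k by (subst sum.delta) auto
      finally show ?thesis using True k(1) by simp
    next
      case False
      have "s \<notin> {real (k-1) * ?h n<..real k * ?h n}" if "k \<in> {1..r n}" for k
      proof
        assume a: "s \<in> {real (k-1) * ?h n<..real k * ?h n}"
        have "0 \<le> real (k-1) * ?h n" using hp[of n] by (intro mult_nonneg_nonneg) auto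
        moreover have "real k * ?h n \<le> r n * ?h n" using that hp[of n] by (intro mult_right_mono) auto
        moreover have "r n * ?h n = T" using r(2)[of n] by simp
        ultimately have "s \<in> {0..T}" using a unfolding greaterThanAtMost_iff atLeastAtMost_iff by linarith
        then show False using False by simp
      qed
      then have "(\<Sum>k=1..r n. g (real k * ?h n) * indicator {real (k-1) * ?h n<..real k * ?h n} s) = 0"
        by (intro sum.neutral ballI) (simp only: indicator_simps mult_zero_right if_False simp_thms)
      then show ?thesis using False by simp
    qed
    have "(LINT s|lborel. ?g n s)
       = (LINT s|lborel. (\<Sum>k=1..r n. g (real k * ?h n) * indicator {real (k-1) * ?h n<..real k * ?h n} s))"
    proof (rule integral_cong_AE)
      show "AE s in lborel. ?g n s = (\<Sum>k=1..r n. g (real k * ?h n) * indicator {real (k-1) * ?h n<..real k * ?h n} s)"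
        using AE_lborel_singleton[of 0] by eventually_elim (rule eq)
    qed measurable
    also have "\<dots> = (\<Sum>k=1..r n. g (real k * ?h n) * measure lborel {real (k-1) * ?h n<..real k * ?h n})"
    proof (subst Bochner_Integration.integral_sum)
      show "integrable lborel (\<lambda>s. g (real k * ?h n) * indicator {real (k-1) * ?h n<..real k * ?h n} s)" for k
        by (rule integrable_indicator_Ioc)
    qed (simp only: integral_mult_right_zero Bochner_Integration.integral_indicator Int_UNIV_right space_lborel space_borel)
    also have "\<dots> = (\<Sum>k=1..r n. g (real k * ?h n) * ?h n)"
    proof (intro sum.cong refl)
      fix k assume "k \<in> {1..r n}"
      then have "real (k-1) * ?h n \<le> real k * ?h n" using hp[of n] by (intro mult_right_mono) auto
      then have "measure lborel {real (k-1) * ?h n<..real k * ?h n} = real k * ?h n - real (k-1) * ?h n"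
        by (rule measure_lborel_Ioc)
      also have "\<dots> = ?h n"
      proof -
        have "real (k - 1) = real k - 1" using \<open>k \<in> {1..r n}\<close> by (simp add: of_nat_diff)
        then show ?thesis by (simp only: left_diff_distrib)
      qed
      finally show "g (real k * ?h n) * measure lborel {real (k-1) * ?h n<..real k * ?h n} = g (real k * ?h n) * ?h n"
        by simp
    qed
    finally show ?thesis .
  qed
  have "ennreal (LINT s|lborel. g s * indicator {0..T} s) = (\<integral>\<^sup>+s. ennreal (g s * indicator {0..T} s) \<partial>lborel)"
  proof (rule nn_integral_eq_integral[symmetric])
    show "integrable lborel (\<lambda>s. g s * indicator {0..T} s)"
    proof (rule Bochner_Integration.integrable_bound)
      show "integrable lborel (\<lambda>s. B * indicator {0..T} s)" by (rule intB)
      show "AE s in lborel. norm (g s * indicator {0..T} s) \<le> norm (B * indicator {0..T} s)"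
        using bd B0 by (intro AE_I2) (auto simp: indicator_def)
    qed measurable
    show "AE s in lborel. 0 \<le> g s * indicator {0..T} s"
      using bd by (intro AE_I2) (auto simp: indicator_def)
  qed
  also have "\<dots> = (\<integral>\<^sup>+s\<in>{0..T}. ennreal (g s) \<partial>lborel)"
    by (intro nn_integral_cong) (auto simp: indicator_def)
  finally have eq: "ennreal (LINT s|lborel. g s * indicator {0..T} s) = (\<integral>\<^sup>+s\<in>{0..T}. ennreal (g s) \<partial>lborel)" .
  show ?thesis using tendsto_ennrealI[OF int] unfolding sumeq eq .
qed

section \<open>The Harris inequality\<close>

text \<open>This is \<open>(a' - a) * (b' - b) \<ge> 0\<close>, written without subtraction so that
  infinite values are harmless.\<close>

lemma ennreal_rearrange:
  fixes a a' b b' :: ennreal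
  assumes "a \<le> a'" "b \<le> b'"
  shows "a * b' + a' * b \<le> a * b + a' * b'"
proof -
  obtain c d where "a' = a + c" "b' = b + d" using assms by (metis le_iff_add)
  then show ?thesis by (auto simp: algebra_simps intro!: add_mono)
qed

text \<open>Two independent copies: integrating the rearrangement inequality at \<open>x\<close> and
  \<open>y\<close> over the product measure produces twice each side.\<close>

lemma nn_integral_Chebyshev:
  fixes f g :: "real \<Rightarrow> ennreal"
  assumes P: "prob_space P" "sets P = sets borel" and fg: "mono f" "mono g"
    and [measurable]: "f \<in> borel_measurable borel" "g \<in> borel_measurable borel"
  shows "(\<integral>\<^sup>+x. f x \<partial>P) * (\<integral>\<^sup>+x. g x \<partial>P) \<le> (\<integral>\<^sup>+x. f x * g x \<partial>P)"
proof -
  interpret prob_space P by fact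
  note P(2)[measurable_cong]
  let ?F = "\<integral>\<^sup>+x. f x \<partial>P" and ?G = "\<integral>\<^sup>+x. g x \<partial>P" and ?H = "\<integral>\<^sup>+x. f x * g x \<partial>P"
  have le: "f x * g y + f y * g x \<le> f x * g x + f y * g y" for x y
  proof (cases "x \<le> y")
    case True
    then show ?thesis using ennreal_rearrange[of "f x" "f y" "g x" "g y"] fg by (auto simp: mono_def)
  next
    case False
    then show ?thesis using ennreal_rearrange[of "f y" "f x" "g y" "g x"] fg
      by (auto simp: mono_def add.commute)
  qed
  have "2 * (?F * ?G) = (\<integral>\<^sup>+x. (\<integral>\<^sup>+y. f x * g y + f y * g x \<partial>P) \<partial>P)"
    by (simp add: nn_integral_add nn_integral_cmult nn_integral_multc mult_2 mult.commute)
  also have "\<dots> \<le> (\<integral>\<^sup>+x. (\<integral>\<^sup>+y. f x * g x + f y * g y \<partial>P) \<partial>P)"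
    by (intro nn_integral_mono le)
  also have "\<dots> = 2 * ?H"
    by (simp add: nn_integral_add emeasure_space_1 mult_2)
  finally show ?thesis by (subst (asm) ennreal_mult_le_mult_iff) auto
qed

text \<open>Induction on the coordinates. Integrating out the coordinates in \<open>I\<close> leaves
  increasing functions of the new one, to which the one-dimensional inequality applies; the
  induction hypothesis then treats the inner product for each fixed value. Monotonicity is asked on
  \<open>extensional\<close> functions, which is where the product measure lives.\<close>

lemma nn_integral_PiM_Harris:
  fixes P :: "'i \<Rightarrow> real measure" and f g :: "('i \<Rightarrow> real) \<Rightarrow> ennreal"
  assumes P: "\<And>i. prob_space (P i)" "\<And>i. sets (P i) = sets borel" and I: "finite I"
    and f: "f \<in> borel_measurable (PiM I (\<lambda>_. borel))"
      "\<And>x y. x \<in> extensional I \<Longrightarrow> y \<in> extensional I \<Longrightarrow> (\<And>i. i \<in> I \<Longrightarrow> x i \<le> y i) \<Longrightarrow> f x \<le> f y"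
    and g: "g \<in> borel_measurable (PiM I (\<lambda>_. borel))"
      "\<And>x y. x \<in> extensional I \<Longrightarrow> y \<in> extensional I \<Longrightarrow> (\<And>i. i \<in> I \<Longrightarrow> x i \<le> y i) \<Longrightarrow> g x \<le> g y"
  shows "(\<integral>\<^sup>+x. f x \<partial>PiM I P) * (\<integral>\<^sup>+x. g x \<partial>PiM I P) \<le> (\<integral>\<^sup>+x. f x * g x \<partial>PiM I P)"
  using I f g
proof (induction I arbitrary: f g rule: finite_induct)
  case empty
  interpret product_sigma_finite P
    using P(1) by (intro product_sigma_finite.intro prob_space_imp_sigma_finite)
  show ?case by (simp add: nn_integral_empty)
next
  case (insert i I)
  interpret product_sigma_finite P
    using P(1) by (intro product_sigma_finite.intro prob_space_imp_sigma_finite)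
  have [measurable_cong]: "sets (P j) = sets borel" for j by fact
  have sets_eq[measurable_cong]: "sets (PiM J P) = sets (PiM J (\<lambda>_. borel))" for J
    using P(2) by (intro sets_PiM_cong) auto
  have ext: "x(i := y) \<in> extensional (insert i I)" if "x \<in> extensional I" for x and y :: real
    using that by (auto simp: extensional_def)
  have sp: "space (PiM I P) \<subseteq> extensional I" by (auto simp: space_PiM PiE_def)
  have upd: "(\<lambda>(x, y). x(i := y)) \<in> measurable (PiM I (\<lambda>_. borel :: real measure) \<Otimes>\<^sub>M borel) (PiM (insert i I) (\<lambda>_. borel))"
    using measurable_add_dim[of i I "\<lambda>_. borel :: real measure"] by simp
  note [measurable] = insert.prems(1) insert.prems(3)
  have fm: "(\<lambda>x. f (x(i := y))) \<in> borel_measurable (PiM I (\<lambda>_. borel))"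
    and gm: "(\<lambda>x. g (x(i := y))) \<in> borel_measurable (PiM I (\<lambda>_. borel))" for y
    by (auto intro!: measurable_compose[OF measurable_fun_upd insert.prems(1)]
        measurable_compose[OF measurable_fun_upd insert.prems(3)])
  interpret PI: prob_space "PiM I P" by (intro prob_space_PiM P)
  let ?F = "\<lambda>y. \<integral>\<^sup>+x. f (x(i := y)) \<partial>PiM I P" and ?G = "\<lambda>y. \<integral>\<^sup>+x. g (x(i := y)) \<partial>PiM I P"
  have mono: "mono ?F" "mono ?G"
    using sp by (auto intro!: monoI nn_integral_mono insert.prems(2,4) ext)
  have "(\<lambda>(y, x). f (x(i := y))) \<in> borel_measurable (borel \<Otimes>\<^sub>M PiM I P)"
    and "(\<lambda>(y, x). g (x(i := y))) \<in> borel_measurable (borel \<Otimes>\<^sub>M PiM I P)"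
    using measurable_compose[OF measurable_pair_swap' measurable_compose[OF upd insert.prems(1)]]
     measurable_compose[OF measurable_pair_swap' measurable_compose[OF upd insert.prems(3)]]
    by (simp_all add: split_beta' cong: measurable_cong_sets)
  then have meas: "?F \<in> borel_measurable borel" "?G \<in> borel_measurable borel"
    by (auto intro!: PI.borel_measurable_nn_integral)
  have "(\<integral>\<^sup>+y. ?F y \<partial>P i) * (\<integral>\<^sup>+y. ?G y \<partial>P i) \<le> (\<integral>\<^sup>+y. ?F y * ?G y \<partial>P i)"
    by (rule nn_integral_Chebyshev[OF P(1,2) mono meas])
  also have "\<dots> \<le> (\<integral>\<^sup>+y. (\<integral>\<^sup>+x. f (x(i := y)) * g (x(i := y)) \<partial>PiM I P) \<partial>P i)"
    by (intro nn_integral_mono insert.IH fm gm insert.prems(2,4) ext) auto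
  finally show ?case
    using insert.hyps insert.prems(1,3) by (simp add: product_nn_integral_insert_rev sets_eq cong: measurable_cong_sets)
qed

section \<open>The Laplace exponent of a spectrally negative process\<close>

text \<open>The difference of the two sides has derivative \<open>- 2 * (1 - exp x)^2\<close> and
  vanishes at \<open>0\<close>. With \<open>u = l * v\<close> the right side is the part of
  \<open>doubling_test\<close> that yields \<open>4 * \<Psi> l - \<Psi> (2 * l)\<close>.\<close>

lemma exp_comb_le_linear:
  assumes "u \<le> (0::real)" shows "2 * u \<le> 4 * exp u - exp (2 * u) - 3"
proof -
  let ?f = "\<lambda>u::real. 4 * exp u - exp (2 * u) - 3 - 2 * u"
  have "?f u \<ge> ?f 0"
  proof (rule DERIV_nonpos_imp_nonincreasing[OF assms])
    fix x :: real
    have "(?f has_real_derivative (- 2 * (1 - exp x)^2)) (at x)"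
      by (auto intro!: derivative_eq_intros simp: power2_eq_square algebra_simps mult_exp_exp)
    then show "\<exists>y. (?f has_real_derivative y) (at x) \<and> y \<le> 0"
      by (intro exI[of _ "- 2 * (1 - exp x)^2"]) auto
  qed
  then show ?thesis by simp
qed

text \<open>The derivative of the difference factors with roots at \<open>exp x = 1\<close> and
  \<open>exp x = 1/2\<close>, which fixes the range. Some restriction is unavoidable: for very
  negative \<open>v\<close> the left side stays near \<open>- 2\<close>.\<close>

lemma exp_comb_le_self:
  assumes "v \<le> (0::real)" "1/2 \<le> exp v" shows "3 * exp v - exp (2 * v) - 2 \<le> v"
proof -
  let ?f = "\<lambda>v::real. v - (3 * exp v - exp (2 * v) - 2)"
  have "?f v \<ge> ?f 0"
  proof (rule DERIV_nonpos_imp_nonincreasing[OF assms(1)])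
    fix x :: real assume x: "v \<le> x" "x \<le> 0"
    have "(?f has_real_derivative ((2 * exp x - 1) * (exp x - 1))) (at x)"
      by (auto intro!: derivative_eq_intros simp: power2_eq_square algebra_simps mult_exp_exp)
    moreover have "exp v \<le> exp x" "exp x \<le> 1" using x by auto
    then have "(2 * exp x - 1) * (exp x - 1) \<le> 0" using assms(2) by (intro mult_nonneg_nonpos; linarith)
    ultimately show "\<exists>y. (?f has_real_derivative y) (at x) \<and> y \<le> 0" by blast
  qed
  then show ?thesis by simp
qed

text \<open>Testing \<open>V t\<close> for small \<open>t\<close> against this function replaces the Levy-Khintchine formula, by which
  \<open>\<Psi>''\<close> is decreasing. The coefficients make the function vanish to first order at \<open>0\<close> with second
  derivative \<open>2 * l > 0\<close>, so that it is nonnegative on the jumps of \<open>V\<close> and near \<open>0\<close>.\<close>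

definition doubling_test :: "real \<Rightarrow> real \<Rightarrow> real" where
  "doubling_test l v = 4 * exp (l * v) - exp (2 * l * v) - 3 - 2 * l * (3 * exp v - exp (2 * v) - 2)"

text \<open>Near \<open>0\<close> both groups of terms are compared with the same linear function
  \<open>2 * l * v\<close>. Away from \<open>0\<close> the correction
  \<open>3 * exp v - exp (2 * v) - 2\<close> is at most \<open>- 3/4\<close>, so for
  \<open>l \<ge> 2\<close> it contributes at least \<open>3\<close>, which offsets the constant
  \<open>- 3\<close>.\<close>

lemma doubling_test_nonpos:
  assumes l: "2 \<le> l" and v: "v \<le> 0" shows "0 \<le> doubling_test l v"
proof (cases "1/2 \<le> exp v")
  case True
  have "2 * (l * v) \<le> 4 * exp (l * v) - exp (2 * (l * v)) - 3"
    using l v by (intro exp_comb_le_linear) (auto intro: mult_nonneg_nonpos)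
  moreover have "2 * l * (3 * exp v - exp (2 * v) - 2) \<le> 2 * l * v"
    using exp_comb_le_self[OF v True] l by (intro mult_left_mono) auto
  ultimately show ?thesis by (simp add: doubling_test_def mult.assoc)
next
  case False
  define s where "s = exp v"
  have s: "s < 1/2" "0 < s" using False by (auto simp: s_def)
  have e2: "exp (2 * v) = s * s" by (simp add: s_def mult_exp_exp)
  have "0 \<le> (1/2 - s) * (5/2 - s)" using s by (intro mult_nonneg_nonneg) auto
  then have "3 * s - s * s - 2 \<le> - 3/4" by (simp add: field_simps)
  then have "2 * l * (3 * s - s * s - 2) \<le> 2 * l * (-3/4)" using l by (intro mult_left_mono) auto
  also have "\<dots> \<le> - 3" using l by simp
  finally have *: "2 * l * (3 * s - s * s - 2) \<le> - 3" .
  define r where "r = exp (l * v)"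
  have "l * v \<le> 0" using l v by (intro mult_nonneg_nonpos) auto
  then have r: "0 < r" "r \<le> 1" by (auto simp: r_def)
  have "exp (2 * l * v) = r * r" by (simp add: r_def mult_exp_exp)
  moreover have "r * r \<le> 4 * r" using r by (intro mult_right_mono) auto
  ultimately show ?thesis using * unfolding doubling_test_def e2 s_def[symmetric] r_def[symmetric] by linarith
qed

lemma doubling_test_pos_near_0:
  assumes l: "0 < l"
  obtains e where "0 < e" "\<And>v. 0 \<le> v \<Longrightarrow> v \<le> e \<Longrightarrow> 0 \<le> doubling_test l v"
proof -
  have "eventually (\<lambda>v. doubling_test l v > 0) (at_right 0)"
    unfolding doubling_test_def using l by real_asymp
  then obtain b where b: "b > 0" "\<And>y. 0 < y \<Longrightarrow> y < b \<Longrightarrow> doubling_test l y > 0"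
    by (auto simp: eventually_at_right[of 0 1])
  have "doubling_test l 0 = 0" by (simp add: doubling_test_def)
  then show thesis using b by (intro that[of "b/2"]) (auto, smt (verit) field_sum_of_halves)
qed

lemma doubling_test_ge:
  assumes l: "1 \<le> l" and v: "0 \<le> v" shows "- ((1 + 6 * l) * exp (2 * l * v)) \<le> doubling_test l v"
proof -
  have "v \<le> 2 * l * v" using l v by (simp add: mult_le_cancel_right1)
  then have "exp v \<le> exp (2 * l * v)" by simp
  then have "6 * l * exp v \<le> 6 * l * exp (2 * l * v)" using l by (intro mult_left_mono) auto
  moreover have "1 \<le> exp (l * v)" using l v by simp
  moreover have "0 \<le> 2 * l * exp (2 * v)" using l by simp
  ultimately show ?thesis using l unfolding doubling_test_def distrib_right right_diff_distrib by linarith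
qed

text \<open>The derivative of \<open>exp (x * c)\<close> at \<open>0\<close> along the meshes
  \<open>t / (n + 1)\<close>. With \<open>c = \<Psi> l\<close> it turns the exponential moment of
  one increment, multiplied by the number of steps, into a value of \<open>\<Psi>\<close>.\<close>

lemma tendsto_Suc_exp_minus_1:
  assumes t: "t > 0"
  shows "(\<lambda>n. real (Suc n) * (exp (t / real (Suc n) * c) - 1)) \<longlonglongrightarrow> t * c"
proof -
  have "((\<lambda>x. exp (x * c)) has_real_derivative c) (at 0)" by (auto intro!: derivative_eq_intros)
  then have "((\<lambda>x. (exp (x * c) - 1) / x) \<longlongrightarrow> c) (at 0)" by (simp add: has_field_derivative_iff)
  moreover have "filterlim (\<lambda>n. t / real (Suc n)) (at 0) sequentially"
    using t unfolding filterlim_at by (intro conjI always_eventually) (auto, real_asymp)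
  ultimately have "(\<lambda>n. (exp (t / real (Suc n) * c) - 1) / (t / real (Suc n))) \<longlonglongrightarrow> c"
    by (rule filterlim_compose)
  from tendsto_mult_left[OF this, of t] show ?thesis using t by (simp add: mult_ac del: of_nat_Suc)
qed

section \<open>Increments and exponential moments\<close>

locale sn_levy = prob_space M for M :: "'a measure" +
  fixes V :: "real \<Rightarrow> 'a \<Rightarrow> real" and \<Psi> :: "real \<Rightarrow> real"
  assumes sn: "spectrally_negative_levy M V" and lap: "laplace_exponent M V \<Psi>"
begin

lemma V_measurable[measurable]: "0 \<le> t \<Longrightarrow> V t \<in> borel_measurable M"
  using sn by (auto simp: spectrally_negative_levy_def levy_process_def)

lemma V_cadlag: "\<omega> \<in> space M \<Longrightarrow> cadlag (\<lambda>t. V t \<omega>)"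
  using sn by (auto simp: spectrally_negative_levy_def levy_process_def)

lemma V_0: "AE \<omega> in M. V 0 \<omega> = 0"
  using sn by (auto simp: spectrally_negative_levy_def levy_process_def)

lemma V_no_pos_jumps: "AE \<omega> in M. \<forall>t>0. V t \<omega> \<le> Lim (at_left t) (\<lambda>s. V s \<omega>)"
  using sn by (auto simp: spectrally_negative_levy_def)

lemma V_stationary: "0 \<le> s \<Longrightarrow> 0 \<le> t \<Longrightarrow> distr M borel (\<lambda>\<omega>. V (s + t) \<omega> - V s \<omega>) = distr M borel (V t)"
  using sn by (auto simp: spectrally_negative_levy_def levy_process_def)

definition incr :: "real \<Rightarrow> nat \<Rightarrow> 'a \<Rightarrow> real" where
  "incr h i \<omega> = V (real (Suc i) * h) \<omega> - V (real i * h) \<omega>"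

lemma incr_measurable[measurable]: "0 \<le> h \<Longrightarrow> incr h i \<in> borel_measurable M"
  unfolding incr_def by measurable

lemma incr_indep: "0 \<le> h \<Longrightarrow> indep_vars (\<lambda>_. borel) (incr h) {..<n}"
proof -
  assume h: "0 \<le> h"
  have "incseq (\<lambda>i. real i * h)" using h by (intro incseq_SucI) (simp add: mult_right_mono)
  then have "indep_vars (\<lambda>_. borel) (\<lambda>i \<omega>. V (real (Suc i) * h) \<omega> - V (real i * h) \<omega>) {..<n}"
  proof -
    have "\<And>n t. 0 \<le> t 0 \<Longrightarrow> incseq t \<Longrightarrow> indep_vars (\<lambda>_. borel) (\<lambda>i \<omega>. V (t (Suc i)) \<omega> - V (t i) \<omega>) {..<n}"
      using sn unfolding spectrally_negative_levy_def levy_process_def by blast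
    from this[of "\<lambda>i. real i * h"] \<open>incseq _\<close> show ?thesis by simp
  qed
  then show ?thesis by (simp add: incr_def[abs_def])
qed

lemma incr_distr: "0 \<le> h \<Longrightarrow> distr M borel (incr h i) = distr M borel (V h)"
  using V_stationary[of "real i * h" h] by (simp add: incr_def[abs_def] algebra_simps)

lemma V_eq_sum_incr: "AE \<omega> in M. \<forall>k. V (real k * h) \<omega> = (\<Sum>i<k. incr h i \<omega>)"
  using V_0
proof eventually_elim
  case (elim \<omega>)
  have "V (real k * h) \<omega> - V (real 0 * h) \<omega> = (\<Sum>i<k. incr h i \<omega>)" for k
    unfolding incr_def by (rule sum_lessThan_telescope[symmetric])
  then show ?case using elim by simp
qed

lemma exp_V_integral: "0 \<le> t \<Longrightarrow> 0 \<le> l \<Longrightarrow> (\<integral>\<omega>. exp (l * V t \<omega>) \<partial>M) = exp (t * \<Psi> l)"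
  using lap by (auto simp: laplace_exponent_def)

text \<open>A non-integrable function has Bochner integral \<open>0\<close>, which is not an
  exponential.\<close>

lemma exp_V_integrable: "0 \<le> t \<Longrightarrow> 0 \<le> l \<Longrightarrow> integrable M (\<lambda>\<omega>. exp (l * V t \<omega>))"
  using exp_V_integral[of t l] not_integrable_integral_eq by (metis exp_not_eq_zero)

lemma Psi_0[simp]: "\<Psi> 0 = 0"
  using exp_V_integral[of 1 0] by (simp add: prob_space)

text \<open>Convexity of \<open>exp\<close> is applied to the tilted exponents
  \<open>a * v - \<Psi> a\<close> and \<open>b * v - \<Psi> b\<close>, whose exponentials both have
  expectation \<open>1\<close> at \<open>v = V 1\<close>.\<close>

lemma Psi_convex: "convex_on {0..} \<Psi>"
proof (rule convex_onI)
  fix s a b :: real assume s: "0 < s" "s < 1" and ab: "a \<in> {0..}" "b \<in> {0..}"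
  let ?m = "(1 - s) * \<Psi> a + s * \<Psi> b" and ?c = "(1 - s) * a + s * b"
  have c: "?c \<ge> 0" using s ab by auto
  have ptw: "exp (?c * v - ?m) \<le> (1 - s) * exp (a * v - \<Psi> a) + s * exp (b * v - \<Psi> b)" for v
  proof -
    have "exp ((1 - s) *\<^sub>R (a * v - \<Psi> a) + s *\<^sub>R (b * v - \<Psi> b)) \<le> (1 - s) * exp (a * v - \<Psi> a) + s * exp (b * v - \<Psi> b)"
      using s by (intro convex_onD[OF exp_convex]) auto
    moreover have "(1 - s) *\<^sub>R (a * v - \<Psi> a) + s *\<^sub>R (b * v - \<Psi> b) = ?c * v - ?m" by (simp add: algebra_simps)
    ultimately show ?thesis by simp
  qed
  have i: "integrable M (\<lambda>\<omega>. exp (x * V 1 \<omega> - y))" if "x \<ge> 0" for x y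
    using exp_V_integrable[of 1 x] that by (simp add: exp_diff)
  have e: "(\<integral>\<omega>. exp (x * V 1 \<omega> - y) \<partial>M) = exp (\<Psi> x - y)" if "x \<ge> 0" for x y
    using exp_V_integral[of 1 x] that by (simp add: exp_diff)
  have "exp (\<Psi> ?c - ?m) = (\<integral>\<omega>. exp (?c * V 1 \<omega> - ?m) \<partial>M)" by (rule e[OF c, symmetric])
  also have "\<dots> \<le> (\<integral>\<omega>. (1 - s) * exp (a * V 1 \<omega> - \<Psi> a) + s * exp (b * V 1 \<omega> - \<Psi> b) \<partial>M)"
    using ab c by (intro integral_mono ptw i Bochner_Integration.integrable_add integrable_mult_right) auto
  also have "\<dots> = 1" using ab i e by simp
  finally have "\<Psi> ?c \<le> ?m" by simp
  then show "\<Psi> ((1 - s) *\<^sub>R a + s *\<^sub>R b) \<le> (1 - s) * \<Psi> a + s * \<Psi> b" by simp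
qed auto

text \<open>With \<open>p n\<close> the probability of an increment larger than \<open>e\<close>, the absence of positive jumps gives
  \<open>(1 - p n) ^ n \<longlonglongrightarrow> 1\<close>, whence \<open>n * p n \<longlonglongrightarrow> 0\<close>.\<close>

lemma jump_prob_tendsto_0:
  assumes t: "t > 0" and e: "e > 0"
  shows "(\<lambda>n. real (Suc n) * prob {\<omega>\<in>space M. e < V (t / Suc n) \<omega>}) \<longlonglongrightarrow> 0"
proof -
  let ?h = "\<lambda>n. t / real (Suc n)"
  define p where "p n = prob {\<omega>\<in>space M. e < V (?h n) \<omega>}" for n
  define G where "G n = {\<omega>\<in>space M. \<forall>k<Suc n. incr (?h n) k \<omega> \<le> e}" for n
  have h: "0 \<le> ?h n" for n using t by auto
  have Gm[measurable]: "G n \<in> sets M" for n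
    unfolding G_def using incr_measurable[OF h[of n]] by measurable
  have "AE \<omega> in M. (\<lambda>n. indicat_real (G n) \<omega>) \<longlonglongrightarrow> 1"
    using V_no_pos_jumps AE_space
  proof eventually_elim
    case (elim \<omega>)
    obtain d where d: "d > 0" "\<And>u v. 0 \<le> u \<Longrightarrow> u \<le> v \<Longrightarrow> v \<le> t \<Longrightarrow> v - u < d \<Longrightarrow> V v \<omega> - V u \<omega> \<le> e"
      using cadlag_increments_le[OF V_cadlag[OF elim(2)], of e t] elim(1) e by blast
    have "(\<lambda>n. ?h n) \<longlonglongrightarrow> 0" by real_asymp
    then have "eventually (\<lambda>n. ?h n < d) sequentially" using d(1) by (rule order_tendstoD)
    then have "eventually (\<lambda>n. indicat_real (G n) \<omega> = 1) sequentially"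
    proof eventually_elim
      case (elim n)
      have "incr (?h n) k \<omega> \<le> e" if k: "k < Suc n" for k
        unfolding incr_def
      proof (rule d(2))
        have "real (Suc k) * ?h n \<le> real (Suc n) * ?h n" using k h[of n] by (intro mult_right_mono) auto
        then show "real (Suc k) * ?h n \<le> t" by simp
        show "real k * ?h n \<le> real (Suc k) * ?h n" using h[of n] by (intro mult_right_mono) auto
        show "0 \<le> real k * ?h n" using h[of n] by (intro mult_nonneg_nonneg) auto
        have "real (Suc k) * ?h n - real k * ?h n = ?h n" by (simp only: left_diff_distrib[symmetric] of_nat_Suc) simp
        then show "real (Suc k) * ?h n - real k * ?h n < d" using elim by simp
      qed
      then show ?case using \<open>\<omega> \<in> space M\<close> by (auto simp: G_def)
    qed
    then show ?case by (rule tendsto_eventually)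
  qed
  then have "(\<lambda>n. \<integral>\<omega>. indicat_real (G n) \<omega> \<partial>M) \<longlonglongrightarrow> (\<integral>\<omega>. 1 \<partial>M)"
    by (intro integral_dominated_convergence[where w="\<lambda>_. 1"]) auto
  then have lim: "(\<lambda>n. prob (G n)) \<longlonglongrightarrow> 1" by (simp add: prob_space)
  have prob_G: "prob (G n) = (1 - p n) ^ Suc n" for n
  proof -
    have "G n = (\<Inter>k\<in>{..<Suc n}. incr (?h n) k -` {..e} \<inter> space M)" by (auto simp: G_def)
    also have "prob \<dots> = (\<Prod>k\<in>{..<Suc n}. prob (incr (?h n) k -` {..e} \<inter> space M))"
      by (rule indep_varsD[OF incr_indep[OF h[of n], of "Suc n"]]) auto
    also have "\<dots> = (\<Prod>k\<in>{..<Suc n}. 1 - p n)"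
    proof (intro prod.cong refl)
      fix k
      have "prob (incr (?h n) k -` {..e} \<inter> space M) = measure (distr M borel (incr (?h n) k)) {..e}"
        using h[of n] by (intro measure_distr[symmetric]) auto
      also have "\<dots> = measure (distr M borel (V (?h n))) {..e}" by (simp only: incr_distr[OF h[of n]])
      also have "\<dots> = prob (V (?h n) -` {..e} \<inter> space M)"
        using h[of n] by (intro measure_distr) auto
      also have "V (?h n) -` {..e} \<inter> space M = space M - {\<omega>\<in>space M. e < V (?h n) \<omega>}" by auto
      also have "prob \<dots> = 1 - p n" unfolding p_def
      proof (rule prob_compl)
        note [measurable] = V_measurable[OF h[of n]]
        show "{\<omega>\<in>space M. e < V (?h n) \<omega>} \<in> sets M" by measurable
      qed
      finally show "prob (incr (?h n) k -` {..e} \<inter> space M) = 1 - p n" .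
    qed
    finally show ?thesis by (simp only: prod_constant card_lessThan)
  qed
  have p01: "0 \<le> p n" "p n \<le> 1" for n by (auto simp: p_def)
  \<comment> \<open>Since \<open>1 - p \<le> exp (- p)\<close>, this exponential lies between
    \<open>prob (G n)\<close> and \<open>1\<close>; taking logarithms gives the claim.\<close>
  have "(\<lambda>n. exp (- (real (Suc n) * p n))) \<longlonglongrightarrow> 1"
  proof (rule tendsto_sandwich[OF _ _ lim])
    have "prob (G n) \<le> exp (- p n) ^ Suc n" for n
      unfolding prob_G using p01[of n] exp_ge_add_one_self[of "- p n"] by (intro power_mono) auto
    then show "eventually (\<lambda>n. prob (G n) \<le> exp (- (real (Suc n) * p n))) sequentially"
      by (simp add: exp_of_nat_mult[symmetric] del: power_Suc of_nat_Suc)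
    show "eventually (\<lambda>n. exp (- (real (Suc n) * p n)) \<le> 1) sequentially"
      using p01 by (intro always_eventually allI) (simp del: of_nat_Suc)
  qed auto
  then have "(\<lambda>n. - ln (exp (- (real (Suc n) * p n)))) \<longlonglongrightarrow> - ln 1" by (intro tendsto_intros) auto
  then show ?thesis by (simp add: p_def del: of_nat_Suc)
qed

lemma exp_V_indicator_integrable:
  assumes t: "0 \<le> t" and l: "0 \<le> l" and A: "A \<in> sets borel"
  shows "integrable M (\<lambda>\<omega>. exp (l * V t \<omega>) * indicator A (V t \<omega>))"
proof (rule Bochner_Integration.integrable_bound[OF exp_V_integrable[OF t l]])
  note [measurable] = V_measurable[OF t] A
  show "(\<lambda>\<omega>. exp (l * V t \<omega>) * indicator A (V t \<omega>)) \<in> borel_measurable M" by measurable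
qed (auto simp: indicator_def)

text \<open>Increments in \<open>(e, K]\<close> contribute at most \<open>exp (l * K)\<close> times
  their probability, which \<open>jump_prob_tendsto_0\<close> controls. Above \<open>K\<close> the
  bound is \<open>exp (- K)\<close> times \<open>exp ((l+1) * v) * (exp v - 1)^2\<close>: this is
  nonnegative, and as a combination of exponentials its coefficients \<open>1, -2, 1\<close> sum to
  zero, so that \<open>n\<close> times its expectation has the finite limit \<open>C\<close>.
  Finally \<open>K\<close> is taken large.\<close>

lemma exp_jump_tendsto_0:
  assumes t: "t > 0" and e: "e > 0" and l: "0 \<le> l"
  shows "(\<lambda>n. real (Suc n) * (\<integral>\<omega>. exp (l * V (t / Suc n) \<omega>) * indicator {e<..} (V (t / Suc n) \<omega>) \<partial>M)) \<longlonglongrightarrow> 0"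
proof -
  let ?h = "\<lambda>n. t / real (Suc n)"
  let ?J = "\<lambda>n. \<integral>\<omega>. exp (l * V (?h n) \<omega>) * indicator {e<..} (V (?h n) \<omega>) \<partial>M"
  define p where "p n = real (Suc n) * prob {\<omega>\<in>space M. e < V (?h n) \<omega>}" for n
  define c where "c n = real (Suc n) * (exp (?h n * \<Psi> (l+3)) - 1) - 2 * (real (Suc n) * (exp (?h n * \<Psi> (l+2)) - 1))
      + real (Suc n) * (exp (?h n * \<Psi> (l+1)) - 1)" for n
  define C where "C = t * \<Psi> (l+3) - 2 * (t * \<Psi> (l+2)) + t * \<Psi> (l+1)"
  have h: "0 \<le> ?h n" for n using t by auto
  have p: "p \<longlonglongrightarrow> 0" unfolding p_def by (rule jump_prob_tendsto_0[OF t e])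
  have c: "c \<longlonglongrightarrow> C" unfolding c_def C_def
    by (intro tendsto_intros tendsto_Suc_exp_minus_1[OF t])
  have bound: "real (Suc n) * ?J n \<le> exp (l * K) * p n + exp (- K) * c n" if K: "K \<ge> 1" for K n
  proof -
    note [measurable] = V_measurable[OF h[of n]]
    note int = exp_V_integrable[OF h[of n]]
    have ptw: "exp (l * v) * indicator {e<..} v \<le> exp (l * K) * indicator {e<..} v +
        exp (- K) * (exp ((l+3) * v) - 2 * exp ((l+2) * v) + exp ((l+1) * v))" for v :: real
    proof -
      have sq: "exp ((l+3) * v) - 2 * exp ((l+2) * v) + exp ((l+1) * v) = exp ((l+1) * v) * (exp v - 1)^2"
        by (simp add: power2_eq_square algebra_simps mult_exp_exp)
      have ge: "0 \<le> exp (- K) * (exp ((l+1) * v) * (exp v - 1)^2)" by simp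
      consider "v \<le> e" | "e < v" "v \<le> K" | "e < v" "K < v" by linarith
      then show ?thesis
      proof cases
        case 2
        then have "l * v \<le> l * K" using l by (intro mult_left_mono)
        then have e: "exp (l * v) \<le> exp (l * K)" by simp
        show ?thesis using add_mono[OF e ge] 2 unfolding sq by simp
      next
        case 3
        have "exp 1 \<le> exp v" using 3 K by simp
        then have "1 \<le> exp v - 1" using exp_ge_add_one_self[of 1] by linarith
        then have "1 \<le> (exp v - 1)^2" by simp
        then have "exp ((l+1) * v) * 1 \<le> exp ((l+1) * v) * (exp v - 1)^2" by (intro mult_left_mono) auto
        moreover have "exp (- K) \<ge> exp (- v)" using 3 by simp
        ultimately have "exp (- v) * exp ((l+1) * v) \<le> exp (- K) * (exp ((l+1) * v) * (exp v - 1)^2)"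
          by (intro mult_mono) auto
        moreover have "exp (- v) * exp ((l+1) * v) = exp (l * v)" by (simp add: mult_exp_exp algebra_simps)
        ultimately show ?thesis using 3 unfolding sq by (simp add: add_increasing)
      qed (use ge sq in auto)
    qed
    have "?J n \<le> (\<integral>\<omega>. exp (l * K) * indicator {e<..} (V (?h n) \<omega>) +
        exp (- K) * (exp ((l+3) * V (?h n) \<omega>) - 2 * exp ((l+2) * V (?h n) \<omega>) + exp ((l+1) * V (?h n) \<omega>)) \<partial>M)"
    proof (intro integral_mono ptw exp_V_indicator_integrable h l)
      show "integrable M (\<lambda>\<omega>. exp (l * K) * indicator {e<..} (V (?h n) \<omega>) +
        exp (- K) * (exp ((l+3) * V (?h n) \<omega>) - 2 * exp ((l+2) * V (?h n) \<omega>) + exp ((l+1) * V (?h n) \<omega>)))"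
        using l exp_V_indicator_integrable[OF h[of n], of 0 "{e<..}"]
        by (intro Bochner_Integration.integrable_add Bochner_Integration.integrable_diff integrable_mult_right int) auto
    qed auto
    also have "\<dots> = exp (l * K) * (\<integral>\<omega>. indicator {e<..} (V (?h n) \<omega>) \<partial>M) +
        exp (- K) * (exp (?h n * \<Psi> (l+3)) - 2 * exp (?h n * \<Psi> (l+2)) + exp (?h n * \<Psi> (l+1)))"
      using l exp_V_indicator_integrable[OF h[of n], of 0 "{e<..}"] exp_V_integral[OF h[of n]] int by simp
    also have "(\<integral>\<omega>. indicator {e<..} (V (?h n) \<omega>) \<partial>M) = (\<integral>\<omega>. indicator {\<omega>\<in>space M. e < V (?h n) \<omega>} \<omega> \<partial>M)"
      by (intro Bochner_Integration.integral_cong) (auto simp: indicator_def)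
    also have "\<dots> = prob {\<omega>\<in>space M. e < V (?h n) \<omega>}" by (subst Bochner_Integration.integral_indicator) (rule arg_cong[where f=prob], auto)
    finally have "real (Suc n) * ?J n \<le> real (Suc n) * (exp (l * K) * prob {\<omega>\<in>space M. e < V (?h n) \<omega>} +
        exp (- K) * (exp (?h n * \<Psi> (l+3)) - 2 * exp (?h n * \<Psi> (l+2)) + exp (?h n * \<Psi> (l+1))))"
      by (intro mult_left_mono) auto
    also have "\<dots> = exp (l * K) * p n + exp (- K) * c n" by (simp add: p_def c_def algebra_simps del: of_nat_Suc)
    finally show ?thesis .
  qed
  have J0: "0 \<le> ?J n" for n by (intro integral_nonneg_AE) (auto simp: indicator_def)
  show ?thesis
  proof (rule tendstoI)
    fix d :: real assume d: "d > 0"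
    define K where "K = max 1 (ln (2 * (\<bar>C\<bar> + 1) / d))"
    have K: "1 \<le> K" by (simp add: K_def)
    have "exp (ln (2 * (\<bar>C\<bar> + 1) / d)) \<le> exp K" by (simp add: K_def)
    then have "2 * (\<bar>C\<bar> + 1) / d \<le> exp K" using d by simp
    then have "exp (- K) * (\<bar>C\<bar> + 1) \<le> d / 2" using d by (simp add: exp_minus field_simps)
    moreover have "exp (- K) * C \<le> exp (- K) * \<bar>C\<bar>" by simp
    moreover have "0 < exp (- K)" by simp
    ultimately have lim0: "exp (l * K) * 0 + exp (- K) * C < d"
      using d unfolding distrib_left mult_zero_right mult_1_right by linarith
    have "(\<lambda>n. exp (l * K) * p n + exp (- K) * c n) \<longlonglongrightarrow> exp (l * K) * 0 + exp (- K) * C"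
      by (intro tendsto_intros p c)
    then have "eventually (\<lambda>n. exp (l * K) * p n + exp (- K) * c n < d) sequentially"
      using lim0 by (rule order_tendstoD)
    then show "eventually (\<lambda>n. dist (real (Suc n) * ?J n) 0 < d) sequentially"
    proof eventually_elim
      case (elim n)
      have "0 \<le> real (Suc n) * ?J n" by (intro mult_nonneg_nonneg J0) simp
      then show ?case using bound[OF K, of n] elim by (simp add: dist_real_def del: of_nat_Suc)
    qed
  qed
qed

section \<open>Doubling and quadratic growth of \<Psi>\<close>

text \<open>The pointwise bound on \<open>doubling_test\<close> is integrated at time
  \<open>1 / (n + 1)\<close> and multiplied by \<open>n + 1\<close>. The constants balance
  (\<open>4 - 1 - 3 = 0\<close> and \<open>3 - 1 - 2 = 0\<close>), so only multiples of
  \<open>exp (h * \<Psi>) - 1\<close> remain and the limit is linear in \<open>\<Psi>\<close>.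
  Negative values can come only from increments above \<open>e\<close>, whose share vanishes in the
  limit.\<close>

lemma Psi_doubling:
  assumes l: "2 \<le> l"
  shows "\<Psi> (2 * l) \<le> 4 * \<Psi> l + 2 * l * (\<Psi> 2 - 3 * \<Psi> 1)"
proof -
  let ?h = "\<lambda>n. 1 / real (Suc n)"
  obtain e where e: "0 < e" "\<And>v. 0 \<le> v \<Longrightarrow> v \<le> e \<Longrightarrow> 0 \<le> doubling_test l v"
    using doubling_test_pos_near_0[of l] l by auto
  let ?J = "\<lambda>n. \<integral>\<omega>. exp (2 * l * V (?h n) \<omega>) * indicator {e<..} (V (?h n) \<omega>) \<partial>M"
  have h: "0 \<le> ?h n" for n by auto
  have ptw: "- (1 + 6 * l) * (exp (2 * l * v) * indicator {e<..} v) \<le> doubling_test l v" for v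
  proof -
    consider "v \<le> 0" | "0 < v" "v \<le> e" | "e < v" by linarith
    then show ?thesis
      using doubling_test_nonpos[OF l, of v] e doubling_test_ge[of l v] l by cases (auto simp: algebra_simps)
  qed
  have ineq: "- (1 + 6 * l) * (real (Suc n) * ?J n) \<le> 4 * (real (Suc n) * (exp (?h n * \<Psi> l) - 1))
      - real (Suc n) * (exp (?h n * \<Psi> (2 * l)) - 1)
      - 2 * l * (3 * (real (Suc n) * (exp (?h n * \<Psi> 1) - 1)) - real (Suc n) * (exp (?h n * \<Psi> 2) - 1))" for n
  proof -
    note int = exp_V_integrable[OF h[of n]]
    have i1: "integrable M (\<lambda>\<omega>. exp (V (?h n) \<omega>))" using int[of 1] by simp
    have e1: "(\<integral>\<omega>. exp (V (?h n) \<omega>) \<partial>M) = exp (?h n * \<Psi> 1)" using exp_V_integral[OF h[of n], of 1] by simp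
    have "(\<integral>\<omega>. - (1 + 6 * l) * (exp (2 * l * V (?h n) \<omega>) * indicator {e<..} (V (?h n) \<omega>)) \<partial>M)
        \<le> (\<integral>\<omega>. doubling_test l (V (?h n) \<omega>) \<partial>M)"
      unfolding doubling_test_def using l ptw[unfolded doubling_test_def]
      by (intro integral_mono integrable_mult_right exp_V_indicator_integrable h Bochner_Integration.integrable_diff int i1) auto
    also have "\<dots> = 4 * exp (?h n * \<Psi> l) - exp (?h n * \<Psi> (2 * l)) - 3
       - 2 * l * (3 * exp (?h n * \<Psi> 1) - exp (?h n * \<Psi> 2) - 2)"
      unfolding doubling_test_def using l int i1 exp_V_integral[OF h[of n]] e1 by (simp add: prob_space del: of_nat_Suc)
    finally have "- (1 + 6 * l) * ?J n \<le> 4 * exp (?h n * \<Psi> l) - exp (?h n * \<Psi> (2 * l)) - 3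
       - 2 * l * (3 * exp (?h n * \<Psi> 1) - exp (?h n * \<Psi> 2) - 2)" by simp
    then have "real (Suc n) * (- (1 + 6 * l) * ?J n) \<le> real (Suc n) * (4 * exp (?h n * \<Psi> l) - exp (?h n * \<Psi> (2 * l)) - 3
       - 2 * l * (3 * exp (?h n * \<Psi> 1) - exp (?h n * \<Psi> 2) - 2))" by (intro mult_left_mono) auto
    then show ?thesis by (simp add: algebra_simps del: of_nat_Suc)
  qed
  have "- (1 + 6 * l) * 0 \<le> 4 * (1 * \<Psi> l) - 1 * \<Psi> (2 * l) - 2 * l * (3 * (1 * \<Psi> 1) - 1 * \<Psi> 2)"
  proof (rule LIMSEQ_le)
    show "(\<lambda>n. - (1 + 6 * l) * (real (Suc n) * ?J n)) \<longlonglongrightarrow> - (1 + 6 * l) * 0"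
      using e l by (intro tendsto_intros exp_jump_tendsto_0) auto
    show "(\<lambda>n. 4 * (real (Suc n) * (exp (?h n * \<Psi> l) - 1))
      - real (Suc n) * (exp (?h n * \<Psi> (2 * l)) - 1)
      - 2 * l * (3 * (real (Suc n) * (exp (?h n * \<Psi> 1) - 1)) - real (Suc n) * (exp (?h n * \<Psi> 2) - 1)))
      \<longlonglongrightarrow> 4 * (1 * \<Psi> l) - 1 * \<Psi> (2 * l) - 2 * l * (3 * (1 * \<Psi> 1) - 1 * \<Psi> 2)"
      by (intro tendsto_diff tendsto_mult_left tendsto_Suc_exp_minus_1 zero_less_one)
  qed (use ineq in blast)
  then show ?thesis by (simp add: algebra_simps)
qed

lemma Psi_le_max_0:
  assumes "0 \<le> x" "x \<le> y" "\<Psi> y \<le> B" "0 \<le> B" shows "\<Psi> x \<le> B"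
proof (cases "y = 0")
  case False
  then have y: "y > 0" using assms by auto
  have "\<Psi> ((1 - x / y) *\<^sub>R 0 + (x / y) *\<^sub>R y) \<le> (1 - x / y) * \<Psi> 0 + (x / y) * \<Psi> y"
    using assms y by (intro convex_onD[OF Psi_convex]) auto
  then have "\<Psi> x \<le> (x / y) * \<Psi> y" using y by simp
  also have "\<dots> \<le> (x / y) * B" using assms y by (intro mult_left_mono) auto
  also have "\<dots> \<le> 1 * B" using assms y by (intro mult_right_mono) auto
  finally show ?thesis by simp
qed (use assms in auto)

text \<open>\<open>\<Psi> l / l\<close> increases, by convexity and \<open>\<Psi> 0 = 0\<close>; the
  quotients are cleared.\<close>

lemma Psi_ray:
  assumes "0 < x" "x \<le> y" shows "y * \<Psi> x \<le> x * \<Psi> y"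
proof -
  have y: "y > 0" using assms by auto
  have "\<Psi> ((1 - x / y) *\<^sub>R 0 + (x / y) *\<^sub>R y) \<le> (1 - x / y) * \<Psi> 0 + (x / y) * \<Psi> y"
    using assms y by (intro convex_onD[OF Psi_convex]) auto
  then have "\<Psi> x \<le> (x / y) * \<Psi> y" using y by simp
  then show ?thesis using y by (simp add: field_simps)
qed

text \<open>Adding \<open>D * l\<close> absorbs the linear error, so that
  \<open>T (2 * l) \<le> 4 * T l\<close> iterates along \<open>2 * 2 ^ k\<close>. Convexity with
  \<open>\<Psi> 0 = 0\<close> carries the bound from the next power of two back to
  \<open>l\<close>.\<close>

lemma Psi_quadratic: "\<exists>C>0. \<forall>l\<ge>2. \<Psi> l \<le> C * l\<^sup>2"
proof -
  define D where "D = \<Psi> 2 - 3 * \<Psi> 1"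
  define T where "T l = \<Psi> l + D * l" for l
  have step: "T (2 * l) \<le> 4 * T l" if "2 \<le> l" for l
    using Psi_doubling[OF that] by (simp add: T_def D_def algebra_simps)
  have pow: "T (2 * 2 ^ k) \<le> 4 ^ k * T 2" for k
  proof (induction k)
    case (Suc k)
    have "T (2 * 2 ^ Suc k) \<le> 4 * T (2 * 2 ^ k)" using step[of "2 * 2 ^ k"] by (simp add: mult_ac)
    then show ?case using Suc by simp
  qed simp
  define C where "C = \<bar>T 2\<bar> + 2 * \<bar>D\<bar> + 1"
  have "\<Psi> l \<le> C * l\<^sup>2" if l: "2 \<le> l" for l
  proof -
    define k where "k = nat \<lfloor>log 2 l\<rfloor>"
    have "0 \<le> log 2 l" using l by simp
    then have kf: "real k \<le> log 2 l" "log 2 l \<le> real k + 1" by (auto simp: k_def)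
    have "2 powr real k \<le> 2 powr (log 2 l)" "2 powr (log 2 l) \<le> 2 powr (real k + 1)" using kf by auto
    then have k: "2 ^ k \<le> l" "l \<le> 2 * 2 ^ k" using l by (auto simp: powr_realpow powr_add)
    let ?b = "2 * 2 ^ k :: real"
    have "\<Psi> ?b \<le> 4 ^ k * T 2 - D * ?b" using pow[of k] by (simp add: T_def)
    moreover have "4 ^ k * T 2 \<le> 4 ^ k * \<bar>T 2\<bar>" by simp
    moreover have "4 ^ k * \<bar>T 2\<bar> \<le> l\<^sup>2 * \<bar>T 2\<bar>"
    proof (intro mult_right_mono)
      have "(4::real) ^ k = (2 ^ k)\<^sup>2" by (metis power2_eq_square mult_2_right num_double numeral_times_numeral power_mult_distrib)
      also have "\<dots> \<le> l\<^sup>2" using k by (intro power_mono) auto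
      finally show "(4::real) ^ k \<le> l\<^sup>2" .
    qed auto
    moreover have "- (D * ?b) \<le> \<bar>D\<bar> * (2 * l)"
    proof -
      have "- (D * ?b) \<le> \<bar>D * ?b\<bar>" by linarith
      also have "\<dots> = \<bar>D\<bar> * ?b" by (simp add: abs_mult)
      also have "\<dots> \<le> \<bar>D\<bar> * (2 * l)" using k by (intro mult_left_mono) auto
      finally show ?thesis .
    qed
    moreover have "\<bar>D\<bar> * (2 * l) \<le> 2 * \<bar>D\<bar> * l\<^sup>2"
    proof -
      have "l * 1 \<le> l * l" using l by (intro mult_left_mono) auto
      then have "\<bar>D\<bar> * l \<le> \<bar>D\<bar> * (l * l)" by (intro mult_left_mono) auto
      then show ?thesis by (simp add: power2_eq_square mult_ac)
    qed
    ultimately have "\<Psi> ?b \<le> l\<^sup>2 * \<bar>T 2\<bar> + 2 * \<bar>D\<bar> * l\<^sup>2" by linarith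
    also have "\<dots> \<le> C * l\<^sup>2" by (simp add: C_def algebra_simps)
    finally show ?thesis using k l by (intro Psi_le_max_0[of l ?b]) (auto simp: C_def)
  qed
  moreover have "C > 0" by (auto simp: C_def)
  ultimately show ?thesis by blast
qed

text \<open>Chernoff's bound with \<open>\<Psi> l \<le> 0\<close> gives at most
  \<open>exp (- l * e)\<close> for the probability of \<open>V t > e\<close>, for every
  \<open>l > 0\<close>; let \<open>l \<rightarrow> \<infinity>\<close>.\<close>

lemma V_nonpos_if_Psi_nonpos:
  assumes P: "\<And>l. l > 0 \<Longrightarrow> \<Psi> l \<le> 0" and t: "t \<ge> 0"
  shows "AE \<omega> in M. V t \<omega> \<le> 0"
proof -
  note [measurable] = V_measurable[OF t]
  have "prob {\<omega>\<in>space M. e < V t \<omega>} = 0" if e: "e > 0" for e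
  proof -
    have "prob {\<omega>\<in>space M. e < V t \<omega>} \<le> exp (- (l * e))" if l: "l > 0" for l
    proof -
      have "prob {\<omega>\<in>space M. e < V t \<omega>} = (\<integral>\<omega>. indicator {\<omega>\<in>space M. e < V t \<omega>} \<omega> \<partial>M)"
        by (subst Bochner_Integration.integral_indicator) auto
      also have "\<dots> \<le> (\<integral>\<omega>. exp (- (l * e)) * exp (l * V t \<omega>) \<partial>M)"
      proof (intro integral_mono integrable_mult_right exp_V_integrable t)
        show "integrable M (indicat_real {\<omega>\<in>space M. e < V t \<omega>})" by (intro integrable_real_indicator) (auto simp: emeasure_eq_measure)
      qed (use l in \<open>auto simp: indicator_def mult_exp_exp\<close>)
      also have "\<dots> = exp (- (l * e)) * exp (t * \<Psi> l)" using exp_V_integral[OF t, of l] l by simp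
      also have "\<dots> \<le> exp (- (l * e)) * 1"
        using P[OF l] t by (intro mult_left_mono) (auto intro: mult_nonneg_nonpos)
      finally show ?thesis by simp
    qed
    moreover have "((\<lambda>l. exp (- (l * e))) \<longlongrightarrow> 0) at_top" using e by real_asymp
    ultimately have "prob {\<omega>\<in>space M. e < V t \<omega>} \<le> 0"
      by (intro tendsto_lowerbound[of _ _ at_top]) (auto intro: eventually_mono[OF eventually_gt_at_top[of 0]])
    then show ?thesis by (simp add: measure_le_0_iff)
  qed
  then have "AE \<omega> in M. \<not> (1 / real (Suc n) < V t \<omega>)" for n
    by (subst AE_iff_measurable[OF _ refl]) (auto simp: emeasure_eq_measure simp del: of_nat_Suc)
  then have "AE \<omega> in M. \<forall>n. \<not> (1 / real (Suc n) < V t \<omega>)" by (simp add: AE_all_countable)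
  then show ?thesis
  proof eventually_elim
    case (elim \<omega>)
    then show ?case using nat_approx_posE[of "V t \<omega>"] by (meson not_le)
  qed
qed

lemma levy_uminus: "levy_process M (\<lambda>t \<omega>. - V t \<omega>)"
proof -
  have L: "levy_process M V" using sn by (simp add: spectrally_negative_levy_def)
  have "indep_vars (\<lambda>_. borel) (\<lambda>i \<omega>. - V (t (Suc i)) \<omega> - - V (t i) \<omega>) {..<n}"
    if t: "0 \<le> t 0" "incseq t" for n t
  proof -
    have "indep_vars (\<lambda>_. borel) (\<lambda>i \<omega>. V (t (Suc i)) \<omega> - V (t i) \<omega>) {..<n}"
      using L t unfolding levy_process_def by blast
    then have "indep_vars (\<lambda>_. borel) (\<lambda>i \<omega>. - (V (t (Suc i)) \<omega> - V (t i) \<omega>)) {..<n}"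
      by (rule indep_vars_compose2) auto
    then show ?thesis by simp
  qed
  moreover have "distr M borel (\<lambda>\<omega>. - V (s + t) \<omega> - - V s \<omega>) = distr M borel (\<lambda>\<omega>. - V t \<omega>)"
    if st: "0 \<le> s" "0 \<le> t" for s t
  proof -
    have "distr M borel (\<lambda>\<omega>. - (V (s + t) \<omega> - V s \<omega>)) = distr (distr M borel (\<lambda>\<omega>. V (s + t) \<omega> - V s \<omega>)) borel uminus"
      using st by (subst distr_distr) (auto simp: comp_def)
    also have "\<dots> = distr (distr M borel (V t)) borel uminus" using st by (simp only: V_stationary)
    also have "\<dots> = distr M borel (\<lambda>\<omega>. - V t \<omega>)" using st by (subst distr_distr) (auto simp: comp_def)
    finally show ?thesis by simp
  qed
  moreover have "cadlag (\<lambda>t. - f t)" if "cadlag f" for f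
    using that unfolding cadlag_def by (blast intro: tendsto_minus)
  ultimately show ?thesis
    using L unfolding levy_process_def by auto
qed

text \<open>Almost sure monotonicity over the countably many rational pairs extends to all times by
  right continuity: a strict increase of \<open>V\<close> from \<open>s\<close> to \<open>t\<close>
  would already be seen between rationals just to their right.\<close>

lemma subordinator_uminus_if_Psi_nonpos:
  assumes P: "\<And>l. l > 0 \<Longrightarrow> \<Psi> l \<le> 0"
  shows "subordinator M (\<lambda>t \<omega>. - V t \<omega>)"
proof -
  have "AE \<omega> in M. V s \<omega> - V r \<omega> \<le> 0" if "0 \<le> r" "r \<le> s" for r s
  proof -
    have "AE x in distr M borel (V (s - r)). x \<le> 0"
      using V_nonpos_if_Psi_nonpos[OF P, of "s - r"] that by (subst AE_distr_iff) auto
    also have "distr M borel (V (s - r)) = distr M borel (\<lambda>\<omega>. V s \<omega> - V r \<omega>)"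
      using V_stationary[of r "s - r"] that by simp
    finally show ?thesis using that by (subst (asm) AE_distr_iff) auto
  qed
  then have "\<forall>p\<in>{p\<in>\<rat> \<times> \<rat>. 0 \<le> fst p \<and> fst p \<le> snd p}. AE \<omega> in M. V (snd p) \<omega> - V (fst p) \<omega> \<le> 0"
    by blast
  moreover have "countable {p\<in>\<rat> \<times> \<rat>. 0 \<le> fst p \<and> fst p \<le> (snd p :: real)}"
    by (rule countable_subset[of _ "\<rat> \<times> \<rat>"]) (auto intro: countable_rat)
  ultimately have "AE \<omega> in M. \<forall>p\<in>{p\<in>\<rat> \<times> \<rat>. 0 \<le> fst p \<and> fst p \<le> snd p}. V (snd p) \<omega> - V (fst p) \<omega> \<le> 0"
    by (simp only: AE_ball_countable)
  then have "AE \<omega> in M. mono_on {0..} (\<lambda>t. - V t \<omega>)"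
    using AE_space
  proof eventually_elim
    case (elim \<omega>)
    have "V t \<omega> \<le> V s \<omega>" if st: "0 \<le> s" "s < t" for s t
    proof (rule ccontr)
      assume "\<not> V t \<omega> \<le> V s \<omega>"
      then obtain m where m: "V s \<omega> < m" "m < V t \<omega>" using dense by (metis not_le)
      have lim: "((\<lambda>t. V t \<omega>) \<longlongrightarrow> V u \<omega>) (at_right u)" if "u \<ge> 0" for u
        using V_cadlag[OF elim(2)] that by (auto simp: cadlag_def)
      obtain b where b: "b > s" "\<And>y. s < y \<Longrightarrow> y < b \<Longrightarrow> V y \<omega> < m"
        using order_tendstoD(2)[OF lim[OF st(1)] m(1)] by (auto simp: eventually_at_right[of s "s+1"])
      obtain c where c: "c > t" "\<And>y. t < y \<Longrightarrow> y < c \<Longrightarrow> m < V y \<omega>"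
        using order_tendstoD(1)[OF lim[of t] m(2)] st by (auto simp: eventually_at_right[of t "t+1"])
      obtain q where q: "q \<in> \<rat>" "s < q" "q < min b t" using Rats_dense_in_real[of s "min b t"] b st by auto
      obtain r where r: "r \<in> \<rat>" "t < r" "r < c" using Rats_dense_in_real[of t c] c by auto
      have "V r \<omega> - V q \<omega> \<le> 0" using elim(1)[rule_format, of "(q, r)"] q r st by auto
      moreover have "V q \<omega> < m" "m < V r \<omega>" using b(2)[of q] c(2)[of r] q r by auto
      ultimately show False by linarith
    qed
    then show ?case by (intro mono_onI) (metis atLeast_iff neg_le_iff_le order_le_less)
  qed
  then show ?thesis using levy_uminus by (simp add: subordinator_def)
qed

end

section \<open>Linear growth of \<Psi> and the two exponents\<close>

locale sn_levy_ns = sn_levy +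
  assumes nsub: "\<not> subordinator M (\<lambda>t \<omega>. - V t \<omega>)"
begin

text \<open>If \<open>\<Psi>\<close> were nonpositive on the positive axis, \<open>- V\<close> would
  be a subordinator. So \<open>\<Psi> l0 > 0\<close> for some \<open>l0\<close>, and
  \<open>\<Psi> l / l\<close> increases from there.\<close>

lemma Psi_ge_linear: "\<exists>c>0. \<exists>l0>0. \<forall>l\<ge>l0. c * l \<le> \<Psi> l"
proof -
  obtain l0 where l0: "l0 > 0" "\<Psi> l0 > 0"
    using subordinator_uminus_if_Psi_nonpos nsub by (meson not_le)
  have "\<Psi> l0 / l0 * l \<le> \<Psi> l" if "l0 \<le> l" for l
    using Psi_ray[OF l0(1) that] l0 by (simp add: field_simps)
  then show ?thesis using l0 by (intro exI[of _ "\<Psi> l0 / l0"] conjI exI[of _ l0]) auto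
qed

lemma sigma_set_ge_1:
  assumes "0 \<le> a" "a < 1" shows "filterlim (\<lambda>u. u powr (- a) * \<Psi> u) at_top at_top"
proof -
  obtain c l0 where c: "c > 0" "l0 > 0" "\<And>l. l \<ge> l0 \<Longrightarrow> c * l \<le> \<Psi> l" using Psi_ge_linear by blast
  have "filterlim (\<lambda>u. c * u powr (1 - a)) at_top at_top" using assms c by real_asymp
  then show ?thesis
  proof (rule filterlim_at_top_mono)
    show "eventually (\<lambda>u. c * u powr (1 - a) \<le> u powr (- a) * \<Psi> u) at_top"
      using eventually_ge_at_top[of l0]
    proof eventually_elim
      case (elim u)
      then have "u powr (- a) * (c * u) \<le> u powr (- a) * \<Psi> u" using c by (intro mult_left_mono) auto
      moreover have "u powr (- a) * (c * u) = c * u powr (1 - a)"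
        using elim c by (simp add: powr_diff powr_minus field_simps)
      ultimately show ?case by simp
    qed
  qed
qed

lemma beta_set_gt_2:
  assumes "2 < a" shows "((\<lambda>u. u powr (- a) * \<Psi> u) \<longlongrightarrow> 0) at_top"
proof -
  obtain c l0 where c: "c > 0" "l0 > 0" "\<And>l. l \<ge> l0 \<Longrightarrow> c * l \<le> \<Psi> l" using Psi_ge_linear by blast
  obtain C where C: "C > 0" "\<And>l. l \<ge> 2 \<Longrightarrow> \<Psi> l \<le> C * l\<^sup>2" using Psi_quadratic by blast
  have "((\<lambda>u. C * u powr (2 - a)) \<longlongrightarrow> 0) at_top" using assms C by real_asymp
  then show ?thesis
  proof (rule tendsto_sandwich[rotated -1])
    show "eventually (\<lambda>u. u powr (- a) * \<Psi> u \<le> C * u powr (2 - a)) at_top"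
      using eventually_ge_at_top[of 2]
    proof eventually_elim
      case (elim u)
      then have "u powr (- a) * \<Psi> u \<le> u powr (- a) * (C * u\<^sup>2)" using C by (intro mult_left_mono) auto
      also have "\<dots> = C * u powr (2 - a)"
        using elim by (simp add: powr_diff powr_minus field_simps)
      finally show ?case .
    qed
    show "eventually (\<lambda>u. 0 \<le> u powr (- a) * \<Psi> u) at_top"
      using eventually_ge_at_top[of l0]
    proof eventually_elim
      case (elim u)
      then have "0 \<le> c * u" using c by simp
      then have "0 \<le> \<Psi> u" using c(3)[OF elim] by linarith
      then show ?case by simp
    qed
  qed auto
qed

lemma sigma_set_le_beta_set:
  assumes a: "filterlim (\<lambda>u. u powr (- a) * \<Psi> u) at_top at_top"
    and b: "((\<lambda>u. u powr (- b) * \<Psi> u) \<longlongrightarrow> 0) at_top"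
  shows "a \<le> b"
proof (rule ccontr)
  assume "\<not> a \<le> b"
  have "eventually (\<lambda>u. 1 < u powr (- a) * \<Psi> u) at_top" using a by (simp add: filterlim_at_top_dense)
  moreover have "eventually (\<lambda>u. u powr (- b) * \<Psi> u < 1) at_top" using b by (rule order_tendstoD) simp
  ultimately have "eventually (\<lambda>u::real. False) at_top"
    using eventually_ge_at_top[of 1]
  proof eventually_elim
    case (elim u)
    have P: "0 < \<Psi> u" using elim by (metis less_trans not_less_iff_gr_or_eq powr_ge_zero zero_less_mult_pos zero_less_one mult_nonneg_nonpos not_le order.strict_implies_order)
    have "u powr (- a) \<le> u powr (- b)" using elim \<open>\<not> a \<le> b\<close> by (intro powr_mono) auto
    then have "u powr (- a) * \<Psi> u \<le> u powr (- b) * \<Psi> u" using P by (intro mult_right_mono) auto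
    then show ?case using elim by linarith
  qed
  then show False by simp
qed

text \<open>The real \<open>Sup\<close> and \<open>Inf\<close> are meaningful on nonempty bounded
  sets: the first set contains \<open>0\<close>, the second contains \<open>3\<close>, and each
  element of the first lies below each element of the second. A strict gap to the exponents turns
  the limits that define them into plain power bounds.\<close>

lemma exponent_bounds:
  shows "1 \<le> sigma_exponent \<Psi>" "sigma_exponent \<Psi> \<le> beta_exponent \<Psi>" "beta_exponent \<Psi> \<le> 2"
    and sigma_exponent_less: "\<And>s. s < sigma_exponent \<Psi> \<Longrightarrow> eventually (\<lambda>u. u powr s \<le> \<Psi> u) at_top"
    and beta_exponent_greater: "\<And>b. beta_exponent \<Psi> < b \<Longrightarrow> eventually (\<lambda>u. \<Psi> u \<le> u powr b) at_top"
proof -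
  let ?S = "{\<alpha>. 0 \<le> \<alpha> \<and> filterlim (\<lambda>u. u powr (- \<alpha>) * \<Psi> u) at_top at_top}"
  let ?B = "{\<alpha>. 0 \<le> \<alpha> \<and> ((\<lambda>u. u powr (- \<alpha>) * \<Psi> u) \<longlongrightarrow> 0) at_top}"
  have B3: "3 \<in> ?B" using beta_set_gt_2[of 3] by simp
  have S0: "0 \<in> ?S" using sigma_set_ge_1[of 0] by simp
  have le: "a \<le> b" if "a \<in> ?S" "b \<in> ?B" for a b using sigma_set_le_beta_set that by auto
  have bddS: "bdd_above ?S" using le[OF _ B3] by (rule bdd_aboveI)
  have bddB: "bdd_below ?B" by (rule bdd_belowI[of _ 0]) auto
  show "1 \<le> sigma_exponent \<Psi>"
  proof (rule dense_le)
    fix y :: real assume "y < 1"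
    then have "max y 0 \<in> ?S" using sigma_set_ge_1[of "max y 0"] by simp
    then have "max y 0 \<le> sigma_exponent \<Psi>" unfolding sigma_exponent_def by (intro cSup_upper bddS)
    then show "y \<le> sigma_exponent \<Psi>" by simp
  qed
  show "sigma_exponent \<Psi> \<le> beta_exponent \<Psi>"
    unfolding sigma_exponent_def beta_exponent_def
    using le S0 B3 by (intro cSup_least cInf_greatest) blast+
  show "beta_exponent \<Psi> \<le> 2"
  proof (rule dense_ge)
    fix y :: real assume "2 < y"
    then have "y \<in> ?B" using beta_set_gt_2[of y] by simp
    then show "beta_exponent \<Psi> \<le> y" unfolding beta_exponent_def by (intro cInf_lower bddB)
  qed
  show "eventually (\<lambda>u. u powr s \<le> \<Psi> u) at_top" if s: "s < sigma_exponent \<Psi>" for s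
  proof -
    obtain a where a: "a \<in> ?S" "s < a"
      using s S0 less_cSup_iff[OF _ bddS, of s] unfolding sigma_exponent_def by blast
    have "eventually (\<lambda>u. 1 < u powr (- a) * \<Psi> u) at_top" using a by (simp add: filterlim_at_top_dense)
    then show ?thesis using eventually_ge_at_top[of 1]
    proof eventually_elim
      case (elim u)
      have "u powr s \<le> u powr a * 1" using elim a by (simp add: powr_mono)
      also have "\<dots> \<le> u powr a * (u powr (- a) * \<Psi> u)" using elim by (intro mult_left_mono) auto
      also have "\<dots> = \<Psi> u" using elim by (simp add: powr_minus)
      finally show ?case .
    qed
  qed
  show "eventually (\<lambda>u. \<Psi> u \<le> u powr b) at_top" if b: "beta_exponent \<Psi> < b" for b
  proof -
    obtain a where a: "a \<in> ?B" "a < b"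
      using b B3 cInf_less_iff[OF _ bddB, of b] unfolding beta_exponent_def by blast
    have "eventually (\<lambda>u. u powr (- a) * \<Psi> u < 1) at_top" using a by (intro order_tendstoD[of _ 0]) auto
    then show ?thesis using eventually_ge_at_top[of 1]
    proof eventually_elim
      case (elim u)
      have "\<Psi> u = u powr a * (u powr (- a) * \<Psi> u)" using elim by (simp add: powr_minus)
      also have "\<dots> \<le> u powr a * 1" using elim by (intro mult_left_mono) auto
      also have "\<dots> \<le> u powr b" using elim a by (simp add: powr_mono)
      finally show ?case .
    qed
  qed
qed

lemma V_reaches_up: "\<exists>s>0. 0 < prob {\<omega>\<in>space M. 2 \<le> V s \<omega>}"
proof -
  obtain c l0 where c: "c > 0" "l0 > 0" "\<And>l. l \<ge> l0 \<Longrightarrow> c * l \<le> \<Psi> l" using Psi_ge_linear by blast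
  \<comment> \<open>With \<open>s * c = 3\<close> the exponent \<open>s * \<Psi> l0\<close> is at
    least \<open>3 * l0\<close>, more than the \<open>2 * l0\<close> that \<open>V s < 2\<close>
    almost surely would allow.\<close>
  define s where "s = 3 / c"
  have s: "s > 0" using c by (simp add: s_def)
  note [measurable] = V_measurable[of s]
  have "prob {\<omega>\<in>space M. 2 \<le> V s \<omega>} \<noteq> 0"
  proof
    assume "prob {\<omega>\<in>space M. 2 \<le> V s \<omega>} = 0"
    then have "AE \<omega> in M. \<not> 2 \<le> V s \<omega>"
      using s by (subst AE_iff_measurable[OF _ refl]) (auto simp: emeasure_eq_measure)
    then have "(\<integral>\<omega>. exp (l0 * V s \<omega>) \<partial>M) \<le> (\<integral>\<omega>. exp (l0 * 2) \<partial>M)"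
      using s c exp_V_integrable[of s l0] by (intro integral_mono_AE) auto
    then have "exp (s * \<Psi> l0) \<le> exp (l0 * 2)" using exp_V_integral[of s l0] s c by (simp add: prob_space)
    then have "s * \<Psi> l0 \<le> l0 * 2" by simp
    moreover have "s * (c * l0) \<le> s * \<Psi> l0" using s c by (intro mult_left_mono) auto
    moreover have "s * (c * l0) = 3 * l0" using c by (simp add: s_def)
    ultimately show False using c by simp
  qed
  then show ?thesis using s by (intro exI[of _ s]) (auto simp: zero_less_measure_iff)
qed

end

section \<open>Reaching logarithmic heights in a short time\<close>

context sn_levy begin

text \<open>With \<open>x = exp (l * V t)\<close>, the bound
  \<open>x \<le> e/2 * x^2 + 1 / (2 * e)\<close> is used on the event \<open>V t \<ge> a\<close> in
  the role of Cauchy-Schwarz. Here \<open>e\<close> is the reciprocal of the second moment of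
  \<open>x\<close>, so the quadratic term contributes exactly \<open>1/2\<close>; the margin
  \<open>1\<close> in the hypothesis makes the first moment at least
  \<open>exp (l * a) + 1\<close>.\<close>

lemma prob_V_ge_Paley_Zygmund:
  assumes t: "0 \<le> t" and l: "0 \<le> l" and a: "0 \<le> a" and big: "l * a + 1 \<le> t * \<Psi> l"
  shows "exp (- (t * \<Psi> (2 * l))) \<le> prob {\<omega>\<in>space M. a \<le> V t \<omega>}"
proof -
  note [measurable] = V_measurable[OF t]
  let ?A = "{\<omega>\<in>space M. a \<le> V t \<omega>}"
  define e where "e = exp (- (t * \<Psi> (2 * l)))"
  have e: "e > 0" by (simp add: e_def)
  have ptw: "exp (l * V t \<omega>) \<le> exp (l * a) + (e / 2 * exp (2 * l * V t \<omega>) + 1 / (2 * e) * indicator ?A \<omega>)"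
    if "\<omega> \<in> space M" for \<omega>
  proof (cases "a \<le> V t \<omega>")
    case True
    define x where "x = exp (l * V t \<omega>)"
    have "exp (2 * l * V t \<omega>) = x * x" by (simp add: x_def mult_exp_exp)
    moreover have "0 \<le> (e * x - 1)\<^sup>2 / (2 * e)" using e by simp
    moreover have "(e * x - 1)\<^sup>2 / (2 * e) = e / 2 * (x * x) + 1 / (2 * e) - x"
      using e by (simp add: power2_eq_square field_simps)
    ultimately show ?thesis using True that unfolding x_def[symmetric] by (simp add: add_increasing)
  next
    case False
    then have "l * V t \<omega> \<le> l * a" using l by (intro mult_left_mono) auto
    then have "exp (l * V t \<omega>) \<le> exp (l * a)" by simp
    moreover have "0 \<le> e / 2 * exp (2 * l * V t \<omega>)" using e by simp
    ultimately show ?thesis using False by (simp add: add_increasing2)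
  qed
  have iA: "integrable M (indicat_real ?A)" by (intro integrable_real_indicator) (auto simp: emeasure_eq_measure)
  have "exp (t * \<Psi> l) = (\<integral>\<omega>. exp (l * V t \<omega>) \<partial>M)" using exp_V_integral t l by simp
  also have "\<dots> \<le> (\<integral>\<omega>. exp (l * a) + (e / 2 * exp (2 * l * V t \<omega>) + 1 / (2 * e) * indicator ?A \<omega>) \<partial>M)"
    using ptw l exp_V_integrable[OF t, of "2 * l"]
    by (intro integral_mono exp_V_integrable t Bochner_Integration.integrable_add integrable_mult_right iA) auto
  also have "\<dots> = exp (l * a) + (e / 2 * exp (t * \<Psi> (2 * l)) + 1 / (2 * e) * prob ?A)"
    using iA exp_V_integrable[OF t, of "2 * l"] exp_V_integral[OF t, of "2 * l"] l
    by (simp add: prob_space Int_absorb2 del: integrable_indicator_iff)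
  also have "e / 2 * exp (t * \<Psi> (2 * l)) = 1 / 2" by (simp add: e_def mult_exp_exp)
  finally have "exp (t * \<Psi> l) \<le> exp (l * a) + (1 / 2 + 1 / (2 * e) * prob ?A)" .
  moreover have "exp (l * a + 1) \<le> exp (t * \<Psi> l)" using big by simp
  moreover have "exp (l * a) + 1 \<le> exp (l * a + 1)"
  proof -
    have "(2::real) \<le> exp 1" using exp_ge_add_one_self[of 1] by simp
    then have "exp (l * a) * 2 \<le> exp (l * a) * exp 1" by (intro mult_left_mono) auto
    moreover have "1 \<le> exp (l * a)" using l a by simp
    ultimately show ?thesis unfolding exp_add by linarith
  qed
  ultimately have "1 / 2 \<le> 1 / (2 * e) * prob ?A" by linarith
  then show ?thesis using e unfolding e_def[symmetric] by (simp add: field_simps)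
qed

text \<open>\<open>l\<close> is the first point of the sequence \<open>2 * 2 ^ k\<close> with
  \<open>l * a + 1 \<le> t * \<Psi> l\<close>, where \<open>a = A * ln (1 / t)\<close>. The lower
  power bound on \<open>\<Psi>\<close> guarantees that one exists below \<open>2 * L\<close>. By
  minimality \<open>t * \<Psi> (l / 2)\<close> is at most \<open>l / 2 * a + 1\<close>, and two
  doublings carry this to \<open>t * \<Psi> (2 * l)\<close>, the exponent in the Paley-Zygmund
  bound. Thus the upper control of \<open>\<Psi>\<close> comes from minimality.\<close>

lemma prob_V_ge_log:
  assumes s: "1 < s" "eventually (\<lambda>u. u powr s \<le> \<Psi> u) at_top"
    and g: "1 / (s - 1) < g" and A: "0 < A"
  shows "eventually (\<lambda>t. exp (- (t powr (- g))) \<le> prob {\<omega>\<in>space M. A * ln (1 / t) \<le> V t \<omega>}) (at_right 0)"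
proof -
  define D where "D = \<bar>\<Psi> 2 - 3 * \<Psi> 1\<bar>"
  \<comment> \<open>Strictly below \<open>g\<close>, the exponent leaves room for the logarithm and
    the constant \<open>16\<close> of two doublings; strictly above \<open>1 / (s - 1)\<close>, it
    makes \<open>t * L powr (s - 1)\<close> the negative power \<open>t powr (- q)\<close>.\<close>
  obtain r where r: "1 / (s - 1) < r" "r < g" using dense[OF g] by blast
  have r0: "0 < r" using r s by (smt (verit) divide_pos_pos)
  have rs: "1 < r * (s - 1)" using r s by (simp add: field_simps)
  obtain u0 where u0: "\<And>u. u \<ge> u0 \<Longrightarrow> u powr s \<le> \<Psi> u" using s(2) by (auto simp: eventually_at_top_linorder)
  define q where "q = r * (s - 1) - 1"
  have q: "q > 0" using rs by (simp add: q_def)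
  have E1: "eventually (\<lambda>t. 16 * (t powr (- r) * (A * ln (1 / t)) + 1) + 12 * t powr (- r) * D * t \<le> t powr (- g)) (at_right 0)"
    using r r0 A by real_asymp
  have E2: "eventually (\<lambda>t. A * ln (1 / t) + 1 \<le> t powr (- q)) (at_right 0)"
    using q A by real_asymp
  have E3: "eventually (\<lambda>t::real. max 2 u0 \<le> t powr (- r)) (at_right 0)"
    using r0 by real_asymp
  have E4: "eventually (\<lambda>t. t * \<Psi> 2 < 1) (at_right 0)" by real_asymp
  have E5: "eventually (\<lambda>t::real. 0 < t \<and> t < 1) (at_right 0)"
    by (intro eventually_conj) real_asymp+
  show ?thesis using E1 E2 E3 E4 E5
  proof eventually_elim
    case (elim t)
    define a where "a = A * ln (1 / t)"
    define L where "L = t powr (- r)"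
    have a: "a \<ge> 0" using elim A by (auto simp: a_def)
    have L: "2 \<le> L" "u0 \<le> L" using elim by (auto simp: L_def)
    let ?P = "\<lambda>k. 2 * 2 ^ k * a + 1 \<le> t * \<Psi> (2 * 2 ^ k)"
    define k1 where "k1 = nat \<lfloor>log 2 L\<rfloor>"
    have "0 \<le> log 2 L" using L by simp
    then have kf: "real k1 \<le> log 2 L" "log 2 L \<le> real k1 + 1" by (auto simp: k1_def)
    have "2 powr real k1 \<le> 2 powr (log 2 L)" "2 powr (log 2 L) \<le> 2 powr (real k1 + 1)" using kf by auto
    then have k1: "2 ^ k1 \<le> L" "L \<le> 2 * 2 ^ k1" using L by (auto simp: powr_realpow powr_add)
    define m where "m = (2 * 2 ^ k1 :: real)"
    have m: "m \<ge> L" "m \<ge> 1" using k1 L by (auto simp: m_def)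
    have Pk1: "?P k1"
    proof -
      have "L powr (s - 1) \<le> m powr (s - 1)" using m L s by (intro powr_mono2) auto
      moreover have "L powr (s - 1) = t powr (- q) / t"
      proof -
        have "- r * (s - 1) = - q - 1" by (simp add: q_def)
        then have "L powr (s - 1) = t powr (- q - 1)" by (simp add: L_def powr_powr)
        then show ?thesis using elim by (simp add: powr_diff)
      qed
      ultimately have "t powr (- q) \<le> t * m powr (s - 1)" using elim by (simp add: field_simps)
      then have "a + 1 \<le> t * m powr (s - 1)" using elim by (simp add: a_def)
      then have "m * (a + 1) \<le> m * (t * m powr (s - 1))" using m by (intro mult_left_mono) auto
      also have "\<dots> = t * m powr s" using m by (simp add: powr_diff)
      also have "\<dots> \<le> t * \<Psi> m" using u0[of m] m L elim by (intro mult_left_mono) auto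
      finally have "m * a + m \<le> t * \<Psi> m" by (simp add: algebra_simps)
      then show ?thesis using m unfolding m_def[symmetric] by linarith
    qed
    define k where "k = (LEAST k. ?P k)"
    have Pk: "?P k" unfolding k_def using Pk1 by (rule LeastI)
    have kk1: "k \<le> k1" unfolding k_def using Pk1 by (rule Least_le)
    \<comment> \<open>For small \<open>t\<close> the point \<open>2\<close> fails, so the minimal
      \<open>k\<close> is a successor and its predecessor supplies the reverse inequality.\<close>
    have "\<not> ?P 0"
    proof -
      have "t * \<Psi> 2 < 2 * a + 1" using elim a by linarith
      then show ?thesis by simp
    qed
    then obtain j where j: "k = Suc j" using Pk by (metis not0_implies_Suc)
    have nPj: "\<not> ?P j" using not_less_Least[of j ?P] j unfolding k_def by auto
    define \<mu> where "\<mu> = (2 * 2 ^ j :: real)"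
    have mu2: "\<mu> \<ge> 2" by (simp add: \<mu>_def)
    have "(2::real) ^ k \<le> 2 ^ k1" using kk1 by (intro power_increasing) auto
    then have muL: "\<mu> \<le> L" using k1 by (simp add: \<mu>_def j)
    have Dle: "2 * x * (\<Psi> 2 - 3 * \<Psi> 1) \<le> 2 * x * D" if "0 \<le> x" for x
      using that by (intro mult_left_mono) (auto simp: D_def)
    have D1: "\<Psi> (2 * \<mu>) \<le> 4 * \<Psi> \<mu> + 2 * \<mu> * D"
      using Psi_doubling[OF mu2] Dle[of \<mu>] mu2 by linarith
    have D2: "\<Psi> (2 * (2 * \<mu>)) \<le> 4 * \<Psi> (2 * \<mu>) + 2 * (2 * \<mu>) * D"
      using Psi_doubling[of "2 * \<mu>"] Dle[of "2 * \<mu>"] mu2 by linarith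
    have "\<Psi> (2 * (2 * \<mu>)) \<le> 16 * \<Psi> \<mu> + 12 * \<mu> * D" using D1 D2 by linarith
    then have "t * \<Psi> (2 * (2 * \<mu>)) \<le> t * (16 * \<Psi> \<mu> + 12 * \<mu> * D)" using elim by (intro mult_left_mono) auto
    also have "\<dots> = 16 * (t * \<Psi> \<mu>) + 12 * \<mu> * D * t" by (simp add: algebra_simps)
    also have "\<dots> \<le> 16 * (L * a + 1) + 12 * L * D * t"
    proof (intro add_mono)
      have "t * \<Psi> \<mu> \<le> \<mu> * a + 1" using nPj by (simp add: \<mu>_def)
      also have "\<mu> * a \<le> L * a" using muL a by (intro mult_right_mono)
      finally show "16 * (t * \<Psi> \<mu>) \<le> 16 * (L * a + 1)" by simp
      show "12 * \<mu> * D * t \<le> 12 * L * D * t" using muL elim by (intro mult_right_mono) (auto simp: D_def)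
    qed
    also have "\<dots> \<le> t powr (- g)" using elim by (simp add: L_def a_def)
    finally have "exp (- (t powr (- g))) \<le> exp (- (t * \<Psi> (2 * (2 * \<mu>))))" by simp
    also have "\<dots> \<le> prob {\<omega>\<in>space M. a \<le> V t \<omega>}"
      using Pk mu2 elim a by (intro prob_V_ge_Paley_Zygmund) (auto simp: j \<mu>_def mult_ac)
    finally show ?case by (simp add: a_def)
  qed
qed

section \<open>Passage above a level and the drift of V\<close>

text \<open>Optional stopping for the martingale \<open>exp (l * S k - k * h * \<Psi> l)\<close> at
  the first grid time above \<open>a\<close>, carried out as the recursion \<open>step\<close>. A
  path that crosses by an increment of at most \<open>1\<close> is stopped below
  \<open>a + 1\<close>; larger increments are charged to \<open>?J n\<close>, whose multiple by the
  number of steps vanishes with the mesh. A rational \<open>T\<close> makes all grid times rational,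
  so the event is the same for every mesh.\<close>

lemma prob_level_reached_ge:
  assumes l: "l > 0" "\<Psi> l > 0" and a: "a > 0" and T: "T > 0" "T \<in> \<rat>"
  shows "1 \<le> exp (l * (a + 1)) * prob {\<omega>\<in>space M. \<exists>q\<in>\<rat>. 0 \<le> q \<and> a \<le> V q \<omega>} + exp (l * a - T * \<Psi> l)"
proof -
  define E where "E = {\<omega>\<in>space M. \<exists>q\<in>\<rat>. 0 \<le> q \<and> a \<le> V q \<omega>}"
  have "E = (\<Union>q\<in>\<rat> \<inter> {0..}. {\<omega>\<in>space M. a \<le> V q \<omega>})" by (auto simp: E_def)
  also have "\<dots> \<in> sets M"
    by (intro sets.countable_UN'') (auto intro: countable_subset[OF _ countable_rat])
  finally have E[measurable]: "E \<in> sets M" .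
  let ?h = "\<lambda>n. T / real (Suc n)"
  let ?J = "\<lambda>n. \<integral>\<omega>. exp (l * V (?h n) \<omega>) * indicator {1<..} (V (?h n) \<omega>) \<partial>M"
  have main: "1 \<le> exp (l * (a + 1)) * prob E + exp (l * a - T * \<Psi> l) + exp (l * a) * (real (Suc n) * ?J n)" for n
  proof -
    define h where "h = ?h n"
    have h: "h > 0" using T by (simp add: h_def)
    note [measurable] = incr_measurable[OF less_imp_le[OF h]]
    define S where "S k \<omega> = (\<Sum>i<k. incr h i \<omega>)" for k \<omega>
    have [measurable]: "S k \<in> borel_measurable M" for k unfolding S_def by measurable
    define B where "B k = {\<omega>\<in>space M. \<forall>j\<le>k. S j \<omega> < a}" for k
    have [measurable]: "B k \<in> sets M" for k unfolding B_def by measurable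
    have int_bd: "integrable M f" if "f \<in> borel_measurable M" "\<And>\<omega>. \<omega> \<in> space M \<Longrightarrow> \<bar>f \<omega>\<bar> \<le> b" for f :: "'a \<Rightarrow> real" and b
      using that by (intro integrable_const_bound[of _ b]) auto
    define e where "e k = (\<integral>\<omega>. exp (l * S k \<omega>) * indicator (B k) \<omega> \<partial>M)" for k
    have le_a: "exp (l * S k \<omega>) * indicator (B k) \<omega> \<le> exp (l * a)" for k \<omega>
      using l by (auto simp: B_def indicator_def)
    have ie: "integrable M (\<lambda>\<omega>. exp (l * S k \<omega>) * indicator (B k) \<omega>)" for k
      using le_a by (intro int_bd[of _ "exp (l * a)"]) auto
    have distr_incr: "integrable M (\<lambda>\<omega>. f (incr h k \<omega>)) \<longleftrightarrow> integrable M (\<lambda>\<omega>. f (V h \<omega>))"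
      "(\<integral>\<omega>. f (incr h k \<omega>) \<partial>M) = (\<integral>\<omega>. f (V h \<omega>) \<partial>M)"
      if [measurable]: "f \<in> borel_measurable borel" for f :: "real \<Rightarrow> real" and k
    proof -
      show "integrable M (\<lambda>\<omega>. f (incr h k \<omega>)) \<longleftrightarrow> integrable M (\<lambda>\<omega>. f (V h \<omega>))"
        using integrable_distr_eq[of "incr h k" M borel f] integrable_distr_eq[of "V h" M borel f] h incr_distr[of h k] by simp
      show "(\<integral>\<omega>. f (incr h k \<omega>) \<partial>M) = (\<integral>\<omega>. f (V h \<omega>) \<partial>M)"
        using integral_distr[of "incr h k" M borel f] integral_distr[of "V h" M borel f] h incr_distr[of h k] by simp
    qed
    have prod: "integrable M (\<lambda>\<omega>. exp (l * S (Suc k) \<omega>) * indicator (B k) \<omega>)"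
      "(\<integral>\<omega>. exp (l * S (Suc k) \<omega>) * indicator (B k) \<omega> \<partial>M) = exp (h * \<Psi> l) * e k" for k
    proof -
      let ?X = "\<lambda>x. exp (l * (\<Sum>i<k. x i)) * indicator {x. \<forall>j\<le>k. (\<Sum>i<j. x i) < a} x :: real"
      have "indep_var (PiM {..<k} (\<lambda>_. borel)) (\<lambda>\<omega>. restrict (\<lambda>i. incr h i \<omega>) {..<k})
          (PiM {k} (\<lambda>_. borel)) (\<lambda>\<omega>. restrict (\<lambda>i. incr h i \<omega>) {k})"
        using h by (intro indep_var_restrict[OF incr_indep[of h "Suc k"]]) auto
      then have "indep_var borel (?X \<circ> (\<lambda>\<omega>. restrict (\<lambda>i. incr h i \<omega>) {..<k}))
          borel ((\<lambda>x. exp (l * x k)) \<circ> (\<lambda>\<omega>. restrict (\<lambda>i. incr h i \<omega>) {k}))"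
      proof (rule indep_var_compose)
        show "?X \<in> borel_measurable (PiM {..<k} (\<lambda>_. borel))"
          by (auto intro!: borel_measurable_times borel_measurable_exp borel_measurable_sum borel_measurable_indicator' pred_intros_finite borel_measurable_less
             measurable_component_singleton borel_measurable_const simp: indicator_def)
      qed measurable
      moreover have "?X \<circ> (\<lambda>\<omega>. restrict (\<lambda>i. incr h i \<omega>) {..<k}) = (\<lambda>\<omega>. exp (l * S k \<omega>) * indicator {\<omega>. \<forall>j\<le>k. S j \<omega> < a} \<omega>)"
        by (auto simp: S_def indicator_def fun_eq_iff intro!: sum.cong)
      moreover have "(\<lambda>x. exp (l * x k)) \<circ> (\<lambda>\<omega>. restrict (\<lambda>i. incr h i \<omega>) {k}) = (\<lambda>\<omega>. exp (l * incr h k \<omega>))"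
        by (simp add: fun_eq_iff)
      ultimately have ind: "indep_var borel (\<lambda>\<omega>. exp (l * S k \<omega>) * indicator {\<omega>. \<forall>j\<le>k. S j \<omega> < a} \<omega>) borel (\<lambda>\<omega>. exp (l * incr h k \<omega>))"
        by simp
      have indB: "indicat_real {\<omega>. \<forall>j\<le>k. S j \<omega> < a} \<omega> = indicator (B k) \<omega>" if "\<omega> \<in> space M" for \<omega>
        using that by (auto simp: B_def indicator_def)
      have i1: "integrable M (\<lambda>\<omega>. exp (l * S k \<omega>) * indicator {\<omega>. \<forall>j\<le>k. S j \<omega> < a} \<omega>)"
        using ie[of k] by (simp add: indB cong: Bochner_Integration.integrable_cong)
      have i2: "integrable M (\<lambda>\<omega>. exp (l * incr h k \<omega>))"
        using distr_incr(1)[of "\<lambda>x. exp (l * x)" k] exp_V_integrable[of h l] h l by simp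
      have eq: "exp (l * S k \<omega>) * indicator (B k) \<omega> * exp (l * incr h k \<omega>) = exp (l * S (Suc k) \<omega>) * indicator (B k) \<omega>" for \<omega>
        by (simp add: S_def distrib_left exp_add)
      show "integrable M (\<lambda>\<omega>. exp (l * S (Suc k) \<omega>) * indicator (B k) \<omega>)"
        using indep_var_integrable[OF ind i1 i2] by (simp add: eq indB cong: Bochner_Integration.integrable_cong)
      have "(\<integral>\<omega>. exp (l * S (Suc k) \<omega>) * indicator (B k) \<omega> \<partial>M)
          = (\<integral>\<omega>. exp (l * S k \<omega>) * indicator {\<omega>. \<forall>j\<le>k. S j \<omega> < a} \<omega> * exp (l * incr h k \<omega>) \<partial>M)"
        by (intro Bochner_Integration.integral_cong) (simp_all only: eq indB)
      also have "\<dots> = (\<integral>\<omega>. exp (l * S k \<omega>) * indicator {\<omega>. \<forall>j\<le>k. S j \<omega> < a} \<omega> \<partial>M) * (\<integral>\<omega>. exp (l * incr h k \<omega>) \<partial>M)"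
        by (rule indep_var_lebesgue_integral[OF ind i1 i2])
      also have "(\<integral>\<omega>. exp (l * S k \<omega>) * indicator {\<omega>. \<forall>j\<le>k. S j \<omega> < a} \<omega> \<partial>M) = e k"
        unfolding e_def by (intro Bochner_Integration.integral_cong) (simp_all only: indB)
      also have "(\<integral>\<omega>. exp (l * incr h k \<omega>) \<partial>M) = exp (h * \<Psi> l)"
        using distr_incr(2)[of "\<lambda>x. exp (l * x)" k] exp_V_integral[of h l] h l by simp
      finally show "(\<integral>\<omega>. exp (l * S (Suc k) \<omega>) * indicator (B k) \<omega> \<partial>M) = exp (h * \<Psi> l) * e k"
        by (simp only: mult.commute)
    qed
    define f where "f k = exp (- (real k * h * \<Psi> l)) * e k" for k
    define J where "J = ?J n"
    have J0: "0 \<le> J" unfolding J_def by (intro integral_nonneg_AE) (auto simp: indicator_def)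
    have step: "f k \<le> f (Suc k) + (exp (l * (a + 1)) * (prob (B k) - prob (B (Suc k))) + exp (l * a) * J)" for k
    proof -
      have ptw: "exp (l * S (Suc k) \<omega>) * indicator (B k) \<omega> \<le> exp (l * S (Suc k) \<omega>) * indicator (B (Suc k)) \<omega>
          + (exp (l * (a + 1)) * (indicator (B k) \<omega> - indicator (B (Suc k)) \<omega>)
          + exp (l * a) * (exp (l * incr h k \<omega>) * indicator {1<..} (incr h k \<omega>)))" for \<omega>
      proof -
        have sub: "\<omega> \<in> B (Suc k) \<Longrightarrow> \<omega> \<in> B k" by (auto simp: B_def)
        have Sk: "\<omega> \<in> B k \<Longrightarrow> S k \<omega> < a" by (auto simp: B_def)
        have S: "S (Suc k) \<omega> = S k \<omega> + incr h k \<omega>" by (simp add: S_def)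
        consider "\<omega> \<notin> B k" | "\<omega> \<in> B (Suc k)" | "\<omega> \<in> B k" "\<omega> \<notin> B (Suc k)" "incr h k \<omega> \<le> 1"
          | "\<omega> \<in> B k" "\<omega> \<notin> B (Suc k)" "1 < incr h k \<omega>" by linarith
        then show ?thesis
        proof cases
          case 3
          then have "exp (l * S (Suc k) \<omega>) \<le> exp (l * (a + 1))" using l Sk S by auto
          then show ?thesis using 3 by simp
        next
          case 4
          then have "exp (l * S (Suc k) \<omega>) \<le> exp (l * (a + incr h k \<omega>))" using l Sk S by auto
          then show ?thesis using 4 by (simp add: distrib_left exp_add add_increasing)
        qed (use sub in \<open>auto simp: indicator_def\<close>)
      qed
      have iB: "integrable M (indicat_real (B k))" for k by (intro int_bd[of _ 1]) (auto simp: indicator_def)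
      have iJ: "integrable M (\<lambda>\<omega>. exp (l * incr h k \<omega>) * indicator {1<..} (incr h k \<omega>))"
        using distr_incr(1)[of "\<lambda>x. exp (l * x) * indicator {1<..} x" k] exp_V_indicator_integrable[of h l "{1<..}"] h l by simp
      have J: "(\<integral>\<omega>. exp (l * incr h k \<omega>) * indicator {1<..} (incr h k \<omega>) \<partial>M) = J"
        using distr_incr(2)[of "\<lambda>x. exp (l * x) * indicator {1<..} x" k] by (simp add: J_def h_def)
      have "exp (h * \<Psi> l) * e k \<le> (\<integral>\<omega>. exp (l * S (Suc k) \<omega>) * indicator (B (Suc k)) \<omega>
          + (exp (l * (a + 1)) * (indicator (B k) \<omega> - indicator (B (Suc k)) \<omega>)
          + exp (l * a) * (exp (l * incr h k \<omega>) * indicator {1<..} (incr h k \<omega>))) \<partial>M)"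
        unfolding prod(2)[symmetric]
        by (intro integral_mono ptw prod(1) Bochner_Integration.integrable_add Bochner_Integration.integrable_diff integrable_mult_right ie iB iJ)
      also have "\<dots> = e (Suc k) + (exp (l * (a + 1)) * (prob (B k) - prob (B (Suc k))) + exp (l * a) * J)"
        using ie iB iJ J by (simp add: e_def)
      finally have "exp (- (real (Suc k) * h * \<Psi> l)) * (exp (h * \<Psi> l) * e k) \<le> exp (- (real (Suc k) * h * \<Psi> l)) *
         (e (Suc k) + (exp (l * (a + 1)) * (prob (B k) - prob (B (Suc k))) + exp (l * a) * J))"
        by (intro mult_left_mono) auto
      moreover have "exp (- (real (Suc k) * h * \<Psi> l)) * (exp (h * \<Psi> l) * e k) = f k"
      proof -
        have "- (real (Suc k) * h * \<Psi> l) + h * \<Psi> l = - (real k * h * \<Psi> l)" by (simp add: algebra_simps)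
        then show ?thesis unfolding f_def by (metis mult.assoc mult_exp_exp)
      qed
      moreover have "exp (- (real (Suc k) * h * \<Psi> l)) * (exp (l * (a + 1)) * (prob (B k) - prob (B (Suc k))) + exp (l * a) * J)
          \<le> 1 * (exp (l * (a + 1)) * (prob (B k) - prob (B (Suc k))) + exp (l * a) * J)"
      proof (rule mult_right_mono)
        have "prob (B (Suc k)) \<le> prob (B k)" by (intro finite_measure_mono) (auto simp: B_def)
        then show "0 \<le> exp (l * (a + 1)) * (prob (B k) - prob (B (Suc k))) + exp (l * a) * J" using J0 by simp
      qed (use h l in simp)
      ultimately show ?thesis by (simp only: distrib_left f_def)
    qed
    have sum: "f 0 \<le> f k + exp (l * (a + 1)) * (prob (B 0) - prob (B k)) + real k * (exp (l * a) * J)" for k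
    proof (induction k)
      case (Suc k)
      then show ?case using step[of k] by (simp add: algebra_simps)
    qed simp
    have B0: "B 0 = space M" using a by (auto simp: B_def S_def)
    have "f 0 = 1" by (simp add: f_def e_def S_def B0 prob_space)
    have "e (Suc n) \<le> exp (l * a)" unfolding e_def
      using le_a by (intro integral_le_const ie) auto
    then have "f (Suc n) \<le> exp (- (real (Suc n) * h * \<Psi> l)) * exp (l * a)"
      unfolding f_def by (intro mult_left_mono) auto
    also have "\<dots> = exp (l * a - T * \<Psi> l)" by (simp add: mult_exp_exp h_def del: of_nat_Suc)
    finally have fn: "f (Suc n) \<le> exp (l * a - T * \<Psi> l)" .
    have "1 - prob (B (Suc n)) = prob (space M - B (Suc n))" by (simp add: prob_compl)
    also have "\<dots> \<le> prob E"
    proof (rule finite_measure_mono_AE)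
      show "AE \<omega> in M. \<omega> \<in> space M - B (Suc n) \<longrightarrow> \<omega> \<in> E"
        using V_eq_sum_incr[of h]
      proof eventually_elim
        case (elim \<omega>)
        show ?case
        proof
          assume "\<omega> \<in> space M - B (Suc n)"
          then obtain j where j: "\<omega> \<in> space M" "a \<le> S j \<omega>" by (auto simp: B_def not_less)
          have "real j * h \<in> \<rat>" using T by (simp add: h_def)
          moreover have "0 \<le> real j * h" using h by simp
          ultimately show "\<omega> \<in> E" using j elim unfolding E_def S_def by auto
        qed
      qed
    qed measurable
    finally have "exp (l * (a + 1)) * (1 - prob (B (Suc n))) \<le> exp (l * (a + 1)) * prob E" by (intro mult_left_mono) auto
    moreover have "real (Suc n) * (exp (l * a) * J) = exp (l * a) * (real (Suc n) * J)" by simp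
    ultimately show ?thesis using sum[of "Suc n"] fn \<open>f 0 = 1\<close> unfolding B0 prob_space J_def[symmetric] by linarith
  qed
  have "(\<lambda>n. exp (l * (a + 1)) * prob E + exp (l * a - T * \<Psi> l) + exp (l * a) * (real (Suc n) * ?J n))
      \<longlonglongrightarrow> exp (l * (a + 1)) * prob E + exp (l * a - T * \<Psi> l) + exp (l * a) * 0"
    using l T by (intro tendsto_intros exp_jump_tendsto_0) auto
  then have "1 \<le> exp (l * (a + 1)) * prob E + exp (l * a - T * \<Psi> l) + exp (l * a) * 0"
    using main by (intro LIMSEQ_le_const) auto
  then show ?thesis by (simp add: E_def)
qed

text \<open>Excludes that \<open>kappa\<close> is the unspecified infimum of the empty set.\<close>

lemma not_drift_to_bot_if_Psi_pos:
  assumes P: "\<And>l. l > 0 \<Longrightarrow> \<Psi> l > 0"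
  shows "\<not> (AE \<omega> in M. filterlim (\<lambda>t. V t \<omega>) at_bot at_top)"
proof
  assume drift: "AE \<omega> in M. filterlim (\<lambda>t. V t \<omega>) at_bot at_top"
  let ?E = "\<lambda>a. {\<omega>\<in>space M. \<exists>q\<in>\<rat>. 0 \<le> q \<and> a \<le> V q \<omega>}"
  have Em: "?E a \<in> sets M" for a
  proof -
    have "?E a = (\<Union>q\<in>\<rat> \<inter> {0..}. {\<omega>\<in>space M. a \<le> V q \<omega>})" by auto
    also have "\<dots> \<in> sets M"
      by (intro sets.countable_UN'') (auto intro: countable_subset[OF _ countable_rat])
    finally show ?thesis .
  qed
  have "prob (?E a) = 1" if a: "a > 0" for a
  proof -
    \<comment> \<open>Sending \<open>T\<close> to infinity along the integers removes the second
      term because \<open>\<Psi> l > 0\<close>; letting \<open>l \<rightarrow> 0\<close> afterwards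
      turns the factor into \<open>1\<close>.\<close>
    have "1 \<le> exp (l * (a + 1)) * prob (?E a)" if l: "l > 0" for l
    proof -
      have "(\<lambda>n. exp (l * (a + 1)) * prob (?E a) + exp (l * a - real (Suc n) * \<Psi> l)) \<longlonglongrightarrow> exp (l * (a + 1)) * prob (?E a) + 0"
        using P[OF l] by (intro tendsto_intros) real_asymp
      then have "1 \<le> exp (l * (a + 1)) * prob (?E a) + 0"
        using prob_level_reached_ge[OF l P[OF l] a, of "real (Suc _)"] by (intro LIMSEQ_le_const) auto
      then show ?thesis by simp
    qed
    moreover have "((\<lambda>l. exp (l * (a + 1)) * prob (?E a)) \<longlongrightarrow> exp (0 * (a + 1)) * prob (?E a)) (at_right 0)"
      by (intro tendsto_intros)
    ultimately have "1 \<le> exp (0 * (a + 1)) * prob (?E a)"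
      by (intro tendsto_lowerbound[of _ _ "at_right 0"]) (auto simp: eventually_at_right_less[of 0] intro: eventually_mono[OF eventually_at_right_less[of 0]])
    then show ?thesis using prob_le_1[of "?E a"] by simp
  qed
  then have "AE \<omega> in M. \<omega> \<in> ?E (real (Suc n))" for n using Em by (simp add: prob_eq_1 del: of_nat_Suc)
  then have "AE \<omega> in M. \<forall>n. \<omega> \<in> ?E (real (Suc n))" by (subst AE_all_countable) blast
  with drift have "AE \<omega> in M. False"
  proof eventually_elim
    case (elim \<omega>)
    have sp: "\<omega> \<in> space M" using elim by auto
    have "eventually (\<lambda>t. V t \<omega> \<le> 0) at_top" using elim by (auto simp: filterlim_at_bot)
    then obtain T where T: "\<And>t. t \<ge> T \<Longrightarrow> V t \<omega> \<le> 0" by (auto simp: eventually_at_top_linorder)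
    obtain B where B: "\<And>s. s \<in> {0..T} \<Longrightarrow> \<bar>V s \<omega>\<bar> \<le> B" using cadlag_bounded[OF V_cadlag[OF sp]] by blast
    obtain n where n: "B < real n" using reals_Archimedean2 by blast
    obtain q where q: "0 \<le> q" "real (Suc n) \<le> V q \<omega>" using elim by blast
    show False using T[of q] B[of q] q n by (cases "q \<le> T") auto
  qed
  then show False by simp
qed

end

section \<open>Skeleton chains of the conditioned process\<close>

lemma natural_sigma_space[simp]: "space (natural_sigma N Y s) = space N"
  by (auto simp: natural_sigma_def space_measure_of_conv)

lemma natural_sigma_sets:
  "sets (natural_sigma N Y s) = sigma_sets (space N) {Y u -` A \<inter> space N | u A. 0 \<le> u \<and> u \<le> s \<and> A \<in> sets borel}"
  unfolding natural_sigma_def by (rule sets_measure_of) auto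

lemma measurable_natural_sigma:
  assumes "0 \<le> u" "u \<le> s" shows "Y u \<in> borel_measurable (natural_sigma N Y s)"
proof (rule measurableI)
  fix A :: "real set" assume "A \<in> sets borel"
  then show "Y u -` A \<inter> space (natural_sigma N Y s) \<in> sets (natural_sigma N Y s)"
    unfolding natural_sigma_sets natural_sigma_space using assms by (intro sigma_sets.Basic) blast
qed auto

locale markov =
  fixes N :: "'b measure" and S P x and Y :: "real \<Rightarrow> 'b \<Rightarrow> real"
  assumes markov: "markov_process N S P x Y"
begin

sublocale N: prob_space N using markov by (simp add: markov_process_def)

lemma Y_measurable[measurable]: "0 \<le> t \<Longrightarrow> Y t \<in> borel_measurable N"
  using markov by (simp add: markov_process_def)

lemma Y_cadlag: "\<omega> \<in> space N \<Longrightarrow> cadlag (\<lambda>t. Y t \<omega>)"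
  using markov by (simp add: markov_process_def)

lemma Y_in: "0 \<le> t \<Longrightarrow> \<omega> \<in> space N \<Longrightarrow> Y t \<omega> \<in> S"
  using markov by (simp add: markov_process_def)

lemma Y_0: "AE \<omega> in N. Y 0 \<omega> = x"
  using markov by (simp add: markov_process_def)

lemma subalgebra_natural_sigma: "subalgebra N (natural_sigma N Y s)"
  unfolding subalgebra_def
proof
  show "sets (natural_sigma N Y s) \<subseteq> sets N"
    unfolding natural_sigma_sets by (rule sets.sigma_sets_subset) (auto intro!: measurable_sets)
qed simp

lemma cond_exp_eq:
  assumes "0 \<le> s" "0 \<le> h" "B \<in> sets borel"
  shows "AE \<omega> in N. real_cond_exp N (natural_sigma N Y s) (indicator (Y (s + h) -` B \<inter> space N)) \<omega>
          = measure (P h (Y s \<omega>)) B"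
  using markov assms by (auto simp: markov_process_def)

text \<open>Measurability of the kernel in its starting point is not contained in
  \<open>markov_process\<close>; it enters as the hypothesis \<open>meas\<close> and is later
  supplied by \<open>Kop\<close>.\<close>

lemma nn_integral_markov_indicator:
  assumes s: "0 \<le> s" and h: "0 \<le> h" and B: "B \<in> sets borel"
    and Z: "Z \<in> borel_measurable (natural_sigma N Y s)" "\<And>\<omega>. \<omega> \<in> space N \<Longrightarrow> 0 \<le> Z \<omega> \<and> Z \<omega> \<le> (1::real)"
    and meas: "(\<lambda>\<omega>. Z \<omega> * measure (P h (Y s \<omega>)) B) \<in> borel_measurable N"
  shows "(\<integral>\<^sup>+\<omega>. ennreal (Z \<omega>) * indicator B (Y (s + h) \<omega>) \<partial>N) = (\<integral>\<^sup>+\<omega>. ennreal (Z \<omega>) * ennreal (measure (P h (Y s \<omega>)) B) \<partial>N)"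
proof -
  interpret fs: finite_measure_subalgebra N "natural_sigma N Y s"
    using subalgebra_natural_sigma by unfold_locales
  let ?I = "indicat_real (Y (s + h) -` B \<inter> space N)"
  have [measurable]: "Z \<in> borel_measurable N" by (rule measurable_from_subalg[OF subalgebra_natural_sigma Z(1)])
  have [measurable]: "?I \<in> borel_measurable N" using s h B by (intro borel_measurable_indicator measurable_sets[OF Y_measurable]) auto
  have int: "integrable N (\<lambda>\<omega>. Z \<omega> * ?I \<omega>)"
  proof (rule N.integrable_const_bound[of _ 1])
    show "AE \<omega> in N. norm (Z \<omega> * ?I \<omega>) \<le> 1" using Z(2) by (intro AE_I2) (auto simp: indicator_def)
  qed measurable
  note ce = fs.real_cond_exp_intg[OF int Z(1)]
  have AE: "AE \<omega> in N. Z \<omega> * real_cond_exp N (natural_sigma N Y s) ?I \<omega> = Z \<omega> * measure (P h (Y s \<omega>)) B"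
    using cond_exp_eq[OF s h B] by eventually_elim simp
  have i2: "integrable N (\<lambda>\<omega>. Z \<omega> * measure (P h (Y s \<omega>)) B)"
    using ce(1) AE meas by (subst integrable_cong_AE[symmetric, OF _ _ AE]) auto
  have "(\<integral>\<^sup>+\<omega>. ennreal (Z \<omega>) * indicator B (Y (s + h) \<omega>) \<partial>N) = (\<integral>\<^sup>+\<omega>. ennreal (Z \<omega> * ?I \<omega>) \<partial>N)"
    by (intro nn_integral_cong) (auto simp: indicator_def)
  also have "\<dots> = ennreal (\<integral>\<omega>. Z \<omega> * ?I \<omega> \<partial>N)"
    using int Z(2) by (intro nn_integral_eq_integral AE_I2) (auto simp: indicator_def)
  also have "(\<integral>\<omega>. Z \<omega> * ?I \<omega> \<partial>N) = (\<integral>\<omega>. Z \<omega> * real_cond_exp N (natural_sigma N Y s) ?I \<omega> \<partial>N)"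
    by (rule ce(2)[symmetric]) auto
  also have "\<dots> = (\<integral>\<omega>. Z \<omega> * measure (P h (Y s \<omega>)) B \<partial>N)"
    using ce(1) AE meas by (intro integral_cong_AE) auto
  also have "ennreal \<dots> = (\<integral>\<^sup>+\<omega>. ennreal (Z \<omega> * measure (P h (Y s \<omega>)) B) \<partial>N)"
    using i2 Z(2) by (intro nn_integral_eq_integral[symmetric] AE_I2) auto
  also have "\<dots> = (\<integral>\<^sup>+\<omega>. ennreal (Z \<omega>) * ennreal (measure (P h (Y s \<omega>)) B) \<partial>N)"
    using Z(2) by (intro nn_integral_cong) (auto simp: ennreal_mult)
  finally show ?thesis .
qed

text \<open>The Markov property at time \<open>0\<close> is applied to the sure event, whose
  conditional probability is \<open>1\<close>. As \<open>Y 0 = x\<close> almost surely, this fixes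
  the mass of the kernel at the single point \<open>x\<close>.\<close>

lemma measure_kernel_UNIV:
  assumes h: "0 \<le> h" shows "measure (P h x) UNIV = 1"
proof -
  interpret fs: finite_measure_subalgebra N "natural_sigma N Y 0"
    using subalgebra_natural_sigma by unfold_locales
  have "AE \<omega> in N. real_cond_exp N (natural_sigma N Y 0) (indicat_real (space N)) \<omega> = indicat_real (space N) \<omega>"
  proof (rule fs.real_cond_exp_F_meas)
    show "integrable N (indicat_real (space N))" by (intro integrable_real_indicator) (auto simp: N.emeasure_space_1)
    show "indicat_real (space N) \<in> borel_measurable (natural_sigma N Y 0)"
      using sets.top[of "natural_sigma N Y 0"] by (intro borel_measurable_indicator) simp
  qed
  moreover have "AE \<omega> in N. real_cond_exp N (natural_sigma N Y 0) (indicator (Y (0 + h) -` UNIV \<inter> space N)) \<omega> = measure (P h (Y 0 \<omega>)) UNIV"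
    by (rule cond_exp_eq[OF order_refl h]) simp
  ultimately have "AE \<omega> in N. measure (P h x) UNIV = 1"
    using Y_0 AE_space
  proof eventually_elim
    case (elim \<omega>)
    then show ?case by simp
  qed
  then show ?thesis by simp
qed

end

section \<open>The killed semigroup and its transform by W\<close>

locale conditioned_levy = sn_levy_ns M V \<Psi> for M :: "'a measure" and V \<Psi> +
  fixes W :: "real \<Rightarrow> real" and N :: "real \<Rightarrow> 'b measure" and Vup :: "real \<Rightarrow> real \<Rightarrow> 'b \<Rightarrow> real"
  assumes scale: "scale_function M V \<Psi> W"
    and cond: "conditioned_to_stay_positive M V W N Vup"
begin

definition infV :: "real \<Rightarrow> 'a \<Rightarrow> real" where
  "infV t \<omega> = (INF s\<in>{0..t}. V s \<omega>)"

lemma bdd_below_V: "\<omega> \<in> space M \<Longrightarrow> bdd_below ((\<lambda>s. V s \<omega>) ` {0..t})"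
proof -
  assume "\<omega> \<in> space M"
  then obtain B where "\<And>s. s \<in> {0..t} \<Longrightarrow> \<bar>V s \<omega>\<bar> \<le> B" using cadlag_bounded[OF V_cadlag] by blast
  then show ?thesis by (intro bdd_belowI2[of _ "- B"]) force
qed

lemma infV_le: "\<omega> \<in> space M \<Longrightarrow> 0 \<le> s \<Longrightarrow> s \<le> t \<Longrightarrow> infV t \<omega> \<le> V s \<omega>"
  unfolding infV_def by (intro cINF_lower bdd_below_V) auto

lemma INF_plus_V:
  assumes "\<omega> \<in> space M" "0 \<le> t" shows "(INF s\<in>{0..t}. x + V s \<omega>) = x + infV t \<omega>"
proof (rule antisym)
  show "x + infV t \<omega> \<le> (INF s\<in>{0..t}. x + V s \<omega>)"
    using assms infV_le by (intro cINF_greatest) auto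
  obtain B where B: "\<And>s. s \<in> {0..t} \<Longrightarrow> B \<le> V s \<omega>"
    using bdd_below_V[OF assms(1), of t] unfolding bdd_below_def by blast
  have "bdd_below ((\<lambda>s. x + V s \<omega>) ` {0..t})" using B by (intro bdd_belowI2[of _ "x + B"]) auto
  note * = cINF_lower[OF this]
  have "(INF s\<in>{0..t}. x + V s \<omega>) - x \<le> infV t \<omega>"
    unfolding infV_def
  proof (rule cINF_greatest)
    fix s assume "s \<in> {0..t}"
    then show "(INF s\<in>{0..t}. x + V s \<omega>) - x \<le> V s \<omega>"
      using *[of s] by simp
  qed (use assms in simp)
  then show "(INF s\<in>{0..t}. x + V s \<omega>) \<le> x + infV t \<omega>" by simp
qed

lemma infV_measurable[measurable]:
  assumes "0 \<le> t" shows "infV t \<in> borel_measurable M"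
proof (cases "t = 0")
  case True
  then show ?thesis using V_measurable[of 0] by (simp add: infV_def[abs_def])
next
  case False
  then have t: "t > 0" using assms by simp
  have eq: "{\<omega>\<in>space M. c \<le> infV t \<omega>} = {\<omega>\<in>space M. \<forall>n. \<forall>k\<le>2^n. c \<le> V (real k * (t / 2^n)) \<omega>}" for c
    unfolding infV_def using le_INF_cadlag_iff_dyadic[OF V_cadlag t] by (intro Collect_cong conj_cong refl)
  have [measurable]: "V (real k * (t / 2^n)) \<in> borel_measurable M" for k n :: nat using t by (intro V_measurable) auto
  have "{\<omega>\<in>space M. \<forall>n. \<forall>k\<le>2^n. c \<le> V (real k * (t / 2^n)) \<omega>} \<in> sets M" for c by measurable
  then show ?thesis unfolding borel_measurable_iff_ge eq by blast
qed

lemma W_mono: "0 \<le> x \<Longrightarrow> x \<le> y \<Longrightarrow> W x \<le> W y"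
  using scale by (auto simp: scale_function_def mono_on_def)

lemma W_nonneg: "0 \<le> x \<Longrightarrow> 0 \<le> W x"
  using scale by (auto simp: scale_function_def)

text \<open>Cutting \<open>W\<close> off outside \<open>(0, \<infinity>)\<close> makes it measurable
  and increasing on the whole line, as kernels and Harris' inequality require.\<close>

definition Wp :: "real \<Rightarrow> ennreal" where
  "Wp x = ennreal (W x) * indicator {0<..} x"

lemma W_ind_measurable: "(\<lambda>x. indicator {0..} x * W x) \<in> borel_measurable borel"
  using borel_measurable_continuous_on_indicator[of "{0..}" W] scale by (simp add: scale_function_def)

lemma Wp_measurable[measurable]: "Wp \<in> borel_measurable borel"
proof -
  have "Wp x = ennreal (indicator {0..} x * W x) * indicator {0<..} x" for x by (auto simp: Wp_def indicator_def)
  then show ?thesis using W_ind_measurable by (simp add: Wp_def[abs_def] cong: measurable_cong)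
qed

lemma Wp_mono: "mono Wp"
  by (auto simp: mono_def Wp_def indicator_def intro!: ennreal_leI W_mono)

lemma Wp_pos: "0 < x \<Longrightarrow> Wp x = ennreal (W x)"
  by (simp add: Wp_def)

text \<open>The semigroup of \<open>V\<close> killed on leaving \<open>(0, \<infinity>)\<close>,
  acting on nonnegative functions.\<close>

definition Q :: "real \<Rightarrow> (real \<Rightarrow> ennreal) \<Rightarrow> real \<Rightarrow> ennreal" where
  "Q t g y = (\<integral>\<^sup>+\<omega>. g (y + V t \<omega>) * indicator {0<..} (y + infV t \<omega>) \<partial>M)"

lemma Q_measurable[measurable]:
  assumes t: "0 \<le> t" and [measurable]: "g \<in> borel_measurable borel" shows "Q t g \<in> borel_measurable borel"
proof -
  note [measurable] = V_measurable[OF t] infV_measurable[OF t]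
  show ?thesis unfolding Q_def by measurable
qed

lemma Q_mono:
  assumes "0 \<le> t" "\<And>z. 0 < z \<Longrightarrow> f z \<le> g z" shows "Q t f y \<le> Q t g y"
  unfolding Q_def
proof (intro nn_integral_mono)
  fix \<omega> assume "\<omega> \<in> space M"
  then show "f (y + V t \<omega>) * indicator {0<..} (y + infV t \<omega>) \<le> g (y + V t \<omega>) * indicator {0<..} (y + infV t \<omega>)"
    using infV_le[of \<omega> t t] assms by (auto simp: indicator_def)
qed

lemma up_kernel_sets[simp]: "sets (up_kernel M V W t y) = sets borel" "space (up_kernel M V W t y) = UNIV"
  by (simp_all add: up_kernel_def killed_law_def)

lemma markov_Vup: "0 < x \<Longrightarrow> markov (N x) {0<..} (up_kernel M V W) x (Vup x)"
  using cond by unfold_locales (simp add: conditioned_to_stay_positive_def)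

lemma measure_up_kernel_UNIV: "0 < x \<Longrightarrow> 0 \<le> t \<Longrightarrow> measure (up_kernel M V W t x) UNIV = 1"
  using markov.measure_kernel_UNIV[OF markov_Vup] by simp

lemma up_kernel_prob_space: "0 < x \<Longrightarrow> 0 \<le> t \<Longrightarrow> prob_space (up_kernel M V W t x)"
  using measure_up_kernel_UNIV[of x t]
  by (intro prob_spaceI) (cases "emeasure (up_kernel M V W t x) UNIV", auto simp: measure_def)

text \<open>Division by zero yields \<open>0\<close>: if \<open>W y = 0\<close>, the density
  \<open>W z / W y\<close> is zero and the kernel from \<open>y\<close> has no mass, against its
  total mass \<open>1\<close>.\<close>

lemma W_pos: assumes y: "0 < y" shows "0 < W y"
proof (rule ccontr)
  assume "\<not> 0 < W y"
  then have "W y = 0" using W_nonneg[of y] y by simp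
  then have "emeasure (up_kernel M V W 0 y) UNIV = 0"
    unfolding up_kernel_def by (subst emeasure_density) (auto simp: killed_law_def)
  then show False using measure_up_kernel_UNIV[OF y order_refl] by (simp add: measure_def)
qed

lemma nn_integral_up_kernel:
  assumes t: "0 \<le> t" and g[measurable]: "g \<in> borel_measurable borel" and y: "0 < y"
  shows "(\<integral>\<^sup>+z. g z \<partial>up_kernel M V W t y) = Q t (\<lambda>z. Wp z * g z) y / ennreal (W y)"
proof -
  note [measurable] = V_measurable[OF t] infV_measurable[OF t]
  let ?D = "{\<omega> \<in> space M. 0 < (INF s\<in>{0..t}. y + V s \<omega>)}"
  have D: "?D = {\<omega>\<in>space M. 0 < y + infV t \<omega>}" using INF_plus_V t by auto
  have Dm[measurable]: "?D \<in> sets M" unfolding D by measurable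
  have WW: "ennreal (W z / W y) * indicator {0<..} z = Wp z / ennreal (W y)" for z
    using W_nonneg[of z] W_pos[OF y] by (auto simp: Wp_def divide_ennreal indicator_def)
  have m: "(\<lambda>z. Wp z / ennreal (W y)) \<in> borel_measurable borel" by measurable
  have m2: "(\<lambda>\<omega>. y + V t \<omega>) \<in> borel_measurable (density M (indicator ?D))" by measurable
  have "(\<integral>\<^sup>+z. g z \<partial>up_kernel M V W t y) = (\<integral>\<^sup>+z. Wp z / ennreal (W y) * g z \<partial>killed_law M V t y)"
    unfolding up_kernel_def WW by (subst nn_integral_density) (auto simp: killed_law_def)
  also have "\<dots> = (\<integral>\<^sup>+\<omega>. Wp (y + V t \<omega>) / ennreal (W y) * g (y + V t \<omega>) \<partial>density M (indicator ?D))"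
    unfolding killed_law_def by (subst nn_integral_distr[OF m2]) auto
  also have "\<dots> = (\<integral>\<^sup>+\<omega>. indicator ?D \<omega> * (Wp (y + V t \<omega>) / ennreal (W y) * g (y + V t \<omega>)) \<partial>M)"
    by (subst nn_integral_density) auto
  also have "\<dots> = (\<integral>\<^sup>+\<omega>. (Wp (y + V t \<omega>) * g (y + V t \<omega>) * indicator {0<..} (y + infV t \<omega>)) / ennreal (W y) \<partial>M)"
    unfolding D by (intro nn_integral_cong) (auto simp: indicator_def divide_ennreal_def mult_ac)
  also have "\<dots> = Q t (\<lambda>z. Wp z * g z) y / ennreal (W y)"
    unfolding Q_def by (rule nn_integral_divide) measurable
  finally show ?thesis .
qed

text \<open>\<open>W\<close> is harmonic for the killed process. This is read off from the
  conditioned process, whose infinite lifetime gives \<open>up_kernel\<close> total mass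
  \<open>1\<close>.\<close>

lemma Q_Wp: assumes "0 \<le> t" "0 < y" shows "Q t Wp y = ennreal (W y)"
proof -
  have "emeasure (up_kernel M V W t y) UNIV = 1"
    using prob_space.emeasure_space_1[OF up_kernel_prob_space[OF assms(2,1)]] by simp
  then have "1 = Q t (\<lambda>z. Wp z * 1) y / ennreal (W y)"
    using nn_integral_up_kernel[OF assms(1) _ assms(2), of "\<lambda>_. 1"] by simp
  then have "1 * ennreal (W y) = Q t Wp y / ennreal (W y) * ennreal (W y)" by simp
  also have "\<dots> = Q t Wp y" using W_pos[OF assms(2)]
    by (simp add: ennreal_divide_times ennreal_times_divide[symmetric] divide_ennreal_def mult.assoc mult.commute[of "inverse _"] flip: divide_ennreal_def)
  finally show ?thesis by simp
qed

end

lemma natural_sigma_mono: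
  assumes "s \<le> t" "f \<in> borel_measurable (natural_sigma N Y s)"
  shows "f \<in> borel_measurable (natural_sigma N Y t)"
proof (rule measurable_from_subalg[OF _ assms(2)])
  show "subalgebra (natural_sigma N Y t) (natural_sigma N Y s)"
    unfolding subalgebra_def natural_sigma_sets using assms(1)
    by (intro conjI sigma_sets_mono') (simp, blast intro: order_trans)
qed

section \<open>Chains on a time grid\<close>

context conditioned_levy begin

text \<open>The semigroup of the conditioned process on positive states, with the value
  \<open>0\<close> elsewhere. Written through \<open>Q\<close>, it is measurable in the starting
  point.\<close>

definition Kop :: "real \<Rightarrow> (real \<Rightarrow> ennreal) \<Rightarrow> real \<Rightarrow> ennreal" where
  "Kop t g y = (if 0 < y then Q t (\<lambda>z. Wp z * g z) y / ennreal (W y) else 0)"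

lemma Kop_eq_up_kernel: "0 \<le> t \<Longrightarrow> g \<in> borel_measurable borel \<Longrightarrow> 0 < y \<Longrightarrow> Kop t g y = (\<integral>\<^sup>+z. g z \<partial>up_kernel M V W t y)"
  by (simp add: Kop_def nn_integral_up_kernel)

lemma W_Kop: "0 < y \<Longrightarrow> ennreal (W y) * Kop t g y = Q t (\<lambda>z. Wp z * g z) y"
  using W_pos[of y] by (simp add: Kop_def ennreal_times_divide mult.commute[of "ennreal (W y)"] mult_divide_eq_ennreal)

lemma Kop_measurable[measurable]:
  assumes t: "0 \<le> t" and [measurable]: "g \<in> borel_measurable borel" shows "Kop t g \<in> borel_measurable borel"
proof -
  have [measurable]: "Q t (\<lambda>z. Wp z * g z) \<in> borel_measurable borel" using t by measurable
  have "Kop t g y = (if 0 < y then Q t (\<lambda>z. Wp z * g z) y / Wp y else 0)" for y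
    by (simp add: Kop_def Wp_pos)
  then show ?thesis by (simp cong: measurable_cong)
qed

lemma Kop_mono: "0 \<le> t \<Longrightarrow> (\<And>z. 0 < z \<Longrightarrow> f z \<le> g z) \<Longrightarrow> Kop t f y \<le> Kop t g y"
  by (auto simp: Kop_def intro!: divide_right_mono_ennreal Q_mono mult_left_mono)

lemma Kop_cong: "0 \<le> t \<Longrightarrow> (\<And>z. 0 < z \<Longrightarrow> f z = g z) \<Longrightarrow> Kop t f y = Kop t g y"
  by (intro antisym Kop_mono) auto

lemma Kop_1: "0 \<le> t \<Longrightarrow> 0 < y \<Longrightarrow> Kop t (\<lambda>_. 1) y = 1"
  using Q_Wp[of t y] W_pos[of y] by (simp add: Kop_def divide_ennreal)

text \<open>The expectation from \<open>y\<close> of the product of \<open>\<psi>\<close> over the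
  next \<open>m\<close> grid points, the starting point excluded. An indicator \<open>\<psi>\<close>
  gives the probability of staying in a set, an exponential one the Laplace transform of a Riemann
  sum.\<close>

primrec chainG :: "(real \<Rightarrow> real) \<Rightarrow> real \<Rightarrow> nat \<Rightarrow> real \<Rightarrow> ennreal" where
  "chainG \<psi> h 0 = (\<lambda>_. 1)"
| "chainG \<psi> h (Suc m) = Kop h (\<lambda>z. ennreal (\<psi> z) * chainG \<psi> h m z)"

lemma chainG_measurable[measurable]: "0 \<le> h \<Longrightarrow> \<psi> \<in> borel_measurable borel \<Longrightarrow> chainG \<psi> h m \<in> borel_measurable borel"
  by (induction m) auto

end

text \<open>A common frame for the starting points \<open>x > 0\<close> and for \<open>0\<close>.
  The kernel is tied to \<open>up_kernel\<close> on positive states only, because from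
  \<open>0\<close> it is the law of the limit process.\<close>

locale up_markov = conditioned_levy M V \<Psi> W N Vup + markov N' S P x Y
  for M :: "'a measure" and V \<Psi> W and N :: "real \<Rightarrow> 'b measure" and Vup
    and N' :: "'c measure" and S P x and Y :: "real \<Rightarrow> 'c \<Rightarrow> real" +
  assumes kernel: "\<And>h y. 0 \<le> h \<Longrightarrow> 0 < y \<Longrightarrow> P h y = up_kernel M V W h y"
begin

text \<open>As \<open>Z\<close> vanishes on \<open>Y s \<le> 0\<close>, only kernels from positive
  states enter. Indicators are extended to all nonnegative Borel functions by linearity and monotone
  limits.\<close>

lemma nn_integral_step:
  assumes s: "0 \<le> s" and h: "0 \<le> h" and g: "g \<in> borel_measurable borel"
    and Z: "Z \<in> borel_measurable (natural_sigma N' Y s)" "\<And>\<omega>. \<omega> \<in> space N' \<Longrightarrow> 0 \<le> Z \<omega> \<and> Z \<omega> \<le> (1::real)"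
      "\<And>\<omega>. \<omega> \<in> space N' \<Longrightarrow> Y s \<omega> \<le> 0 \<Longrightarrow> Z \<omega> = 0"
  shows "(\<integral>\<^sup>+\<omega>. ennreal (Z \<omega>) * g (Y (s + h) \<omega>) \<partial>N') = (\<integral>\<^sup>+\<omega>. ennreal (Z \<omega>) * Kop h g (Y s \<omega>) \<partial>N')"
  using g
proof (induction g rule: borel_measurable_induct)
  have [measurable]: "Z \<in> borel_measurable N'" by (rule measurable_from_subalg[OF subalgebra_natural_sigma Z(1)])
  note [measurable] = Y_measurable[OF s] Y_measurable[of "s + h"] Kop_measurable[OF h]
  have sh: "0 \<le> s + h" using s h by simp
  {
    case (cong f g)
    then have "f = g" by auto
    then show ?case using cong by simp
  next
    case (set A)
    note [measurable] = set
    have eq: "ennreal (Z \<omega>) * ennreal (measure (P h (Y s \<omega>)) A) = ennreal (Z \<omega>) * Kop h (indicator A) (Y s \<omega>)"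
      if "\<omega> \<in> space N'" for \<omega>
    proof (cases "0 < Y s \<omega>")
      case True
      interpret U: prob_space "up_kernel M V W h (Y s \<omega>)" by (rule up_kernel_prob_space[OF True h])
      show ?thesis using kernel[OF h True] set Kop_eq_up_kernel[OF h _ True, of "indicator A"]
        by (simp add: U.emeasure_eq_measure)
    qed (use Z(3) that in auto)
    have eqr: "Z \<omega> * measure (P h (Y s \<omega>)) A = Z \<omega> * enn2real (Kop h (indicator A) (Y s \<omega>))" if "\<omega> \<in> space N'" for \<omega>
    proof (cases "0 < Y s \<omega>")
      case True
      show ?thesis using kernel[OF h True] set Kop_eq_up_kernel[OF h _ True, of "indicator A"]
        by (simp add: measure_def)
    qed (use Z(3) that in auto)
    have "(\<lambda>\<omega>. Z \<omega> * measure (P h (Y s \<omega>)) A) \<in> borel_measurable N'"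
      by (subst measurable_cong[OF eqr]) measurable
    from nn_integral_markov_indicator[OF s h set Z(1,2) this]
    show ?case by (simp add: eq cong: nn_integral_cong)
  next
    case (mult u c)
    note [measurable] = mult(2)
    have K: "Kop h (\<lambda>x. c * u x) y = c * Kop h u y" for y
    proof (cases "0 < y")
      case True
      then show ?thesis using h by (simp add: Kop_eq_up_kernel nn_integral_cmult cong: measurable_cong_sets)
    qed (simp add: Kop_def)
    have "(\<integral>\<^sup>+\<omega>. c * (ennreal (Z \<omega>) * u (Y (s + h) \<omega>)) \<partial>N') = (\<integral>\<^sup>+\<omega>. c * (ennreal (Z \<omega>) * Kop h u (Y s \<omega>)) \<partial>N')"
      using sh mult by (simp add: nn_integral_cmult)
    then show ?case by (simp add: K mult_ac)
  next
    case (add u v)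
    note [measurable] = add(1,3)
    have K: "Kop h (\<lambda>x. v x + u x) y = Kop h v y + Kop h u y" for y
    proof (cases "0 < y")
      case True
      then show ?thesis using h by (simp add: Kop_eq_up_kernel nn_integral_add cong: measurable_cong_sets)
    qed (simp add: Kop_def)
    show ?case using sh add by (simp add: K distrib_left nn_integral_add)
  next
    case (seq U)
    note [measurable] = seq(1)
    have K: "Kop h (Sup (range U)) y = (SUP i. Kop h (U i) y)" for y
    proof (cases "0 < y")
      case True
      have "(\<integral>\<^sup>+z. (SUP i. U i z) \<partial>up_kernel M V W h y) = (SUP i. \<integral>\<^sup>+z. U i z \<partial>up_kernel M V W h y)"
        using seq by (intro nn_integral_monotone_convergence_SUP) (auto cong: measurable_cong_sets)
      moreover have "Sup (range U) = (\<lambda>z. SUP i. U i z)" by (simp add: fun_eq_iff image_comp)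
      moreover have [measurable]: "(\<lambda>z. SUP i. U i z) \<in> borel_measurable borel" by measurable
      ultimately show ?thesis using h True by (simp add: Kop_eq_up_kernel)
    qed (simp add: Kop_def)
    have inc: "incseq (\<lambda>i \<omega>. ennreal (Z \<omega>) * U i (Y (s + h) \<omega>))"
      using \<open>incseq U\<close> by (auto simp: incseq_def le_fun_def intro!: mult_left_mono)
    have inc2: "incseq (\<lambda>i \<omega>. ennreal (Z \<omega>) * Kop h (U i) (Y s \<omega>))"
      using \<open>incseq U\<close> h by (auto simp: incseq_def le_fun_def intro!: mult_left_mono Kop_mono)
    have "(\<integral>\<^sup>+\<omega>. ennreal (Z \<omega>) * Sup (range U) (Y (s + h) \<omega>) \<partial>N') = (\<integral>\<^sup>+\<omega>. (SUP i. ennreal (Z \<omega>) * U i (Y (s + h) \<omega>)) \<partial>N')"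
      by (simp add: SUP_mult_left_ennreal image_comp)
    also have "\<dots> = (SUP i. \<integral>\<^sup>+\<omega>. ennreal (Z \<omega>) * U i (Y (s + h) \<omega>) \<partial>N')"
      using sh inc by (intro nn_integral_monotone_convergence_SUP) auto
    also have "\<dots> = (SUP i. \<integral>\<^sup>+\<omega>. ennreal (Z \<omega>) * Kop h (U i) (Y s \<omega>) \<partial>N')"
      by (simp add: seq)
    also have "\<dots> = (\<integral>\<^sup>+\<omega>. (SUP i. ennreal (Z \<omega>) * Kop h (U i) (Y s \<omega>)) \<partial>N')"
      using inc2 by (intro nn_integral_monotone_convergence_SUP[symmetric]) auto
    also have "\<dots> = (\<integral>\<^sup>+\<omega>. ennreal (Z \<omega>) * Kop h (Sup (range U)) (Y s \<omega>) \<partial>N')"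
      by (simp add: K SUP_mult_left_ennreal)
    finally show ?case .
  }
qed

lemma nn_integral_chain:
  assumes h: "0 \<le> h" and psi: "\<psi> \<in> borel_measurable borel" "\<And>z. 0 \<le> \<psi> z \<and> \<psi> z \<le> 1"
    and s: "0 \<le> s"
    and Z: "Z \<in> borel_measurable (natural_sigma N' Y s)" "\<And>\<omega>. \<omega> \<in> space N' \<Longrightarrow> 0 \<le> Z \<omega> \<and> Z \<omega> \<le> (1::real)"
      "\<And>\<omega>. \<omega> \<in> space N' \<Longrightarrow> Y s \<omega> \<le> 0 \<Longrightarrow> Z \<omega> = 0"
  shows "(\<integral>\<^sup>+\<omega>. ennreal (Z \<omega>) * (\<Prod>k=1..m. ennreal (\<psi> (Y (s + real k * h) \<omega>))) \<partial>N')
    = (\<integral>\<^sup>+\<omega>. ennreal (Z \<omega>) * chainG \<psi> h m (Y s \<omega>) \<partial>N')"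
  using s Z
proof (induction m arbitrary: s Z)
  case (Suc m)
  note s = Suc.prems(1)
  have sh: "0 \<le> s + h" using s h by simp
  have [measurable]: "Z \<in> borel_measurable N'" by (rule measurable_from_subalg[OF subalgebra_natural_sigma Suc.prems(2)])
  note [measurable] = Y_measurable[OF s] Y_measurable[OF sh] psi(1)
  \<comment> \<open>The new weight carries the factor \<open>Y (s + h) > 0\<close> that the
    induction hypothesis demands. It changes nothing almost surely: from a positive state the kernel
    does not charge \<open>(-\<infinity>, 0]\<close>.\<close>
  define Z' where "Z' \<omega> = Z \<omega> * (\<psi> (Y (s + h) \<omega>) * indicator {0<..} (Y (s + h) \<omega>))" for \<omega>
  have Z': "Z' \<in> borel_measurable (natural_sigma N' Y (s + h))"
  proof -
    have [measurable]: "Z \<in> borel_measurable (natural_sigma N' Y (s + h))"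
      using natural_sigma_mono[OF _ Suc.prems(2), of "s + h"] h by simp
    have [measurable]: "Y (s + h) \<in> borel_measurable (natural_sigma N' Y (s + h))"
      by (rule measurable_natural_sigma) (use sh in auto)
    show ?thesis unfolding Z'_def by measurable
  qed
  have Z'01: "0 \<le> Z' \<omega> \<and> Z' \<omega> \<le> 1" if "\<omega> \<in> space N'" for \<omega>
    using Suc.prems(3)[OF that] psi(2)[of "Y (s + h) \<omega>"] by (auto simp: Z'_def indicator_def intro: mult_le_one)
  have "(\<integral>\<^sup>+\<omega>. ennreal (Z \<omega>) * indicator {..0} (Y (s + h) \<omega>) \<partial>N') = (\<integral>\<^sup>+\<omega>. ennreal (Z \<omega>) * Kop h (indicator {..0}) (Y s \<omega>) \<partial>N')"
    by (rule nn_integral_step[OF s h _ Suc.prems(2-4)]) auto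
  moreover have "Kop h (indicator {..0}) y = 0" for y
    using Kop_cong[OF h, of "indicator {..0}" "\<lambda>_. 0" y] by (auto simp: Kop_def Q_def)
  ultimately have "(\<integral>\<^sup>+\<omega>. ennreal (Z \<omega>) * indicator {..0} (Y (s + h) \<omega>) \<partial>N') = 0" by simp
  then have "AE \<omega> in N'. ennreal (Z \<omega>) * indicator {..0} (Y (s + h) \<omega>) = 0"
    using sh by (subst (asm) nn_integral_0_iff_AE) auto
  then have AE0: "AE \<omega> in N'. ennreal (Z \<omega>) * ennreal (\<psi> (Y (s + h) \<omega>)) = ennreal (Z' \<omega>)"
    using AE_space
  proof eventually_elim
    case (elim \<omega>)
    then show ?case using Suc.prems(3)[OF elim(2)] psi(2)[of "Y (s + h) \<omega>"]
      by (cases "0 < Y (s + h) \<omega>") (auto simp: Z'_def ennreal_mult)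
  qed
  have "(\<integral>\<^sup>+\<omega>. ennreal (Z \<omega>) * (\<Prod>k=1..Suc m. ennreal (\<psi> (Y (s + real k * h) \<omega>))) \<partial>N')
      = (\<integral>\<^sup>+\<omega>. ennreal (Z' \<omega>) * (\<Prod>k=1..m. ennreal (\<psi> (Y ((s + h) + real k * h) \<omega>))) \<partial>N')"
  proof (rule nn_integral_cong_AE)
    show "AE \<omega> in N'. ennreal (Z \<omega>) * (\<Prod>k=1..Suc m. ennreal (\<psi> (Y (s + real k * h) \<omega>)))
      = ennreal (Z' \<omega>) * (\<Prod>k=1..m. ennreal (\<psi> (Y ((s + h) + real k * h) \<omega>)))"
      using AE0
    proof eventually_elim
      case (elim \<omega>)
      have "(\<Prod>k=1..Suc m. ennreal (\<psi> (Y (s + real k * h) \<omega>)))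
         = ennreal (\<psi> (Y (s + real 1 * h) \<omega>)) * (\<Prod>k=Suc 1..Suc m. ennreal (\<psi> (Y (s + real k * h) \<omega>)))"
        by (rule prod.atLeast_Suc_atMost) simp
      also have "(\<Prod>k=Suc 1..Suc m. ennreal (\<psi> (Y (s + real k * h) \<omega>))) = (\<Prod>k=1..m. ennreal (\<psi> (Y (s + real (Suc k) * h) \<omega>)))"
        by (rule prod.shift_bounds_cl_Suc_ivl)
      finally show ?case using elim by (simp add: mult.assoc[symmetric] algebra_simps)
    qed
  qed
  also have "\<dots> = (\<integral>\<^sup>+\<omega>. ennreal (Z' \<omega>) * chainG \<psi> h m (Y (s + h) \<omega>) \<partial>N')"
    by (rule Suc.IH[OF sh Z' Z'01]) (auto simp: Z'_def)
  also have "\<dots> = (\<integral>\<^sup>+\<omega>. ennreal (Z \<omega>) * (ennreal (\<psi> (Y (s + h) \<omega>)) * chainG \<psi> h m (Y (s + h) \<omega>)) \<partial>N')"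
    using AE0 by (intro nn_integral_cong_AE) (auto simp: mult.assoc[symmetric])
  also have "\<dots> = (\<integral>\<^sup>+\<omega>. ennreal (Z \<omega>) * chainG \<psi> h (Suc m) (Y s \<omega>) \<partial>N')"
    unfolding chainG.simps using h by (intro nn_integral_step[OF s h _ Suc.prems(2-4)]) measurable
  finally show ?case .
qed simp

end

context conditioned_levy begin

subsection \<open>Stochastic domination\<close>

lemma scale_Laplace: "kappa M V \<Psi> < l \<Longrightarrow> (LINT x:{0..}|lborel. exp (- l * x) * W x) = 1 / \<Psi> l"
  using scale by (auto simp: scale_function_def)

text \<open>As \<open>W\<close> increases, the Laplace integrand on \<open>(x, x + 1]\<close> is at
  least \<open>W x * exp (- l * (x + 1))\<close>, and the whole integral is
  \<open>1 / \<Psi> l\<close>. Being nonzero, that integral also yields integrability.\<close>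

lemma W_le_exp:
  assumes k: "kappa M V \<Psi> < l" and P: "0 < \<Psi> l" and l: "0 < l" and x: "0 \<le> x"
  shows "W x \<le> exp l / \<Psi> l * exp (l * x)"
proof -
  let ?f = "\<lambda>y. indicator {0..} y * (exp (- l * y) * W y)"
  have eq: "(LINT y|lborel. ?f y) = 1 / \<Psi> l" using scale_Laplace[OF k] by (simp add: set_lebesgue_integral_def)
  then have int: "integrable lborel ?f" using P not_integrable_integral_eq by force
  have "W x * exp (- l * (x + 1)) = (LINT y|lborel. (W x * exp (- l * (x + 1))) * indicator {x<..x+1} y)"
    using x by simp
  also have "\<dots> \<le> (LINT y|lborel. ?f y)"
  proof (rule integral_mono[OF integrable_indicator_Ioc int])
    fix y
    show "(W x * exp (- l * (x + 1))) * indicator {x<..x+1} y \<le> ?f y"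
    proof (cases "x < y \<and> y \<le> x + 1")
      case True
      have "exp (- l * (x + 1)) \<le> exp (- l * y)" using True l by simp
      then have "W x * exp (- l * (x + 1)) \<le> W y * exp (- l * y)"
        using True x by (intro mult_mono W_mono W_nonneg) auto
      then show ?thesis using True x by (simp add: mult.commute)
    next
      case False
      then show ?thesis using W_nonneg[of y] by (auto simp: indicator_def)
    qed
  qed
  finally have "W x * exp (- l * (x + 1)) \<le> 1 / \<Psi> l" using eq by simp
  then have "W x * exp (- l * (x + 1)) * exp (l * (x + 1)) \<le> 1 / \<Psi> l * exp (l * (x + 1))"
    by (rule mult_right_mono) simp
  moreover have "exp (- l * (x + 1)) * exp (l * (x + 1)) = 1" by (simp add: mult_exp_exp)
  moreover have "exp (l * (x + 1)) = exp l * exp (l * x)" by (simp add: mult_exp_exp algebra_simps)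
  ultimately show ?thesis by (simp only: mult.assoc) (simp add: mult_ac)
qed

lemma W_exp_growth: obtains c C where "c > 0" "C > 0" "\<And>x. 0 \<le> x \<Longrightarrow> W x \<le> C * exp (c * x)"
proof -
  obtain a l0 where a: "a > 0" "l0 > 0" "\<And>l. l \<ge> l0 \<Longrightarrow> a * l \<le> \<Psi> l" using Psi_ge_linear by blast
  define l where "l = max l0 (kappa M V \<Psi> + 1)"
  have l: "kappa M V \<Psi> < l" "0 < l" using a by (auto simp: l_def)
  have "0 < a * l" using a l by simp
  also have "\<dots> \<le> \<Psi> l" using a by (simp add: l_def)
  finally have P: "0 < \<Psi> l" .
  show thesis
    by (rule that[of l "exp l / \<Psi> l"]) (use l P W_le_exp in auto)
qed

lemma nn_integral_Wp_finite:
  assumes "0 \<le> t" shows "(\<integral>\<^sup>+\<omega>. Wp (x + V t \<omega>) \<partial>M) < \<infinity>"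
proof -
  obtain c C where c: "c > 0" "C > 0" "\<And>x. 0 \<le> x \<Longrightarrow> W x \<le> C * exp (c * x)" using W_exp_growth by blast
  have "Wp (x + V t \<omega>) \<le> ennreal (C * exp (c * x) * exp (c * V t \<omega>))" for \<omega>
    using c(3)[of "x + V t \<omega>"] by (auto simp: Wp_def indicator_def algebra_simps exp_add intro!: ennreal_leI)
  then have "(\<integral>\<^sup>+\<omega>. Wp (x + V t \<omega>) \<partial>M) \<le> (\<integral>\<^sup>+\<omega>. ennreal (C * exp (c * x) * exp (c * V t \<omega>)) \<partial>M)"
    by (rule nn_integral_mono)
  also have "\<dots> = ennreal (\<integral>\<omega>. C * exp (c * x) * exp (c * V t \<omega>) \<partial>M)"
    using c assms by (intro nn_integral_eq_integral integrable_mult_right exp_V_integrable) auto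
  finally show ?thesis by (auto simp: less_top[symmetric] top_unique)
qed

lemma Harris_grid:
  assumes t: "t > 0"
  shows "(\<integral>\<^sup>+\<omega>. Wp (x + V t \<omega>) * indicator {\<omega>. \<forall>k\<le>2^n. d \<le> x + V (real k * (t / 2^n)) \<omega>} \<omega> \<partial>M) * emeasure M {\<omega>\<in>space M. b \<le> x + V t \<omega>}
    \<le> (\<integral>\<^sup>+\<omega>. Wp (x + V t \<omega>) * indicator {\<omega>. \<forall>k\<le>2^n. d \<le> x + V (real k * (t / 2^n)) \<omega>} \<omega> * indicator {b..} (x + V t \<omega>) \<partial>M)"
proof -
  define h where "h = t / 2^n"
  have h: "0 \<le> h" using t by (simp add: h_def)
  let ?I = "{..<(2::nat)^n}"
  let ?P = "\<lambda>i. distr M borel (incr h i)"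
  let ?T = "\<lambda>\<omega>. \<lambda>i\<in>?I. incr h i \<omega>"
  \<comment> \<open>As functions of the increments, \<open>f\<close> and \<open>g\<close> involve
    only partial sums. They agree with the path up to a null set, since \<open>V 0 = 0\<close> holds
    almost surely.\<close>
  define f where "f z = Wp (x + (\<Sum>i\<in>?I. z i)) * indicator {z. \<forall>k\<in>{..2^n}. d \<le> x + (\<Sum>i<k. z i)} z" for z
  define g where "g z = (indicator {b..} (x + (\<Sum>i\<in>?I. z i)) :: ennreal)" for z
  note [measurable] = incr_measurable[OF h]
  have [measurable]: "V t \<in> borel_measurable M" using t by simp
  have D: "distr M (PiM ?I (\<lambda>_. borel)) ?T = PiM ?I ?P"
  proof -
    have "?I \<noteq> {}" by (auto simp: lessThan_empty_iff)
    then show ?thesis using incr_indep[OF h] indep_vars_iff_distr_eq_PiM'[of ?I "incr h" "\<lambda>_. borel"] by simp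
  qed
  have Tm[measurable]: "?T \<in> measurable M (PiM ?I (\<lambda>_. borel))" by measurable
  have fm[measurable]: "f \<in> borel_measurable (PiM ?I (\<lambda>_. borel))"
  proof -
    have [measurable]: "(\<lambda>z. \<Sum>i<k. z i :: real) \<in> borel_measurable (PiM ?I (\<lambda>_. borel))" if "k \<in> {..2^n}" for k
      using that by (intro borel_measurable_sum measurable_component_singleton) auto
    have "Measurable.pred (PiM ?I (\<lambda>_. borel)) (\<lambda>z. \<forall>k\<in>{..2^n}. d \<le> x + (\<Sum>i<k. z i))"
      by (intro pred_intros_finite) auto
    then show ?thesis unfolding f_def by measurable
  qed
  have gm[measurable]: "g \<in> borel_measurable (PiM ?I (\<lambda>_. borel))" unfolding g_def by measurable
  have AE: "AE \<omega> in M. (\<forall>k\<le>2^n. (\<Sum>i<k. ?T \<omega> i) = V (real k * h) \<omega>)"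
    using V_eq_sum_incr[of h]
  proof eventually_elim
    case (elim \<omega>)
    have "(\<Sum>i<k. ?T \<omega> i) = (\<Sum>i<k. incr h i \<omega>)" if "k \<le> 2^n" for k
      using that by (intro sum.cong) auto
    then show ?case using elim by simp
  qed
  have th: "real (2^n) * h = t" by (simp add: h_def)
  have AEf: "AE \<omega> in M. f (?T \<omega>) = Wp (x + V t \<omega>) * indicator {\<omega>. \<forall>k\<le>2^n. d \<le> x + V (real k * h) \<omega>} \<omega>"
    using AE by eventually_elim (auto simp: f_def indicator_def th[symmetric])
  have AEg: "AE \<omega> in M. g (?T \<omega>) = indicator {b..} (x + V t \<omega>)"
    using AE by eventually_elim (auto simp: g_def indicator_def th[symmetric])
  have "(\<integral>\<^sup>+z. f z \<partial>PiM ?I ?P) * (\<integral>\<^sup>+z. g z \<partial>PiM ?I ?P) \<le> (\<integral>\<^sup>+z. f z * g z \<partial>PiM ?I ?P)"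
  proof (rule nn_integral_PiM_Harris)
    show "prob_space (?P i)" for i using incr_measurable[OF h] by (intro prob_space_distr)
    fix y z :: "nat \<Rightarrow> real" assume le: "\<And>i. i \<in> ?I \<Longrightarrow> y i \<le> z i"
    have s: "(\<Sum>i<k. y i) \<le> (\<Sum>i<k. z i)" if "k \<le> 2^n" for k using that le by (intro sum_mono) auto
    show "g y \<le> g z" using s[of "2^n"] by (auto simp: g_def indicator_def)
    have "Wp (x + (\<Sum>i\<in>?I. y i)) \<le> Wp (x + (\<Sum>i\<in>?I. z i))" using s[of "2^n"] by (intro monoD[OF Wp_mono]) auto
    moreover have "(indicator {z. \<forall>k\<in>{..2^n}. d \<le> x + (\<Sum>i<k. z i)} y :: ennreal) \<le> indicator {z. \<forall>k\<in>{..2^n}. d \<le> x + (\<Sum>i<k. z i)} z"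
      using s by (force simp: indicator_def)
    ultimately show "f y \<le> f z" unfolding f_def by (intro mult_mono) auto
  qed (use fm gm in auto)
  then have "(\<integral>\<^sup>+\<omega>. f (?T \<omega>) \<partial>M) * (\<integral>\<^sup>+\<omega>. g (?T \<omega>) \<partial>M) \<le> (\<integral>\<^sup>+\<omega>. f (?T \<omega>) * g (?T \<omega>) \<partial>M)"
    unfolding D[symmetric] by (simp add: nn_integral_distr[OF Tm])
  also have "(\<integral>\<^sup>+\<omega>. f (?T \<omega>) * g (?T \<omega>) \<partial>M) = (\<integral>\<^sup>+\<omega>. Wp (x + V t \<omega>) * indicator {\<omega>. \<forall>k\<le>2^n. d \<le> x + V (real k * h) \<omega>} \<omega> * indicator {b..} (x + V t \<omega>) \<partial>M)"
    using AEf AEg by (intro nn_integral_cong_AE) auto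
  also have "(\<integral>\<^sup>+\<omega>. f (?T \<omega>) \<partial>M) = (\<integral>\<^sup>+\<omega>. Wp (x + V t \<omega>) * indicator {\<omega>. \<forall>k\<le>2^n. d \<le> x + V (real k * h) \<omega>} \<omega> \<partial>M)"
    using AEf by (intro nn_integral_cong_AE)
  also have "(\<integral>\<^sup>+\<omega>. g (?T \<omega>) \<partial>M) = (\<integral>\<^sup>+\<omega>. indicator {\<omega>\<in>space M. b \<le> x + V t \<omega>} \<omega> \<partial>M)"
    using AEg AE_space by (intro nn_integral_cong_AE) (auto simp: indicator_def)
  also have "\<dots> = emeasure M {\<omega>\<in>space M. b \<le> x + V t \<omega>}" by (intro nn_integral_indicator) measurable
  finally show ?thesis by (simp add: h_def)
qed

text \<open>Survival is approximated by staying above a barrier \<open>d > 0\<close> in the weak sense: this closed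
  condition is the decreasing limit of its versions on dyadic grids, and \<open>d\<close> tends to \<open>0\<close> last.\<close>

lemma Kop_tail_ge:
  assumes t: "t > 0" and x: "x > 0"
  shows "emeasure M {\<omega>\<in>space M. b \<le> x + V t \<omega>} \<le> Kop t (indicator {b..}) x"
proof -
  note [measurable] = V_measurable[OF less_imp_le[OF t]] infV_measurable[OF less_imp_le[OF t]]
  let ?p = "emeasure M {\<omega>\<in>space M. b \<le> x + V t \<omega>}"
  let ?A = "\<lambda>n d. {\<omega>. \<forall>k\<le>2^n. d \<le> x + V (real k * (t / 2^n)) \<omega>}"
  let ?R = "\<lambda>\<omega>. Wp (x + V t \<omega>) * indicator {b..} (x + V t \<omega>)"
  have Am: "?A n d \<inter> space M \<in> sets M" for n d
  proof -
    have [measurable]: "V (real k * (t / 2^n)) \<in> borel_measurable M" for k using t by (intro V_measurable) auto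
    have "?A n d \<inter> space M = {\<omega>\<in>space M. \<forall>k\<le>2^n. d \<le> x + V (real k * (t / 2^n)) \<omega>}" by auto
    also have "\<dots> \<in> sets M" by measurable
    finally show ?thesis .
  qed
  have infA: "d \<le> x + infV t \<omega> \<longleftrightarrow> (\<forall>n. \<omega> \<in> ?A n d)" if "\<omega> \<in> space M" for \<omega> d
    using le_INF_cadlag_iff_dyadic[OF V_cadlag[OF that] t, of "d - x"] unfolding infV_def[symmetric]
    by (simp add: algebra_simps)
  have nested: "\<omega> \<in> ?A n d" if "\<omega> \<in> ?A (Suc n) d" for \<omega> n d
  proof safe
    fix k :: nat assume "k \<le> 2 ^ n"
    then have "2 * k \<le> 2 ^ Suc n" by simp
    then have "d \<le> x + V (real (2 * k) * (t / 2 ^ Suc n)) \<omega>" using that by blast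
    then show "d \<le> x + V (real k * (t / 2 ^ n)) \<omega>" by simp
  qed
  have main: "(\<integral>\<^sup>+\<omega>. Wp (x + V t \<omega>) * indicator {d..} (x + infV t \<omega>) \<partial>M) * ?p \<le> (\<integral>\<^sup>+\<omega>. ?R \<omega> * indicator {d..} (x + infV t \<omega>) \<partial>M)" for d
  proof -
    have indA: "(indicator {d..} (x + infV t \<omega>) :: ennreal) \<le> indicator (?A n d) \<omega>" if "\<omega> \<in> space M" for n \<omega>
      using infA[OF that, of d] by (auto simp: indicator_def)
    have "(\<integral>\<^sup>+\<omega>. Wp (x + V t \<omega>) * indicator {d..} (x + infV t \<omega>) \<partial>M) * ?p \<le> (\<integral>\<^sup>+\<omega>. ?R \<omega> * indicator (?A n d \<inter> space M) \<omega> \<partial>M)" for n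
    proof -
      have "(\<integral>\<^sup>+\<omega>. Wp (x + V t \<omega>) * indicator {d..} (x + infV t \<omega>) \<partial>M) * ?p
        \<le> (\<integral>\<^sup>+\<omega>. Wp (x + V t \<omega>) * indicator (?A n d) \<omega> \<partial>M) * ?p"
        using indA by (intro mult_right_mono nn_integral_mono mult_left_mono) auto
      also have "\<dots> \<le> (\<integral>\<^sup>+\<omega>. Wp (x + V t \<omega>) * indicator (?A n d) \<omega> * indicator {b..} (x + V t \<omega>) \<partial>M)"
        by (rule Harris_grid[OF t])
      also have "\<dots> = (\<integral>\<^sup>+\<omega>. ?R \<omega> * indicator (?A n d \<inter> space M) \<omega> \<partial>M)"
        by (intro nn_integral_cong) (auto simp: indicator_def)
      finally show ?thesis .
    qed
    moreover have "(\<lambda>n. \<integral>\<^sup>+\<omega>. ?R \<omega> * indicator (?A n d \<inter> space M) \<omega> \<partial>M) \<longlonglongrightarrow> (\<integral>\<^sup>+\<omega>. ?R \<omega> * indicator {d..} (x + infV t \<omega>) \<partial>M)"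
    proof (rule nn_integral_dominated_convergence[where w="\<lambda>\<omega>. Wp (x + V t \<omega>)"])
      show "(\<lambda>\<omega>. ?R \<omega> * indicator (?A n d \<inter> space M) \<omega>) \<in> borel_measurable M" for n
        using Am[of n d] by measurable
      show "(\<integral>\<^sup>+\<omega>. Wp (x + V t \<omega>) \<partial>M) < \<infinity>" using nn_integral_Wp_finite t by simp
      show "AE \<omega> in M. (\<lambda>n. ?R \<omega> * indicator (?A n d \<inter> space M) \<omega>) \<longlonglongrightarrow> ?R \<omega> * indicator {d..} (x + infV t \<omega>)"
      proof (rule AE_I2)
        fix \<omega> assume w: "\<omega> \<in> space M"
        have "eventually (\<lambda>n. (indicator (?A n d \<inter> space M) \<omega> :: ennreal) = indicator {d..} (x + infV t \<omega>)) sequentially"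
        proof (cases "\<forall>n. \<omega> \<in> ?A n d")
          case True
          then show ?thesis using infA[OF w, of d] w by (simp add: indicator_def)
        next
          case False
          then obtain n0 where n0: "\<omega> \<notin> ?A n0 d" by blast
          have "\<omega> \<notin> ?A n d" if "n \<ge> n0" for n using that
          proof (induction n rule: dec_induct)
            case (step n) then show ?case using nested by blast
          qed (rule n0)
          then have "eventually (\<lambda>n. \<omega> \<notin> ?A n d) sequentially" by (auto simp: eventually_sequentially)
          moreover have "\<not> d \<le> x + infV t \<omega>" using infA[OF w] False by simp
          ultimately show ?thesis by (auto elim!: eventually_mono simp: indicator_def)
        qed
        then show "(\<lambda>n. ?R \<omega> * indicator (?A n d \<inter> space M) \<omega>) \<longlonglongrightarrow> ?R \<omega> * indicator {d..} (x + infV t \<omega>)"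
          by (intro tendsto_eventually) (auto elim: eventually_mono)
      qed
    qed (auto simp: indicator_def)
    ultimately show ?thesis by (intro LIMSEQ_le_const) auto
  qed
  let ?d = "\<lambda>j. 1 / real (Suc j)"
  have inc: "incseq (\<lambda>j \<omega>. Wp (x + V t \<omega>) * indicator {?d j..} (x + infV t \<omega>))"
  proof (intro incseq_SucI le_funI mult_left_mono)
    fix j \<omega>
    have "?d (Suc j) \<le> ?d j" by (simp add: field_simps)
    then show "(indicator {?d j..} (x + infV t \<omega>) :: ennreal) \<le> indicator {?d (Suc j)..} (x + infV t \<omega>)"
      by (auto simp: indicator_def simp del: of_nat_Suc)
  qed simp
  have sup: "(SUP j. Wp (x + V t \<omega>) * indicator {?d j..} (x + infV t \<omega>)) = Wp (x + V t \<omega>) * indicator {0<..} (x + infV t \<omega>)" for \<omega>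
  proof -
    have "(SUP j. (indicator {?d j..} (x + infV t \<omega>) :: ennreal)) = indicator {0<..} (x + infV t \<omega>)"
    proof (cases "0 < x + infV t \<omega>")
      case True
      then obtain j where j: "?d j < x + infV t \<omega>" using nat_approx_posE by blast
      show ?thesis
      proof (rule antisym)
        show "(indicator {0<..} (x + infV t \<omega>) :: ennreal) \<le> (SUP j. indicator {?d j..} (x + infV t \<omega>))"
          using j True by (intro SUP_upper2[of j]) (auto simp: indicator_def)
      qed (use True in \<open>auto intro!: SUP_least simp: indicator_def\<close>)
    next
      case False
      have "0 < ?d j" for j by simp
      then have "\<not> ?d j \<le> x + infV t \<omega>" for j using False by (meson less_le_trans)
      then show ?thesis using False by (simp add: indicator_def del: of_nat_Suc)
    qed
    then show ?thesis by (simp add: SUP_mult_left_ennreal[symmetric] del: of_nat_Suc)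
  qed
  \<comment> \<open>The barriers \<open>1 / (j + 1)\<close> exhaust the survival event, whose total
    weight is \<open>W x\<close> by harmonicity; dividing by it at the end gives domination.\<close>
  have "ennreal (W x) * ?p = (\<integral>\<^sup>+\<omega>. (SUP j. Wp (x + V t \<omega>) * indicator {?d j..} (x + infV t \<omega>)) \<partial>M) * ?p"
    using Q_Wp[of t x] t x by (simp add: Q_def sup del: of_nat_Suc)
  also have "\<dots> = (SUP j. (\<integral>\<^sup>+\<omega>. Wp (x + V t \<omega>) * indicator {?d j..} (x + infV t \<omega>) \<partial>M)) * ?p"
    using inc by (subst nn_integral_monotone_convergence_SUP) auto
  also have "\<dots> = (SUP j. (\<integral>\<^sup>+\<omega>. Wp (x + V t \<omega>) * indicator {?d j..} (x + infV t \<omega>) \<partial>M) * ?p)"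
    by (simp add: SUP_mult_right_ennreal del: of_nat_Suc)
  also have "\<dots> \<le> Q t (\<lambda>z. Wp z * indicator {b..} z) x"
  proof (rule SUP_least)
    fix j
    have "0 < ?d j" by simp
    then have "\<And>r. ?d j \<le> r \<Longrightarrow> 0 < r" by (rule less_le_trans)
    then have "(\<integral>\<^sup>+\<omega>. ?R \<omega> * indicator {?d j..} (x + infV t \<omega>) \<partial>M) \<le> Q t (\<lambda>z. Wp z * indicator {b..} z) x"
      unfolding Q_def by (intro nn_integral_mono mult_left_mono) (auto simp: indicator_def simp del: of_nat_Suc)
    then show "(\<integral>\<^sup>+\<omega>. Wp (x + V t \<omega>) * indicator {?d j..} (x + infV t \<omega>) \<partial>M) * ?p \<le> Q t (\<lambda>z. Wp z * indicator {b..} z) x"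
      using main[of "?d j"] by (rule order_trans[rotated])
  qed
  also have "\<dots> = ennreal (W x) * Kop t (indicator {b..}) x" using W_Kop[OF x] by simp
  finally show ?thesis using W_pos[OF x] by (simp add: ennreal_mult_le_mult_iff)
qed

text \<open>Reaching \<open>2\<close> at time \<open>s\<close> says nothing yet about survival.
  Domination of \<open>V\<close> by the conditioned process started from \<open>1\<close> adds it:
  if the joint event were null, that process could not charge \<open>[3, \<infinity>)\<close> at
  time \<open>s\<close>.\<close>

lemma escape_prob_pos:
  obtains s where "s > 0" "0 < emeasure M {\<omega>\<in>space M. 2 \<le> V s \<omega> \<and> 0 < 1 + infV s \<omega>}"
proof -
  obtain s where s: "s > 0" "0 < prob {\<omega>\<in>space M. 2 \<le> V s \<omega>}" using V_reaches_up by blast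
  note [measurable] = V_measurable[OF less_imp_le[OF s(1)]] infV_measurable[OF less_imp_le[OF s(1)]]
  have "0 < emeasure M {\<omega>\<in>space M. 2 \<le> V s \<omega>}" using s(2) by (simp add: emeasure_eq_measure)
  also have "{\<omega>\<in>space M. 2 \<le> V s \<omega>} = {\<omega>\<in>space M. 3 \<le> 1 + V s \<omega>}" by auto
  also have "emeasure M \<dots> \<le> Kop s (indicator {3..}) 1" by (rule Kop_tail_ge[OF s(1) zero_less_one])
  finally have "0 < ennreal (W 1) * Kop s (indicator {3..}) 1"
    using W_pos[of 1] by (simp add: ennreal_zero_less_mult_iff)
  then have Qp: "0 < Q s (\<lambda>z. Wp z * indicator {3..} z) 1" by (simp only: W_Kop[OF zero_less_one])
  have "emeasure M {\<omega>\<in>space M. 2 \<le> V s \<omega> \<and> 0 < 1 + infV s \<omega>} \<noteq> 0"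
  proof
    assume "emeasure M {\<omega>\<in>space M. 2 \<le> V s \<omega> \<and> 0 < 1 + infV s \<omega>} = 0"
    then have "AE \<omega> in M. \<not> (2 \<le> V s \<omega> \<and> 0 < 1 + infV s \<omega>)"
      by (subst AE_iff_measurable[OF _ refl]) auto
    then have "AE \<omega> in M. Wp (1 + V s \<omega>) * indicator {3..} (1 + V s \<omega>) * indicator {0<..} (1 + infV s \<omega>) = 0"
      by eventually_elim (auto simp: indicator_def)
    then have "Q s (\<lambda>z. Wp z * indicator {3..} z) 1 = 0"
      unfolding Q_def by (subst nn_integral_0_iff_AE) auto
    then show False using Qp by simp
  qed
  then show thesis using s by (intro that[of s]) (auto simp: zero_less_iff_neq_zero)
qed

text \<open>\<open>W y * chainG\<close> is an expectation under the killed process in which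
  \<open>W\<close> appears only at the last grid point. Raising the path by \<open>b\<close>
  enlarges the survival event and increases that terminal weight.\<close>

lemma chainG_domination:
  assumes h: "0 \<le> h" and psi: "\<psi> \<in> borel_measurable borel" and b: "0 \<le> b" and y: "b < y"
  shows "ennreal (W (y - b)) * chainG (\<lambda>z. \<psi> (b + z)) h m (y - b) \<le> ennreal (W y) * chainG \<psi> h m y"
  using y
proof (induction m arbitrary: y)
  case 0
  then show ?case using b by (auto intro!: ennreal_leI W_mono)
next
  case (Suc m)
  let ?G = "chainG \<psi> h m" and ?G' = "chainG (\<lambda>z. \<psi> (b + z)) h m"
  have y: "0 < y" "0 < y - b" using Suc.prems b by auto
  have "ennreal (W (y - b)) * chainG (\<lambda>z. \<psi> (b + z)) h (Suc m) (y - b)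
      = Q h (\<lambda>z. Wp z * (ennreal (\<psi> (b + z)) * ?G' z)) (y - b)"
    unfolding chainG.simps by (rule W_Kop[OF y(2)])
  also have "\<dots> \<le> Q h (\<lambda>z. Wp z * (ennreal (\<psi> z) * ?G z)) y"
    unfolding Q_def
  proof (intro nn_integral_mono)
    fix \<omega> assume w: "\<omega> \<in> space M"
    show "Wp (y - b + V h \<omega>) * (ennreal (\<psi> (b + (y - b + V h \<omega>))) * ?G' (y - b + V h \<omega>)) * indicator {0<..} (y - b + infV h \<omega>)
      \<le> Wp (y + V h \<omega>) * (ennreal (\<psi> (y + V h \<omega>)) * ?G (y + V h \<omega>)) * indicator {0<..} (y + infV h \<omega>)"
    proof (cases "0 < y - b + infV h \<omega>")
      case True
      then have p: "0 < y - b + V h \<omega>" using infV_le[OF w h order_refl] by linarith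
      then have "ennreal (W (y + V h \<omega> - b)) * ?G' (y + V h \<omega> - b) \<le> ennreal (W (y + V h \<omega>)) * ?G (y + V h \<omega>)"
        using b by (intro Suc.IH) auto
      moreover have "0 < y + infV h \<omega>" using True b by linarith
      moreover have "0 < y + V h \<omega>" using p b by linarith
      moreover have "y - b + V h \<omega> = y + V h \<omega> - b" by simp
      ultimately show ?thesis using True p
        by (simp add: Wp_pos mult.left_commute[of _ "ennreal (\<psi> _)"] mult_left_mono \<open>y - b + V h \<omega> = y + V h \<omega> - b\<close>)
    qed simp
  qed
  also have "\<dots> = ennreal (W y) * chainG \<psi> h (Suc m) y"
    unfolding chainG.simps by (rule W_Kop[OF y(1), symmetric])
  finally show ?case .
qed

section \<open>The upper bound\<close>

text \<open>A bound for the \<open>W\<close>-weight of a grid step that climbs more than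
  \<open>1/4\<close> from a height at most \<open>L\<close>. The threshold is the width of the strip
  \<open>[1/2, 3/4]\<close> and also the excess in \<open>W (L + 1/4)\<close>.\<close>

definition overshoot :: "real \<Rightarrow> real \<Rightarrow> ennreal" where
  "overshoot L h = (\<integral>\<^sup>+\<omega>. Wp (L + V h \<omega>) * indicator {1/4<..} (V h \<omega>) \<partial>M)"

lemma nn_integral_exp_V: "0 \<le> h \<Longrightarrow> 0 \<le> l \<Longrightarrow> (\<integral>\<^sup>+\<omega>. ennreal (exp (l * V h \<omega>)) \<partial>M) = ennreal (exp (h * \<Psi> l))"
  using exp_V_integral[of h l] by (subst nn_integral_eq_integral[OF exp_V_integrable]) auto

text \<open>\<open>W\<close> grows at most exponentially, which reduces the claim to exponential
  moments of increments above \<open>1/4\<close>.\<close>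

lemma overshoot_tendsto_0:
  assumes t: "t > 0"
  shows "(\<lambda>n. of_nat (Suc n) * overshoot L (t / real (Suc n))) \<longlonglongrightarrow> 0"
proof -
  obtain c C where c: "c > 0" "C > 0" "\<And>x. 0 \<le> x \<Longrightarrow> W x \<le> C * exp (c * x)" using W_exp_growth by blast
  let ?h = "\<lambda>n. t / real (Suc n)"
  let ?J = "\<lambda>n. \<integral>\<omega>. exp (c * V (?h n) \<omega>) * indicator {1/4<..} (V (?h n) \<omega>) \<partial>M"
  have h: "0 \<le> ?h n" for n using t by simp
  have "of_nat (Suc n) * overshoot L (?h n) \<le> ennreal (C * exp (c * L) * (real (Suc n) * ?J n))" for n
  proof -
    have J0: "0 \<le> ?J n" by (intro integral_nonneg_AE) auto
    have "overshoot L (?h n) \<le> (\<integral>\<^sup>+\<omega>. ennreal (C * exp (c * L) * (exp (c * V (?h n) \<omega>) * indicator {1/4<..} (V (?h n) \<omega>))) \<partial>M)"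
      unfolding overshoot_def
    proof (intro nn_integral_mono)
      fix \<omega>
      have "Wp (L + V (?h n) \<omega>) \<le> ennreal (C * exp (c * L) * exp (c * V (?h n) \<omega>))"
        using c(3)[of "L + V (?h n) \<omega>"] by (auto simp: Wp_def indicator_def algebra_simps exp_add intro!: ennreal_leI)
      then show "Wp (L + V (?h n) \<omega>) * indicator {1/4<..} (V (?h n) \<omega>)
        \<le> ennreal (C * exp (c * L) * (exp (c * V (?h n) \<omega>) * indicator {1/4<..} (V (?h n) \<omega>)))"
        by (auto simp: indicator_def)
    qed
    also have "\<dots> = ennreal (\<integral>\<omega>. C * exp (c * L) * (exp (c * V (?h n) \<omega>) * indicator {1/4<..} (V (?h n) \<omega>)) \<partial>M)"
      using c h[of n] by (intro nn_integral_eq_integral integrable_mult_right exp_V_indicator_integrable) auto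
    also have "\<dots> = ennreal (C * exp (c * L) * ?J n)" by simp
    finally have "of_nat (Suc n) * overshoot L (?h n) \<le> of_nat (Suc n) * ennreal (C * exp (c * L) * ?J n)"
      by (rule mult_left_mono) simp
    also have "\<dots> = ennreal (real (Suc n) * (C * exp (c * L) * ?J n))"
      using c J0 by (simp add: ennreal_mult ennreal_of_nat_eq_real_of_nat del: of_nat_Suc)
    finally show ?thesis by (simp add: mult_ac del: of_nat_Suc)
  qed
  note le = this
  have "(\<lambda>n. ennreal (C * exp (c * L) * (real (Suc n) * ?J n))) \<longlonglongrightarrow> ennreal (C * exp (c * L) * 0)"
    using t c by (intro tendsto_ennrealI tendsto_mult_left exp_jump_tendsto_0) simp_all
  then have lim: "(\<lambda>n. ennreal (C * exp (c * L) * (real (Suc n) * ?J n))) \<longlonglongrightarrow> 0"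
    by (simp only: mult_zero_right ennreal_0)
  show ?thesis
    by (rule tendsto_sandwich[OF always_eventually always_eventually tendsto_const lim]) (intro allI zero_le, intro allI le)
qed

text \<open>The estimates bound \<open>1 - chainG\<close>, the probability of reaching \<open>L\<close>, from above; they are stated
  additively to avoid subtraction in \<open>ennreal\<close>.\<close>

lemma chainG_ge_from_middle:
  assumes h: "0 \<le> h" and l: "0 \<le> l" "0 \<le> \<Psi> l" and L: "0 < L" and y: "0 < y" "y < L"
  shows "ennreal (W y) \<le> ennreal (W y) * chainG (indicator {..<L}) h m y
    + ennreal (W (L + 1/4) * exp (l * (y - L) + real m * h * \<Psi> l)) + of_nat m * overshoot L h"
  using y
proof (induction m arbitrary: y)
  case 0
  then show ?case by (simp add: add.assoc)
next
  case (Suc m)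
  note [measurable] = V_measurable[OF h] infV_measurable[OF h]
  let ?G = "chainG (indicator {..<L}) h m"
  have [measurable]: "?G \<in> borel_measurable borel" by (rule chainG_measurable[OF h]) measurable
  let ?A = "W (L + 1/4)"
  have A: "0 \<le> ?A" using L W_nonneg by simp
  let ?f = "\<lambda>z. Wp z * (ennreal (indicator {..<L} z) * ?G z)"
  let ?e = "\<lambda>y. ?A * exp (l * (y - L) + real m * h * \<Psi> l)"
  have ptw: "Wp (y + V h \<omega>) * indicator {0<..} (y + infV h \<omega>)
     \<le> ?f (y + V h \<omega>) * indicator {0<..} (y + infV h \<omega>) + (ennreal (?e y) * ennreal (exp (l * V h \<omega>))
      + (of_nat m * overshoot L h + Wp (L + V h \<omega>) * indicator {1/4<..} (V h \<omega>)))"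
    if w: "\<omega> \<in> space M" for \<omega>
  proof (cases "0 < y + infV h \<omega>")
    case True
    define z where "z = y + V h \<omega>"
    have z: "0 < z" using True infV_le[OF w h order_refl] by (simp add: z_def)
    have ee: "ennreal (?e y) * ennreal (exp (l * V h \<omega>)) = ennreal (?e z)"
      using A by (simp add: ennreal_mult'[symmetric] z_def mult.assoc mult_exp_exp algebra_simps)
    have "Wp z \<le> ?f z + (ennreal (?e z) + (of_nat m * overshoot L h + Wp (L + V h \<omega>) * indicator {1/4<..} (V h \<omega>)))"
    proof -
      \<comment> \<open>Below \<open>L\<close> the induction hypothesis applies. After a crossing by
        a small step, \<open>W z \<le> W (L + 1/4)\<close> and
        \<open>exp (l * (z - L)) \<ge> 1\<close>, so the exponential term pays for it; a large step
        is paid for by \<open>overshoot\<close>.\<close>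
      consider "z < L" | "L \<le> z" "V h \<omega> \<le> 1/4" | "L \<le> z" "1/4 < V h \<omega>" by linarith
      then show ?thesis
      proof cases
        case 1
        then have "Wp z \<le> ?f z + ennreal (?e z) + of_nat m * overshoot L h"
          using Suc.IH[OF z 1] z by (simp add: Wp_pos)
        also have "\<dots> \<le> ?f z + (ennreal (?e z) + (of_nat m * overshoot L h + Wp (L + V h \<omega>) * indicator {1/4<..} (V h \<omega>)))"
          by (simp add: add.assoc[symmetric])
        finally show ?thesis .
      next
        case 2
        then have "z \<le> L + 1/4" using Suc.prems by (simp add: z_def)
        then have "W z \<le> ?A * 1" using z W_mono by simp
        also have "\<dots> \<le> ?e z" using A l h 2 by (intro mult_left_mono) auto
        finally have "Wp z \<le> ennreal (?e z)" using z by (simp add: Wp_pos ennreal_leI)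
        then show ?thesis by (simp add: add_increasing add_increasing2)
      next
        case 3
        have "Wp z \<le> Wp (L + V h \<omega>)" using Suc.prems by (intro monoD[OF Wp_mono]) (simp add: z_def)
        then show ?thesis using 3 by (simp add: add_increasing add_increasing2)
      qed
    qed
    then show ?thesis using True ee by (simp add: z_def)
  qed simp
  have "ennreal (W y) = Q h Wp y" using Q_Wp[OF h Suc.prems(1)] by simp
  also have "\<dots> \<le> (\<integral>\<^sup>+\<omega>. ?f (y + V h \<omega>) * indicator {0<..} (y + infV h \<omega>) + (ennreal (?e y) * ennreal (exp (l * V h \<omega>))
      + (of_nat m * overshoot L h + Wp (L + V h \<omega>) * indicator {1/4<..} (V h \<omega>))) \<partial>M)"
    unfolding Q_def using ptw by (rule nn_integral_mono)
  also have "\<dots> = Q h ?f y + (ennreal (?e y) * ennreal (exp (h * \<Psi> l)) + (of_nat m * overshoot L h + overshoot L h))"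
    unfolding Q_def overshoot_def[of L h] using nn_integral_exp_V[OF h l(1)]
    by (simp add: nn_integral_add nn_integral_cmult emeasure_space_1)
  also have "ennreal (?e y) * ennreal (exp (h * \<Psi> l)) = ennreal (?A * exp (l * (y - L) + real (Suc m) * h * \<Psi> l))"
    using A by (simp add: ennreal_mult'[symmetric] mult.assoc mult_exp_exp algebra_simps)
  also have "Q h ?f y = ennreal (W y) * chainG (indicator {..<L}) h (Suc m) y"
    unfolding chainG.simps by (rule W_Kop[OF Suc.prems(1), symmetric])
  finally show ?case by (simp add: add_ac distrib_right del: chainG.simps)
qed

text \<open>Without a step above \<open>1/4\<close> the chain cannot get from below
  \<open>1/2\<close> to above \<open>3/4\<close> without visiting the strip between. The error
  \<open>e\<close> is kept relative to \<open>W\<close> because harmonicity reproduces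
  \<open>e * W y\<close> exactly; an absolute error would later be divided by a possibly tiny
  \<open>W y\<close>.\<close>

lemma chainG_ge_from_bottom:
  assumes h: "0 \<le> h" and L: "1 \<le> L" and y: "0 < y" "y < 1/2"
    and mid: "\<And>z k. 1/2 \<le> z \<Longrightarrow> z \<le> 3/4 \<Longrightarrow> k \<le> m \<Longrightarrow>
       ennreal (W z) \<le> ennreal (W z) * chainG (indicator {..<L}) h k z + e * ennreal (W z)"
  shows "ennreal (W y) \<le> ennreal (W y) * chainG (indicator {..<L}) h m y + e * ennreal (W y) + of_nat m * overshoot L h"
  using y mid
proof (induction m arbitrary: y)
  case 0
  then show ?case by (simp add: add.assoc)
next
  case (Suc m)
  note [measurable] = V_measurable[OF h] infV_measurable[OF h]
  let ?G = "chainG (indicator {..<L}) h m"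
  have [measurable]: "?G \<in> borel_measurable borel" by (rule chainG_measurable[OF h]) measurable
  let ?f = "\<lambda>z. Wp z * (ennreal (indicator {..<L} z) * ?G z)"
  have ptw: "Wp (y + V h \<omega>) * indicator {0<..} (y + infV h \<omega>)
     \<le> ?f (y + V h \<omega>) * indicator {0<..} (y + infV h \<omega>) + (e * (Wp (y + V h \<omega>) * indicator {0<..} (y + infV h \<omega>))
      + (of_nat m * overshoot L h + Wp (L + V h \<omega>) * indicator {1/4<..} (V h \<omega>)))"
    if w: "\<omega> \<in> space M" for \<omega>
  proof (cases "0 < y + infV h \<omega>")
    case True
    define z where "z = y + V h \<omega>"
    have z: "0 < z" using True infV_le[OF w h order_refl] by (simp add: z_def)
    have "Wp z \<le> ?f z + (e * Wp z + (of_nat m * overshoot L h + Wp (L + V h \<omega>) * indicator {1/4<..} (V h \<omega>)))"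
    proof -
      consider "z < 1/2" | "1/2 \<le> z" "z \<le> 3/4" | "3/4 < z" by linarith
      then show ?thesis
      proof cases
        case 1
        have "Wp z \<le> ?f z + e * Wp z + of_nat m * overshoot L h"
          using Suc.IH[OF z 1] Suc.prems(3) z 1 L by (simp add: Wp_pos)
        also have "\<dots> \<le> ?f z + (e * Wp z + (of_nat m * overshoot L h + Wp (L + V h \<omega>) * indicator {1/4<..} (V h \<omega>)))"
          by (simp add: add.assoc[symmetric])
        finally show ?thesis .
      next
        case 2
        have "Wp z \<le> ?f z + e * Wp z" using Suc.prems(3)[of z m] 2 z L by (simp add: Wp_pos)
        also have "\<dots> \<le> ?f z + (e * Wp z + (of_nat m * overshoot L h + Wp (L + V h \<omega>) * indicator {1/4<..} (V h \<omega>)))"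
          by (simp add: add.assoc[symmetric])
        finally show ?thesis .
      next
        case 3
        then have "1/4 < V h \<omega>" using Suc.prems by (simp add: z_def)
        moreover have "Wp z \<le> Wp (L + V h \<omega>)" using Suc.prems L by (intro monoD[OF Wp_mono]) (simp add: z_def)
        ultimately show ?thesis by (simp add: add_increasing add_increasing2)
      qed
    qed
    then show ?thesis using True by (simp add: z_def)
  qed simp
  have "ennreal (W y) = Q h Wp y" using Q_Wp[OF h Suc.prems(1)] by simp
  also have "\<dots> \<le> (\<integral>\<^sup>+\<omega>. ?f (y + V h \<omega>) * indicator {0<..} (y + infV h \<omega>) + (e * (Wp (y + V h \<omega>) * indicator {0<..} (y + infV h \<omega>))
      + (of_nat m * overshoot L h + Wp (L + V h \<omega>) * indicator {1/4<..} (V h \<omega>))) \<partial>M)"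
    unfolding Q_def using ptw by (rule nn_integral_mono)
  also have "\<dots> = Q h ?f y + (e * Q h Wp y + (of_nat m * overshoot L h + overshoot L h))"
    unfolding Q_def overshoot_def[of L h]
    by (simp add: nn_integral_add nn_integral_cmult emeasure_space_1)
  also have "Q h Wp y = ennreal (W y)" by (rule Q_Wp[OF h Suc.prems(1)])
  also have "Q h ?f y = ennreal (W y) * chainG (indicator {..<L}) h (Suc m) y"
    unfolding chainG.simps by (rule W_Kop[OF Suc.prems(1), symmetric])
  finally show ?case by (simp add: add_ac distrib_right del: chainG.simps)
qed

text \<open>The factor \<open>1 / W x\<close> multiplies only the overshoot term, which vanishes
  with the mesh for fixed \<open>x\<close>. The exponential term is free of \<open>x\<close> and so
  survives the limit \<open>x \<rightarrow> 0\<close>.\<close>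

lemma chainG_ge:
  assumes h: "0 \<le> h" and l: "0 \<le> l" "0 \<le> \<Psi> l" and L: "1 \<le> L" and x: "0 < x" "x < 1/2"
  shows "1 \<le> chainG (indicator {..<L}) h n x + ennreal (W (L + 1/4) / W (1/2) * exp (l * (3/4 - L) + real n * h * \<Psi> l))
    + (ennreal (1 / W (1/2)) + ennreal (1 / W x)) * (of_nat n * overshoot L h)"
proof -
  let ?B = "W (L + 1/4) * exp (l * (3/4 - L) + real n * h * \<Psi> l)"
  let ?o = "of_nat n * overshoot L h"
  have B: "0 \<le> ?B" using L W_nonneg by simp
  define e where "e = ennreal (1 / W (1/2)) * (ennreal ?B + ?o)"
  have Wh: "0 < W (1/2)" "0 < W x" using W_pos x by auto
  have "ennreal (W x) \<le> ennreal (W x) * chainG (indicator {..<L}) h n x + e * ennreal (W x) + ?o"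
  proof (rule chainG_ge_from_bottom[OF h L x])
    fix z :: real and k :: nat assume z: "1/2 \<le> z" "z \<le> 3/4" and k: "k \<le> n"
    have "ennreal (W z) \<le> ennreal (W z) * chainG (indicator {..<L}) h k z
      + ennreal (W (L + 1/4) * exp (l * (z - L) + real k * h * \<Psi> l)) + of_nat k * overshoot L h"
      using z L by (intro chainG_ge_from_middle h l) auto
    also have "\<dots> = ennreal (W z) * chainG (indicator {..<L}) h k z
      + (ennreal (W (L + 1/4) * exp (l * (z - L) + real k * h * \<Psi> l)) + of_nat k * overshoot L h)" by (simp add: add.assoc)
    also have "\<dots> \<le> ennreal (W z) * chainG (indicator {..<L}) h k z + (ennreal ?B + ?o)"
    proof (intro add_left_mono add_mono ennreal_leI mult_left_mono)
      have "l * (z - L) \<le> l * (3/4 - L)" using z l by (intro mult_left_mono) auto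
      moreover have "real k * h * \<Psi> l \<le> real n * h * \<Psi> l" using k h l by (intro mult_right_mono) auto
      ultimately show "exp (l * (z - L) + real k * h * \<Psi> l) \<le> exp (l * (3/4 - L) + real n * h * \<Psi> l)" by simp
      show "of_nat k * overshoot L h \<le> ?o" using k by (intro mult_right_mono) auto
    qed (use L W_nonneg in auto)
    also have "ennreal ?B + ?o \<le> e * ennreal (W z)"
    proof -
      have "1 = ennreal (1 / W (1/2)) * ennreal (W (1/2))" using Wh by (simp add: ennreal_mult'[symmetric])
      also have "\<dots> \<le> ennreal (1 / W (1/2)) * ennreal (W z)" using z by (intro mult_left_mono ennreal_leI W_mono) auto
      finally have "(ennreal ?B + ?o) * 1 \<le> (ennreal ?B + ?o) * (ennreal (1 / W (1/2)) * ennreal (W z))"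
        by (rule mult_left_mono) simp
      then show ?thesis by (simp add: e_def mult_ac)
    qed
    finally show "ennreal (W z) \<le> ennreal (W z) * chainG (indicator {..<L}) h k z + e * ennreal (W z)" by simp
  qed
  then have "ennreal (1 / W x) * ennreal (W x) \<le> ennreal (1 / W x) * (ennreal (W x) * chainG (indicator {..<L}) h n x + e * ennreal (W x) + ?o)"
    by (rule mult_left_mono) simp
  moreover have one: "ennreal (1 / W x) * ennreal (W x) = 1" using Wh by (simp add: ennreal_mult'[symmetric])
  moreover have "ennreal (1 / W x) * (ennreal (W x) * chainG (indicator {..<L}) h n x + e * ennreal (W x) + ?o)
     = (ennreal (1 / W x) * ennreal (W x)) * chainG (indicator {..<L}) h n x + (ennreal (1 / W x) * ennreal (W x)) * e + ennreal (1 / W x) * ?o"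
    by (simp only: distrib_left mult_ac)
  ultimately have "1 \<le> chainG (indicator {..<L}) h n x + e + ennreal (1 / W x) * ?o" by simp
  also have "e = ennreal (1 / W (1/2) * ?B) + ennreal (1 / W (1/2)) * ?o"
    using B Wh unfolding e_def by (subst ennreal_mult) (auto simp: distrib_left)
  finally show ?thesis by (simp add: add_ac distrib_right)
qed

end

text \<open>The right side is the indicator of a set over the unit type, evaluated at
  \<open>()\<close>: it encodes the truth value of the bounded quantifier.\<close>

lemma prod_indicator_ennreal:
  "finite A \<Longrightarrow> (\<Prod>k\<in>A. ennreal (indicator S (f k))) = (indicator {\<omega>. \<forall>k\<in>A. f k \<in> S} () :: ennreal)"
  by (induction A rule: finite_induct) (auto simp: indicator_def)

lemma integral_indicator_sets: "A \<in> sets N \<Longrightarrow> (\<integral>\<omega>. indicat_real A \<omega> \<partial>N) = measure N A"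
  by (simp add: Int_absorb2 sets.sets_into_space)

lemma (in finite_measure) integrable_indicator_sets: "A \<in> sets M \<Longrightarrow> integrable M (indicat_real A)"
  by (intro integrable_real_indicator) (auto simp: less_top[symmetric])

section \<open>Height estimates carried over to the process started from 0\<close>

context conditioned_levy begin

lemma up_markov_pos: "0 < x \<Longrightarrow> up_markov M V \<Psi> W N Vup (N x) {0<..} (up_kernel M V W) x (Vup x)"
  using markov_Vup[of x] by (intro up_markov.intro up_markov_axioms.intro conditioned_levy_axioms) auto

definition P0 :: "real \<Rightarrow> real \<Rightarrow> real measure" where
  "P0 = (\<lambda>t x. if x = 0 then distr (N 0) borel (Vup 0 t) else up_kernel M V W t x)"

lemma up_markov_0: "up_markov M V \<Psi> W N Vup (N 0) {0..} P0 0 (Vup 0)"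
  using cond by (intro up_markov.intro up_markov_axioms.intro conditioned_levy_axioms markov.intro)
    (auto simp: conditioned_to_stay_positive_def Let_def P0_def)

lemma chainG_eq_expectation:
  assumes x: "0 < x" and h: "0 \<le> h" and psi: "\<psi> \<in> borel_measurable borel" "\<And>z. 0 \<le> \<psi> z \<and> \<psi> z \<le> 1"
  shows "(\<integral>\<^sup>+\<omega>. (\<Prod>k=1..m. ennreal (\<psi> (Vup x (real k * h) \<omega>))) \<partial>N x) = chainG \<psi> h m x"
proof -
  interpret U: up_markov M V \<Psi> W N Vup "N x" "{0<..}" "up_kernel M V W" x "Vup x" by (rule up_markov_pos[OF x])
  let ?Z = "\<lambda>\<omega>. indicat_real {0<..} (Vup x 0 \<omega>)"
  have Z: "?Z \<in> borel_measurable (natural_sigma (N x) (Vup x) 0)"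
    using measurable_natural_sigma[of 0 0 "Vup x" "N x"] by measurable
  have Z1: "AE \<omega> in N x. ennreal (?Z \<omega>) = 1" using U.Y_0 by eventually_elim (use x in simp)
  have "(\<integral>\<^sup>+\<omega>. (\<Prod>k=1..m. ennreal (\<psi> (Vup x (real k * h) \<omega>))) \<partial>N x)
    = (\<integral>\<^sup>+\<omega>. ennreal (?Z \<omega>) * (\<Prod>k=1..m. ennreal (\<psi> (Vup x (0 + real k * h) \<omega>))) \<partial>N x)"
    using Z1 by (intro nn_integral_cong_AE) auto
  also have "\<dots> = (\<integral>\<^sup>+\<omega>. ennreal (?Z \<omega>) * chainG \<psi> h m (Vup x 0 \<omega>) \<partial>N x)"
    by (rule U.nn_integral_chain[OF h psi order_refl Z]) (auto simp: indicator_def)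
  also have "\<dots> = (\<integral>\<^sup>+\<omega>. chainG \<psi> h m x \<partial>N x)"
    using Z1 U.Y_0 by (intro nn_integral_cong_AE) auto
  also have "\<dots> = chainG \<psi> h m x" by (simp add: U.N.emeasure_space_1)
  finally show ?thesis .
qed

text \<open>What remains of the error in \<open>chainG_ge\<close> when the mesh tends to
  \<open>0\<close>: \<open>W (L + 1/4) / W (1/2)\<close> is the price of the transform started in
  the middle strip, and \<open>3/4\<close> is the upper edge of that strip.\<close>

definition hit_bound :: "real \<Rightarrow> real \<Rightarrow> real \<Rightarrow> real" where
  "hit_bound l L t = W (L + 1/4) / W (1/2) * exp (l * (3/4 - L) + t * \<Psi> l)"

lemma hit_bound_nonneg: "1 \<le> L \<Longrightarrow> 0 \<le> hit_bound l L t"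
  unfolding hit_bound_def using W_nonneg[of "L+1/4"] W_pos[of "1/2"] by simp

text \<open>The grid of \<open>r\<close> points is refined to \<open>r * Suc j\<close> points, which
  only shrinks the event; as \<open>j\<close> grows the overshoot terms disappear.\<close>

lemma stay_below_grid_pos:
  assumes x: "0 < x" "x < 1/2" and t: "0 < t" and l: "0 \<le> l" "0 \<le> \<Psi> l" and L: "1 \<le> L" and r: "0 < (r::nat)"
  shows "1 \<le> emeasure (N x) {\<omega>\<in>space (N x). \<forall>k\<in>{1..r}. Vup x (real k * (t / real r)) \<omega> < L} + ennreal (hit_bound l L t)"
proof -
  interpret U: up_markov M V \<Psi> W N Vup "N x" "{0<..}" "up_kernel M V W" x "Vup x" by (rule up_markov_pos[OF x(1)])
  let ?E = "\<lambda>r. {\<omega>\<in>space (N x). \<forall>k\<in>{1..r}. Vup x (real k * (t / real r)) \<omega> < L}"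
  have Em: "?E r \<in> sets (N x)" for r :: nat
  proof -
    have [measurable]: "Vup x (real k * (t / real r)) \<in> borel_measurable (N x)" for k using t by (intro U.Y_measurable) auto
    show ?thesis by measurable
  qed
  have G: "emeasure (N x) (?E r) = chainG (indicator {..<L}) (t / real r) r x" for r :: nat
  proof -
    have "emeasure (N x) (?E r) = (\<integral>\<^sup>+\<omega>. indicator (?E r) \<omega> \<partial>N x)" using Em by (rule nn_integral_indicator[symmetric])
    also have "\<dots> = (\<integral>\<^sup>+\<omega>. (\<Prod>k=1..r. ennreal (indicator {..<L} (Vup x (real k * (t / real r)) \<omega>))) \<partial>N x)"
      by (intro nn_integral_cong) (auto simp: prod_indicator_ennreal indicator_def)
    also have "\<dots> = chainG (indicator {..<L}) (t / real r) r x"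
      using t by (intro chainG_eq_expectation x) auto
    finally show ?thesis .
  qed
  let ?n = "\<lambda>j. r * Suc j"
  have "1 \<le> emeasure (N x) (?E r) + ennreal (hit_bound l L t)
     + (ennreal (1 / W (1/2)) + ennreal (1 / W x)) * (of_nat (?n j) * overshoot L (t / real (?n j)))" for j
  proof -
    have "1 \<le> chainG (indicator {..<L}) (t / real (?n j)) (?n j) x + ennreal (W (L + 1/4) / W (1/2) * exp (l * (3/4 - L) + real (?n j) * (t / real (?n j)) * \<Psi> l))
      + (ennreal (1 / W (1/2)) + ennreal (1 / W x)) * (of_nat (?n j) * overshoot L (t / real (?n j)))"
      using t by (intro chainG_ge l L x) auto
    also have "real (?n j) * (t / real (?n j)) = t" using r by (simp del: of_nat_mult)
    finally have *: "1 \<le> emeasure (N x) (?E (?n j)) + ennreal (hit_bound l L t)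
      + (ennreal (1 / W (1/2)) + ennreal (1 / W x)) * (of_nat (?n j) * overshoot L (t / real (?n j)))"
      unfolding hit_bound_def G .
    have "emeasure (N x) (?E (?n j)) \<le> emeasure (N x) (?E r)"
    proof (rule emeasure_mono[OF _ Em])
      show "?E (?n j) \<subseteq> ?E r"
      proof safe
        fix \<omega> k assume w: "\<forall>k\<in>{1..?n j}. Vup x (real k * (t / real (?n j))) \<omega> < L" and k: "k \<in> {1..r}"
        have "k * Suc j \<le> r * Suc j" using k by (intro mult_le_mono1) simp
        then have "k * Suc j \<in> {1..?n j}" using k by simp
        then have "Vup x (real (k * Suc j) * (t / real (?n j))) \<omega> < L" using w by blast
        moreover have "real (k * Suc j) * (t / real (?n j)) = real k * (t / real r)" using r by (simp add: field_simps del: of_nat_Suc mult_Suc_right)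
        ultimately show "Vup x (real k * (t / real r)) \<omega> < L" by simp
      qed
    qed
    from order_trans[OF * add_right_mono[OF add_right_mono[OF this]]] show ?thesis .
  qed
  moreover have "(\<lambda>j. emeasure (N x) (?E r) + ennreal (hit_bound l L t)
     + (ennreal (1 / W (1/2)) + ennreal (1 / W x)) * (of_nat (?n j) * overshoot L (t / real (?n j))))
     \<longlonglongrightarrow> emeasure (N x) (?E r) + ennreal (hit_bound l L t) + (ennreal (1 / W (1/2)) + ennreal (1 / W x)) * 0"
  proof (intro tendsto_add tendsto_const ennreal_tendsto_cmult)
    \<comment> \<open>The shift by one is due to \<open>overshoot_tendsto_0\<close> being indexed
      through \<open>Suc n\<close>.\<close>
    have "strict_mono (\<lambda>j. ?n j - 1)"
      using r by (intro strict_mono_Suc_iff[THEN iffD2]) auto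
    from LIMSEQ_subseq_LIMSEQ[OF overshoot_tendsto_0[OF t, of L] this]
    show "(\<lambda>j. of_nat (?n j) * overshoot L (t / real (?n j))) \<longlonglongrightarrow> 0"
      using r by (simp add: comp_def del: of_nat_Suc mult_Suc_right)
  qed (simp add: ennreal_add_less_top less_top)
  ultimately have "1 \<le> emeasure (N x) (?E r) + ennreal (hit_bound l L t) + (ennreal (1 / W (1/2)) + ennreal (1 / W x)) * 0"
    by (intro LIMSEQ_le_const) auto
  then show ?thesis by simp
qed

lemma continuous_on_coordinate: "continuous_on UNIV (\<lambda>u::real \<Rightarrow> real. u t)"
  by (rule continuous_on_product_coordinates)

lemma fdd_limit:
  fixes f :: "(real \<Rightarrow> real) \<Rightarrow> real"
  assumes "finite J" "J \<subseteq> {0..}" "continuous_on UNIV f" "bounded (range f)"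
  shows "((\<lambda>x. \<integral>\<omega>. f (\<lambda>t\<in>J. Vup x t \<omega>) \<partial>N x) \<longlongrightarrow> (\<integral>\<omega>. f (\<lambda>t\<in>J. Vup 0 t \<omega>) \<partial>N 0)) (at_right 0)"
proof -
  have "converges_in_fdd N Vup (N 0) (Vup 0) (at_right 0)"
    using cond unfolding conditioned_to_stay_positive_def by (elim conjE)
  from this[unfolded converges_in_fdd_def, rule_format, OF assms] show ?thesis .
qed

text \<open>Convergence of finite-dimensional distributions tests continuous functions only. The
  cutoff used is \<open>1\<close> up to \<open>L\<close> and \<open>0\<close> from
  \<open>L + 1\<close> on, which is why the limit process is controlled one unit higher.\<close>

lemma hit_grid_0:
  assumes t: "0 < t" and l: "0 \<le> l" "0 \<le> \<Psi> l" and L: "1 \<le> L" and r: "0 < (r::nat)"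
  shows "measure (N 0) {\<omega>\<in>space (N 0). \<exists>k\<in>{1..r}. L + 1 \<le> Vup 0 (real k * (t / real r)) \<omega>} \<le> hit_bound l L t"
proof -
  interpret Z: up_markov M V \<Psi> W N Vup "N 0" "{0..}" P0 0 "Vup 0" by (rule up_markov_0)
  let ?t = "\<lambda>k. real k * (t / real r)"
  let ?J = "?t ` {1..r}"
  let ?c = "\<lambda>z::real. max 0 (min 1 (L + 1 - z))"
  define f where "f u = (\<Prod>s\<in>?J. ?c (u s))" for u :: "real \<Rightarrow> real"
  have tJ: "?J \<subseteq> {0..}" using t by auto
  have f01: "0 \<le> f u \<and> f u \<le> 1" for u unfolding f_def by (auto intro!: prod_nonneg prod_le_1)
  have cont: "continuous_on UNIV f" unfolding f_def
    by (intro continuous_intros continuous_on_coordinate)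
  have bd: "bounded (range f)" using f01 by (intro boundedI[of _ 1]) (metis abs_of_nonneg imageE real_norm_def)
  have fr: "f (\<lambda>t\<in>?J. Y t \<omega>) = f (\<lambda>t. Y t \<omega>)" for Y :: "real \<Rightarrow> 'c \<Rightarrow> real" and \<omega>
    unfolding f_def by (intro prod.cong) auto
  have low: "1 - hit_bound l L t \<le> (\<integral>\<omega>. f (\<lambda>t\<in>?J. Vup x t \<omega>) \<partial>N x)" if x: "0 < x" "x < 1/2" for x
  proof -
    interpret U: up_markov M V \<Psi> W N Vup "N x" "{0<..}" "up_kernel M V W" x "Vup x" by (rule up_markov_pos[OF x(1)])
    have [measurable]: "Vup x (?t k) \<in> borel_measurable (N x)" for k using t by (intro U.Y_measurable) auto
    let ?E = "{\<omega>\<in>space (N x). \<forall>k\<in>{1..r}. Vup x (?t k) \<omega> < L}"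
    have [measurable]: "?E \<in> sets (N x)" by measurable
    have fm: "(\<lambda>\<omega>. f (\<lambda>t. Vup x t \<omega>)) \<in> borel_measurable (N x)" unfolding f_def
      using t by (intro borel_measurable_prod) auto
    have "1 \<le> emeasure (N x) ?E + ennreal (hit_bound l L t)" by (rule stay_below_grid_pos[OF x t l L r])
    also have "\<dots> = ennreal (U.N.prob ?E + hit_bound l L t)"
      using hit_bound_nonneg[OF L] by (simp add: U.N.emeasure_eq_measure)
    finally have "1 \<le> U.N.prob ?E + hit_bound l L t"
      by (simp only: ennreal_ge_1)
    then have "1 - hit_bound l L t \<le> U.N.prob ?E" by simp
    also have "\<dots> = (\<integral>\<omega>. indicator ?E \<omega> \<partial>N x)" by (rule integral_indicator_sets[symmetric]) measurable
    also have "\<dots> \<le> (\<integral>\<omega>. f (\<lambda>t. Vup x t \<omega>) \<partial>N x)"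
    proof (rule integral_mono)
      show "integrable (N x) (indicat_real ?E)" by (rule U.N.integrable_indicator_sets) measurable
      show "integrable (N x) (\<lambda>\<omega>. f (\<lambda>t. Vup x t \<omega>))" using f01 fm by (intro U.N.integrable_const_bound[of _ 1]) auto
      show "indicat_real ?E \<omega> \<le> f (\<lambda>t. Vup x t \<omega>)" for \<omega>
      proof (cases "\<omega> \<in> ?E")
        case True
        then have "f (\<lambda>t. Vup x t \<omega>) = 1" unfolding f_def by (intro prod.neutral) auto
        then show ?thesis by (simp add: indicator_def)
      qed (use f01 in auto)
    qed
    finally show ?thesis by (simp only: fr)
  qed
  have "1 - hit_bound l L t \<le> (\<integral>\<omega>. f (\<lambda>t\<in>?J. Vup 0 t \<omega>) \<partial>N 0)"
  proof (rule tendsto_lowerbound[OF fdd_limit[OF _ tJ cont bd]])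
    have "eventually (\<lambda>x::real. 0 < x \<and> x < 1/2) (at_right 0)" by (intro eventually_conj) real_asymp+
    then show "eventually (\<lambda>x. 1 - hit_bound l L t \<le> (\<integral>\<omega>. f (\<lambda>t\<in>?J. Vup x t \<omega>) \<partial>N x)) (at_right 0)"
      by eventually_elim (use low in auto)
  qed auto
  also have "\<dots> = (\<integral>\<omega>. f (\<lambda>t. Vup 0 t \<omega>) \<partial>N 0)" by (simp only: fr)
  finally have A: "1 - hit_bound l L t \<le> (\<integral>\<omega>. f (\<lambda>t. Vup 0 t \<omega>) \<partial>N 0)" .
  have [measurable]: "Vup 0 (?t k) \<in> borel_measurable (N 0)" for k using t by (intro Z.Y_measurable) auto
  let ?H = "{\<omega>\<in>space (N 0). \<exists>k\<in>{1..r}. L + 1 \<le> Vup 0 (?t k) \<omega>}"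
  have [measurable]: "?H \<in> sets (N 0)" by measurable
  have fm: "(\<lambda>\<omega>. f (\<lambda>t. Vup 0 t \<omega>)) \<in> borel_measurable (N 0)" unfolding f_def
    using t by (intro borel_measurable_prod) auto
  have iH: "integrable (N 0) (indicat_real ?H)" by (rule Z.N.integrable_indicator_sets) measurable
  have "(\<integral>\<omega>. f (\<lambda>t. Vup 0 t \<omega>) \<partial>N 0) \<le> (\<integral>\<omega>. 1 - indicator ?H \<omega> \<partial>N 0)"
  proof (rule integral_mono)
    show "integrable (N 0) (\<lambda>\<omega>. f (\<lambda>t. Vup 0 t \<omega>))" using f01 fm by (intro Z.N.integrable_const_bound[of _ 1]) auto
    show "integrable (N 0) (\<lambda>\<omega>. 1 - indicat_real ?H \<omega>)" using iH by simp
    show "f (\<lambda>t. Vup 0 t \<omega>) \<le> 1 - indicat_real ?H \<omega>" for \<omega>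
    proof (cases "\<omega> \<in> ?H")
      case True
      then obtain k where k: "k \<in> {1..r}" "L + 1 \<le> Vup 0 (?t k) \<omega>" by auto
      then have "f (\<lambda>t. Vup 0 t \<omega>) = 0" unfolding f_def by (intro prod_zero bexI[of _ "?t k"]) auto
      then show ?thesis by (simp add: indicator_def)
    qed (use f01 in auto)
  qed
  also have "\<dots> = (\<integral>\<omega>. 1 \<partial>N 0) - (\<integral>\<omega>. indicat_real ?H \<omega> \<partial>N 0)"
    by (rule Bochner_Integration.integral_diff[OF _ iH]) simp
  also have "(\<integral>\<omega>. indicat_real ?H \<omega> \<partial>N 0) = Z.N.prob ?H" by (rule integral_indicator_sets) measurable
  also have "(\<integral>\<omega>. 1 \<partial>N 0) = (1::real)" by (simp add: Z.N.prob_space)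
  finally have "(\<integral>\<omega>. f (\<lambda>t. Vup 0 t \<omega>) \<partial>N 0) \<le> 1 - Z.N.prob ?H" .
  with A show ?thesis by linarith
qed

end

section \<open>Finiteness of the exponential functional\<close>

context sn_levy_ns begin

text \<open>Were \<open>\<Psi> l = 0\<close>, convexity would force
  \<open>\<Psi> (l / 2) = 0\<close> as well. Then \<open>(exp (l / 2 * V 1) - 1)^2\<close> has
  expectation \<open>1 - 2 + 1 = 0\<close>, so \<open>V 1 = 0\<close> almost surely and
  \<open>\<Psi>\<close> vanishes identically, against its linear growth.\<close>

lemma Psi_neg_between:
  assumes l: "0 < l" "l < l1" and P1: "\<Psi> l1 \<le> 0" shows "\<Psi> l < 0"
proof -
  have "l1 * \<Psi> l \<le> l * \<Psi> l1" using Psi_ray l by simp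
  also have "\<dots> \<le> 0" using l P1 by (simp add: mult_nonneg_nonpos)
  finally have le: "\<Psi> l \<le> 0" using l by (simp add: mult_le_0_iff)
  have "\<Psi> l \<noteq> 0"
  proof
    assume l0: "\<Psi> l = 0"
    define \<mu> where "\<mu> = l / 2"
    have mu: "0 < \<mu>" "\<mu> < l" using l by (auto simp: \<mu>_def)
    have "l * \<Psi> \<mu> \<le> \<mu> * \<Psi> l" using Psi_ray mu by simp
    then have "\<Psi> \<mu> \<le> 0" using l l0 by (simp add: mult_le_0_iff)
    define s where "s = (l - \<mu>) / (l1 - \<mu>)"
    have s: "0 < s" "s < 1" using l mu by (auto simp: s_def)
    have sl: "(1 - s) * \<mu> + s * l1 = l"
    proof -
      have "s * (l1 - \<mu>) = l - \<mu>" using l mu by (simp add: s_def)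
      then show ?thesis by (simp add: algebra_simps)
    qed
    have "\<Psi> ((1 - s) *\<^sub>R \<mu> + s *\<^sub>R l1) \<le> (1 - s) * \<Psi> \<mu> + s * \<Psi> l1"
      using s l mu by (intro convex_onD[OF Psi_convex]) auto
    then have "0 \<le> (1 - s) * \<Psi> \<mu> + s * \<Psi> l1" using sl l0 by simp
    moreover have "s * \<Psi> l1 \<le> 0" using s P1 by (simp add: mult_nonneg_nonpos)
    ultimately have "0 \<le> (1 - s) * \<Psi> \<mu>" by linarith
    then have "\<Psi> \<mu> = 0" using s \<open>\<Psi> \<mu> \<le> 0\<close> by (simp add: zero_le_mult_iff)
    have "(\<integral>\<omega>. (exp (\<mu> * V 1 \<omega>) - 1)\<^sup>2 \<partial>M) = (\<integral>\<omega>. exp (l * V 1 \<omega>) - 2 * exp (\<mu> * V 1 \<omega>) + 1 \<partial>M)"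
      by (intro Bochner_Integration.integral_cong refl)
        (simp add: power2_eq_square \<mu>_def algebra_simps mult_exp_exp)
    also have "\<dots> = exp (\<Psi> l) - 2 * exp (\<Psi> \<mu>) + 1"
      using exp_V_integrable[of 1 l] exp_V_integrable[of 1 \<mu>] exp_V_integral[of 1 l] exp_V_integral[of 1 \<mu>] l mu
      by (simp add: prob_space)
    also have "\<dots> = 0" using l0 \<open>\<Psi> \<mu> = 0\<close> by simp
    finally have I0: "(\<integral>\<omega>. (exp (\<mu> * V 1 \<omega>) - 1)\<^sup>2 \<partial>M) = 0" .
    have "integrable M (\<lambda>\<omega>. exp (l * V 1 \<omega>) - 2 * exp (\<mu> * V 1 \<omega>) + 1)"
      using exp_V_integrable[of 1 l] exp_V_integrable[of 1 \<mu>] l mu by auto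
    then have int: "integrable M (\<lambda>\<omega>. (exp (\<mu> * V 1 \<omega>) - 1)\<^sup>2)"
      by (rule Bochner_Integration.integrable_cong[THEN iffD1, rotated -1])
        (simp_all add: power2_eq_square \<mu>_def algebra_simps mult_exp_exp)
    have "AE \<omega> in M. (exp (\<mu> * V 1 \<omega>) - 1)\<^sup>2 = 0"
      using integral_nonneg_eq_0_iff_AE[OF int] I0 by auto
    then have V0: "AE \<omega> in M. V 1 \<omega> = 0" by eventually_elim (use mu in auto)
    have "\<Psi> x = 0" if "0 \<le> x" for x
    proof -
      have "exp (\<Psi> x) = (\<integral>\<omega>. exp (x * V 1 \<omega>) \<partial>M)" using exp_V_integral[of 1 x] that by simp
      also have "\<dots> = (\<integral>\<omega>. 1 \<partial>M)" using V0 by (intro integral_cong_AE) (auto elim: eventually_mono)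
      finally show ?thesis by (simp add: prob_space)
    qed
    moreover obtain c l0 where "c > 0" "l0 > 0" "\<And>l. l \<ge> l0 \<Longrightarrow> c * l \<le> \<Psi> l" using Psi_ge_linear by blast
    ultimately show False by (metis less_imp_le mult_pos_pos not_le order_refl)
  qed
  then show ?thesis using le by simp
qed

text \<open>\<open>k\<close> is the supremum of the set where \<open>\<Psi> \<le> 0\<close>. If
  \<open>V\<close> drifts to minus infinity, \<open>kappa\<close> is the infimum of the positive
  zeros; one zero is found above \<open>\<theta>\<close> by the intermediate value theorem, and it
  is at most \<open>k\<close> because it lies in that set.\<close>

lemma kappa_le:
  assumes "0 < l1" "\<Psi> l1 \<le> 0"
  obtains k \<theta> where "0 < \<theta>" "\<theta> < k" "k - 1/2 \<le> \<theta>" "\<Psi> \<theta> < 0" "kappa M V \<Psi> \<le> k" "\<And>l. k < l \<Longrightarrow> 0 < \<Psi> l"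
proof -
  obtain c l0 where c: "c > 0" "l0 > 0" "\<And>l. l \<ge> l0 \<Longrightarrow> c * l \<le> \<Psi> l" using Psi_ge_linear by blast
  have pos: "0 < \<Psi> l" if "l \<ge> l0" for l
    using c(3)[OF that] c(1,2) that by (smt (verit) mult_pos_pos)
  let ?S = "{l. 0 < l \<and> \<Psi> l \<le> 0}"
  define k where "k = Sup ?S"
  have ne: "l1 \<in> ?S" using assms by simp
  have bdd: "bdd_above ?S" using pos by (intro bdd_aboveI[of _ l0]) (force simp: not_less[symmetric])
  have up: "l \<le> k" if "l \<in> ?S" for l unfolding k_def using that bdd by (rule cSup_upper)
  have k0: "0 < k" using up[OF ne] assms by simp
  \<comment> \<open>\<open>k / 2\<close> keeps \<open>\<theta>\<close> positive;
    \<open>k - 1/2\<close> keeps it so close to \<open>k\<close> that the factor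
    \<open>exp (- x)\<close> can bring the growth of \<open>W\<close> below
    \<open>exp (\<theta> * x)\<close>.\<close>
  define \<theta> where "\<theta> = max (k / 2) (k - 1/2)"
  have th: "0 < \<theta>" "\<theta> < k" "k - 1/2 \<le> \<theta>" using k0 by (auto simp: \<theta>_def)
  obtain l where l: "l \<in> ?S" "\<theta> < l" using less_cSup_iff[of ?S \<theta>] ne bdd th unfolding k_def by blast
  have neg: "\<Psi> \<theta> < 0" using Psi_neg_between[OF th(1) l(2)] l(1) by simp
  have "kappa M V \<Psi> \<le> k"
  proof (cases "AE \<omega> in M. filterlim (\<lambda>t. V t \<omega>) at_bot at_top")
    case True
    have "convex_on {0<..} \<Psi>" by (rule convex_on_subset[OF Psi_convex]) auto
    then have cont: "continuous_on {0<..} \<Psi>" by (intro convex_on_continuous open_greaterThan)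
    have "{\<theta>..max l0 k} \<subseteq> {0<..}" using th by auto
    then have "continuous_on {\<theta>..max l0 k} \<Psi>" by (rule continuous_on_subset[OF cont])
    then have "\<exists>x\<ge>\<theta>. x \<le> max l0 k \<and> \<Psi> x = 0"
      using neg pos[of "max l0 k"] th by (intro IVT') auto
    then obtain x where x: "\<theta> \<le> x" "\<Psi> x = 0" by blast
    have "Inf {\<theta>. 0 < \<theta> \<and> \<Psi> \<theta> = 0} \<le> x" using x th by (intro cInf_lower bdd_belowI[of _ 0]) auto
    also have "x \<le> k" using x th by (intro up) auto
    finally show ?thesis using True by (simp add: kappa_def)
  qed (use k0 in \<open>simp add: kappa_def\<close>)
  moreover have "0 < \<Psi> l" if "k < l" for l using up[of l] that k0 by (auto simp: not_le[symmetric])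
  ultimately show thesis using that th neg by blast
qed

end

lemma sum_exp_decay:
  assumes c: "0 < c" and h: "0 < h"
  shows "(\<Sum>k=1..n. h * exp (- (real k * h * c))) \<le> 1 / c"
proof -
  have "(\<Sum>k=1..n. h * exp (- (real k * h * c))) \<le> (1 - exp (- (real n * h * c))) / c"
  proof (induction n)
    case (Suc n)
    have "h * c \<le> exp (h * c) - 1" using exp_ge_add_one_self[of "h * c"] by linarith
    then have "h * c * exp (- (real (Suc n) * h * c)) \<le> (exp (h * c) - 1) * exp (- (real (Suc n) * h * c))"
      by (rule mult_right_mono) simp
    also have "\<dots> = exp (- (real n * h * c)) - exp (- (real (Suc n) * h * c))"
      by (simp add: left_diff_distrib mult_exp_exp algebra_simps)
    finally have "h * exp (- (real (Suc n) * h * c)) \<le> (exp (- (real n * h * c)) - exp (- (real (Suc n) * h * c))) / c"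
      using c by (simp add: field_simps)
    then show ?case using Suc by (simp add: diff_divide_distrib)
  qed simp
  also have "\<dots> \<le> 1 / c" using c by (intro divide_right_mono) auto
  finally show ?thesis .
qed

context conditioned_levy begin

text \<open>Here \<open>exp (- z) * W z\<close> is bounded by a multiple of \<open>exp (\<theta> * z)\<close> for some \<open>\<theta> > 0\<close> with
  \<open>\<Psi> \<theta> < 0\<close>, and \<open>exp (\<theta> * V t)\<close> has the integrable expectation \<open>exp (t * \<Psi> \<theta>)\<close>.\<close>

lemma occupation_bound_neg:
  assumes "0 < l1" "\<Psi> l1 \<le> 0"
  shows "\<exists>J. \<forall>h>0. \<forall>n. (\<Sum>k=1..n. ennreal h * Kop (real k * h) (\<lambda>z. ennreal (exp (- z))) 1) \<le> ennreal J"
proof -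
  obtain k \<theta> where k: "0 < \<theta>" "\<theta> < k" "k - 1/2 \<le> \<theta>" "\<Psi> \<theta> < 0" "kappa M V \<Psi> \<le> k" "\<And>l. k < l \<Longrightarrow> 0 < \<Psi> l"
    using kappa_le[OF assms] by blast
  \<comment> \<open>\<open>\<Psi>\<close> is positive above \<open>k\<close>, so \<open>W\<close>
    grows at most at rate \<open>k + 1/4\<close>. After multiplication by \<open>exp (- x)\<close>
    the rate is \<open>k - 3/4\<close>, which is below
    \<open>\<theta> \<ge> k - 1/2\<close>.\<close>
  define C where "C = exp (k + 1/4) / \<Psi> (k + 1/4)"
  have C: "0 \<le> C" using k(6)[of "k+1/4"] by (simp add: C_def)
  have Wle: "W x \<le> C * exp ((k + 1/4) * x)" if "0 \<le> x" for x
    unfolding C_def using k that by (intro W_le_exp) auto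
  have Wth: "W x * exp (- x) \<le> C * exp (\<theta> * x)" if "0 \<le> x" for x
  proof -
    have "W x * exp (- x) \<le> C * exp ((k + 1/4) * x) * exp (- x)" by (intro mult_right_mono Wle that) auto
    also have "\<dots> = C * exp ((k - 3/4) * x)" by (simp add: mult.assoc mult_exp_exp algebra_simps)
    also have "\<dots> \<le> C * exp (\<theta> * x)"
    proof (intro mult_left_mono C)
      have "(k - 3/4) * x \<le> \<theta> * x" using k that by (intro mult_right_mono) auto
      then show "exp ((k - 3/4) * x) \<le> exp (\<theta> * x)" by simp
    qed
    finally show ?thesis .
  qed
  define D where "D = C * exp \<theta> / W 1"
  have D: "0 \<le> D" using C W_nonneg[of 1] by (simp add: D_def)
  have K: "Kop t (\<lambda>z. ennreal (exp (- z))) 1 \<le> ennreal (D * exp (t * \<Psi> \<theta>))" if t: "0 \<le> t" for t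
  proof -
    have "Q t (\<lambda>z. Wp z * ennreal (exp (- z))) 1 \<le> (\<integral>\<^sup>+\<omega>. ennreal (C * exp \<theta>) * ennreal (exp (\<theta> * V t \<omega>)) \<partial>M)"
      unfolding Q_def
    proof (intro nn_integral_mono)
      fix \<omega> assume w: "\<omega> \<in> space M"
      show "Wp (1 + V t \<omega>) * ennreal (exp (- (1 + V t \<omega>))) * indicator {0<..} (1 + infV t \<omega>) \<le> ennreal (C * exp \<theta>) * ennreal (exp (\<theta> * V t \<omega>))"
      proof (cases "0 < 1 + infV t \<omega>")
        case True
        then have p: "0 < 1 + V t \<omega>" using infV_le[OF w t order_refl] by linarith
        have "W (1 + V t \<omega>) * exp (- (1 + V t \<omega>)) \<le> C * exp (\<theta> * (1 + V t \<omega>))" using p by (intro Wth) auto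
        also have "\<dots> = C * exp \<theta> * exp (\<theta> * V t \<omega>)" by (simp add: mult.assoc mult_exp_exp distrib_left)
        finally show ?thesis using True p C W_nonneg[of "1 + V t \<omega>"] by (simp add: Wp_pos ennreal_mult'[symmetric] ennreal_leI)
      qed simp
    qed
    also have "\<dots> = ennreal (C * exp \<theta>) * ennreal (exp (t * \<Psi> \<theta>))"
      using t k nn_integral_exp_V[of t \<theta>] by (subst nn_integral_cmult) auto
    also have "\<dots> = ennreal (C * exp \<theta> * exp (t * \<Psi> \<theta>))" using C by (simp add: ennreal_mult')
    finally have "Q t (\<lambda>z. Wp z * ennreal (exp (- z))) 1 / ennreal (W 1) \<le> ennreal (C * exp \<theta> * exp (t * \<Psi> \<theta>)) / ennreal (W 1)"
      by (rule divide_right_mono_ennreal)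
    also have "\<dots> = ennreal (D * exp (t * \<Psi> \<theta>))" using C W_pos[of 1] by (subst divide_ennreal) (auto simp: D_def)
    finally show ?thesis by (simp add: Kop_def)
  qed
  show ?thesis
  proof (intro exI[of _ "D * (1 / (- \<Psi> \<theta>))"] allI impI)
    fix h :: real and n :: nat assume h: "0 < h"
    have "(\<Sum>k=1..n. ennreal h * Kop (real k * h) (\<lambda>z. ennreal (exp (- z))) 1)
      \<le> (\<Sum>k=1..n. ennreal h * ennreal (D * exp (real k * h * \<Psi> \<theta>)))"
      using h by (intro sum_mono mult_left_mono K) auto
    also have "\<dots> = ennreal (D * (\<Sum>k=1..n. h * exp (- (real k * h * (- \<Psi> \<theta>)))))"
      using h D by (simp add: ennreal_mult'[symmetric] sum_distrib_left mult_ac)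
    also have "\<dots> \<le> ennreal (D * (1 / (- \<Psi> \<theta>)))"
      using k h D by (intro ennreal_leI mult_left_mono sum_exp_decay) auto
    finally show "(\<Sum>k=1..n. ennreal h * Kop (real k * h) (\<lambda>z. ennreal (exp (- z))) 1) \<le> ennreal (D * (1 / (- \<Psi> \<theta>)))" .
  qed
qed

lemma chainG_eq_1:
  assumes "0 \<le> h" "\<And>z. 0 < z \<Longrightarrow> \<psi> z = 1" "0 < y" shows "chainG \<psi> h m y = 1"
  using assms(3)
proof (induction m arbitrary: y)
  case (Suc m)
  have "chainG \<psi> h (Suc m) y = Kop h (\<lambda>_. 1) y"
    unfolding chainG.simps by (intro Kop_cong assms(1)) (simp add: assms(2) Suc.IH)
  then show ?case using Kop_1[OF assms(1) Suc.prems] by simp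
qed simp

text \<open>One step of length \<open>s\<close> lifts the killed process above \<open>z + 2\<close>
  with at least the probability from \<open>escape_prob_pos\<close>. From a height
  \<open>x > z + 2\<close>, survival of the path lowered by \<open>z + 1\<close> keeps the original
  path above \<open>z + 1\<close>; the lowered path starts above \<open>1\<close>, so its weight is
  at least \<open>W 1\<close>.\<close>

lemma chainG_escape:
  assumes s: "0 \<le> s" and z: "1 \<le> z" and y: "z < y" "y \<le> z + 1"
  shows "emeasure M {\<omega>\<in>space M. 2 \<le> V s \<omega> \<and> 0 < 1 + infV s \<omega>} * ennreal (W 1) \<le> ennreal (W y) * chainG (indicator {z+1<..}) s m y"
    (is "emeasure M ?E * _ \<le> _")
proof (cases m)
  case 0
  have "emeasure M ?E * ennreal (W 1) \<le> 1 * ennreal (W y)"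
    using y z by (intro mult_mono emeasure_le_1 ennreal_leI W_mono) auto
  then show ?thesis using 0 by simp
next
  case (Suc j)
  note [measurable] = V_measurable[OF s] infV_measurable[OF s]
  let ?G = "chainG (indicator {z+1<..}) s j"
  have "emeasure M ?E * ennreal (W 1) = (\<integral>\<^sup>+\<omega>. ennreal (W 1) * indicator ?E \<omega> \<partial>M)"
    by (subst nn_integral_cmult_indicator) (auto simp: mult.commute)
  also have "\<dots> \<le> Q s (\<lambda>x. Wp x * (ennreal (indicator {z+1<..} x) * ?G x)) y"
    unfolding Q_def
  proof (intro nn_integral_mono)
    fix \<omega> assume w: "\<omega> \<in> space M"
    show "ennreal (W 1) * indicator ?E \<omega> \<le> Wp (y + V s \<omega>) * (ennreal (indicator {z+1<..} (y + V s \<omega>)) * ?G (y + V s \<omega>)) * indicator {0<..} (y + infV s \<omega>)"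
    proof (cases "\<omega> \<in> ?E")
      case True
      define x where "x = y + V s \<omega>"
      have x: "z + 2 < x" and p: "0 < y + infV s \<omega>" using True y z by (auto simp: x_def)
      have "ennreal (W 1) \<le> ennreal (W (x - (z + 1))) * 1" using x z by (auto intro!: ennreal_leI W_mono)
      also have "1 = chainG (\<lambda>w. indicator {z+1<..} (z + 1 + w)) s j (x - (z + 1))"
        using x by (intro chainG_eq_1[symmetric] s) auto
      also have "ennreal (W (x - (z + 1))) * chainG (\<lambda>w. indicator {z+1<..} (z + 1 + w)) s j (x - (z + 1)) \<le> ennreal (W x) * ?G x"
        using x z s by (intro chainG_domination) auto
      finally show ?thesis using True x p z by (simp add: x_def[symmetric] Wp_pos)
    qed simp
  qed
  also have "\<dots> = ennreal (W y) * chainG (indicator {z+1<..}) s m y"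
    unfolding Suc chainG.simps using y z by (intro W_Kop[symmetric]) simp
  finally show ?thesis .
qed

end

lemma exp_shell_decomposition:
  fixes y :: real
  shows "ennreal (exp (- y)) * indicator {1<..} y
    \<le> (\<Sum>i. ennreal (exp (- real (Suc i))) * indicator {real (Suc i)<..real (Suc i) + 1} y)"
proof (cases "1 < y")
  case True
  \<comment> \<open>The shells start at \<open>1\<close>: \<open>Suc i\<close> is the ceiling of
    \<open>y\<close> minus \<open>1\<close>, the left end of the shell containing
    \<open>y\<close>.\<close>
  define i where "i = nat \<lceil>y\<rceil> - 2"
  have "2 \<le> \<lceil>y\<rceil>" using True by (simp add: le_ceiling_iff)
  then have "int (Suc i) = \<lceil>y\<rceil> - 1" unfolding i_def by arith
  then have i: "real (Suc i) = of_int \<lceil>y\<rceil> - 1" by (metis of_int_1 of_int_diff of_int_of_nat_eq)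
  have y: "real (Suc i) < y" "y \<le> real (Suc i) + 1" unfolding i by linarith+
  define f where "f i = ennreal (exp (- real (Suc i))) * indicator {real (Suc i)<..real (Suc i) + 1} y" for i
  have "ennreal (exp (- y)) * indicator {1<..} y \<le> f i"
    using y by (simp add: f_def indicator_def ennreal_leI del: of_nat_Suc)
  also have "f i = (\<Sum>j\<in>{i}. f j)" by simp
  also have "\<dots> \<le> (\<Sum>j. f j)" by (rule sum_le_suminf) auto
  finally show ?thesis unfolding f_def .
qed simp

text \<open>The grid of mesh \<open>s / m\<close> splits into \<open>m\<close> translates of the
  grid of mesh \<open>s\<close>, on each of which visits can be counted. Running to \<open>n\<close>
  in every class overcounts, which is harmless for nonnegative terms.\<close>

lemma sum_le_sum_residues:
  fixes f :: "nat \<Rightarrow> ennreal"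
  assumes m: "0 < m"
  shows "(\<Sum>k=1..n. f k) \<le> (\<Sum>r=1..m. \<Sum>j\<le>n. f (r + j * m))"
proof -
  let ?g = "\<lambda>k. ((k - 1) mod m + 1, (k - 1) div m)"
  have inv: "fst (?g k) + snd (?g k) * m = k" if "1 \<le> k" for k
  proof -
    have "(k - 1) div m * m + (k - 1) mod m = k - 1" by (rule div_mult_mod_eq)
    then show ?thesis using that by simp
  qed
  have inj: "inj_on ?g {1..n}" by (rule inj_on_inverseI[of _ "\<lambda>p. fst p + snd p * m"]) (use inv in auto)
  have sub: "?g ` {1..n} \<subseteq> {1..m} \<times> {..n}"
  proof safe
    fix k assume k: "k \<in> {1..n}"
    have "(k - 1) mod m < m" using m by simp
    then show "(k - 1) mod m + 1 \<in> {1..m}" by simp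
    have "k \<le> n" using k by simp
    then have "k - 1 \<le> n" by linarith
    with div_le_dividend show "(k - 1) div m \<le> n" by (rule order_trans)
  qed
  have "(\<Sum>k=1..n. f k) = (\<Sum>k=1..n. f (fst (?g k) + snd (?g k) * m))" using inv by (intro sum.cong) auto
  also have "\<dots> = (\<Sum>p\<in>?g ` {1..n}. f (fst p + snd p * m))" using inj by (simp add: sum.reindex)
  also have "\<dots> \<le> (\<Sum>p\<in>{1..m} \<times> {..n}. f (fst p + snd p * m))" using sub by (intro sum_mono2) auto
  also have "\<dots> = (\<Sum>r=1..m. \<Sum>j\<le>n. f (r + j * m))" by (simp add: sum.cartesian_product split_beta)
  finally show ?thesis .
qed

context conditioned_levy begin

text \<open>Last-exit decomposition: at most one time of the grid can be the last visit to \<open>(z, z + 1]\<close>,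
  and from there the process escapes with the probability bounded below by \<open>chainG_escape\<close>.\<close>

lemma sum_visits_le:
  assumes s: "0 \<le> s" and r: "0 \<le> r" and z: "1 \<le> z"
  shows "emeasure M {\<omega>\<in>space M. 2 \<le> V s \<omega> \<and> 0 < 1 + infV s \<omega>} * ennreal (W 1) *
      (\<Sum>j\<le>J. emeasure (N 2) {\<omega>\<in>space (N 2). z < Vup 2 (r + real j * s) \<omega> \<and> Vup 2 (r + real j * s) \<omega> \<le> z + 1})
      \<le> ennreal (W (z + 1))"
proof -
  interpret U: up_markov M V \<Psi> W N Vup "N 2" "{0<..}" "up_kernel M V W" 2 "Vup 2" by (rule up_markov_pos) simp
  let ?Y = "\<lambda>j. Vup 2 (r + real j * s)"
  let ?A = "\<lambda>j. {\<omega>\<in>space (N 2). z < ?Y j \<omega> \<and> ?Y j \<omega> \<le> z + 1}"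
  let ?D = "\<lambda>j. {\<omega>\<in>space (N 2). z < ?Y j \<omega> \<and> ?Y j \<omega> \<le> z + 1 \<and> (\<forall>i\<in>{1..J - j}. z + 1 < ?Y (j + i) \<omega>)}"
  let ?c = "emeasure M {\<omega>\<in>space M. 2 \<le> V s \<omega> \<and> 0 < 1 + infV s \<omega>} * ennreal (W 1)"
  have rj: "0 \<le> r + real j * s" for j using r s by simp
  note [measurable] = U.Y_measurable[OF rj]
  have Am[measurable]: "?A j \<in> sets (N 2)" for j by measurable
  have Dm[measurable]: "?D j \<in> sets (N 2)" for j by measurable
  have D: "?c * emeasure (N 2) (?A j) \<le> ennreal (W (z + 1)) * emeasure (N 2) (?D j)" for j
  proof -
    let ?Z = "\<lambda>\<omega>. indicat_real {z<..z+1} (?Y j \<omega>)"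
    have Z: "?Z \<in> borel_measurable (natural_sigma (N 2) (Vup 2) (r + real j * s))"
      using measurable_natural_sigma[of "r + real j * s" "r + real j * s" "Vup 2" "N 2"] rj by measurable
    have "emeasure (N 2) (?D j) = (\<integral>\<^sup>+\<omega>. indicator (?D j) \<omega> \<partial>N 2)" by (rule nn_integral_indicator[symmetric]) measurable
    also have "\<dots> = (\<integral>\<^sup>+\<omega>. ennreal (?Z \<omega>) * (\<Prod>i=1..J - j. ennreal (indicator {z+1<..} (Vup 2 ((r + real j * s) + real i * s) \<omega>))) \<partial>N 2)"
    proof (intro nn_integral_cong)
      fix \<omega> assume w: "\<omega> \<in> space (N 2)"
      have e: "r + real (j + i) * s = (r + real j * s) + real i * s" for i by (simp add: algebra_simps)
      show "indicator (?D j) \<omega> = ennreal (?Z \<omega>) * (\<Prod>i=1..J - j. ennreal (indicator {z+1<..} (Vup 2 ((r + real j * s) + real i * s) \<omega>)))"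
        unfolding prod_indicator_ennreal[OF finite_atLeastAtMost] e[symmetric] using w by (auto simp: indicator_def)
    qed
    also have "\<dots> = (\<integral>\<^sup>+\<omega>. ennreal (?Z \<omega>) * chainG (indicator {z+1<..}) s (J - j) (?Y j \<omega>) \<partial>N 2)"
      by (rule U.nn_integral_chain[OF s _ _ rj Z]) (use z in \<open>auto simp: indicator_def\<close>)
    finally have eq: "emeasure (N 2) (?D j) = (\<integral>\<^sup>+\<omega>. ennreal (?Z \<omega>) * chainG (indicator {z+1<..}) s (J - j) (?Y j \<omega>) \<partial>N 2)" .
    have Gm[measurable]: "chainG (indicator {z+1<..}) s (J - j) \<in> borel_measurable borel"
      by (rule chainG_measurable[OF s]) measurable
    have "?c * emeasure (N 2) (?A j) = (\<integral>\<^sup>+\<omega>. ?c * indicator (?A j) \<omega> \<partial>N 2)"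
      by (rule nn_integral_cmult_indicator[symmetric]) measurable
    also have "\<dots> \<le> (\<integral>\<^sup>+\<omega>. ennreal (W (z + 1)) * (ennreal (?Z \<omega>) * chainG (indicator {z+1<..}) s (J - j) (?Y j \<omega>)) \<partial>N 2)"
    proof (intro nn_integral_mono)
      fix \<omega>
      show "?c * indicator (?A j) \<omega> \<le> ennreal (W (z + 1)) * (ennreal (?Z \<omega>) * chainG (indicator {z+1<..}) s (J - j) (?Y j \<omega>))"
      proof (cases "\<omega> \<in> ?A j")
        case True
        then have y: "z < ?Y j \<omega>" "?Y j \<omega> \<le> z + 1" by auto
        have "?c \<le> ennreal (W (?Y j \<omega>)) * chainG (indicator {z+1<..}) s (J - j) (?Y j \<omega>)"
          by (rule chainG_escape[OF s z y])
        also have "\<dots> \<le> ennreal (W (z + 1)) * chainG (indicator {z+1<..}) s (J - j) (?Y j \<omega>)"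
          using y z by (intro mult_right_mono ennreal_leI W_mono) auto
        finally show ?thesis using True by simp
      qed simp
    qed
    also have "\<dots> = ennreal (W (z + 1)) * emeasure (N 2) (?D j)"
      unfolding eq by (rule nn_integral_cmult) measurable
    finally show ?thesis .
  qed
  have disj: "disjoint_family_on ?D {..J}"
  proof -
    have "\<omega> \<notin> ?D i" if "\<omega> \<in> ?D j" "j < i" "i \<le> J" for i j \<omega>
    proof
      assume wi: "\<omega> \<in> ?D i"
      have "i - j \<in> {1..J - j}" using that by auto
      then have "z + 1 < ?Y (j + (i - j)) \<omega>" using that(1) by blast
      then show False using wi that by simp
    qed
    then show ?thesis unfolding disjoint_family_on_def by (metis (no_types, lifting) atMost_iff disjoint_iff linorder_neqE_nat)
  qed
  have "?c * (\<Sum>j\<le>J. emeasure (N 2) (?A j)) \<le> ennreal (W (z + 1)) * (\<Sum>j\<le>J. emeasure (N 2) (?D j))"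
    unfolding sum_distrib_left by (intro sum_mono D)
  also have "(\<Sum>j\<le>J. emeasure (N 2) (?D j)) = emeasure (N 2) (\<Union>j\<le>J. ?D j)"
    by (rule sum_emeasure[OF _ disj]) (use Dm in blast, simp)
  also have "\<dots> \<le> 1" by (rule U.N.emeasure_le_1)
  finally show ?thesis by (simp add: mult_left_mono)
qed

lemma nn_integral_Vup:
  assumes x: "0 < x" and t: "0 \<le> t" and g: "g \<in> borel_measurable borel"
  shows "(\<integral>\<^sup>+\<omega>. g (Vup x t \<omega>) \<partial>N x) = Kop t g x"
proof -
  interpret U: up_markov M V \<Psi> W N Vup "N x" "{0<..}" "up_kernel M V W" x "Vup x" by (rule up_markov_pos[OF x])
  have "(\<integral>\<^sup>+\<omega>. ennreal 1 * g (Vup x (0 + t) \<omega>) \<partial>N x) = (\<integral>\<^sup>+\<omega>. ennreal 1 * Kop t g (Vup x 0 \<omega>) \<partial>N x)"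
    using U.Y_in[OF order_refl] by (intro U.nn_integral_step[OF order_refl t g]) force+
  also have "\<dots> = (\<integral>\<^sup>+\<omega>. Kop t g x \<partial>N x)"
    using U.Y_0 by (intro nn_integral_cong_AE) auto
  finally show ?thesis by (simp add: U.N.emeasure_space_1)
qed

text \<open>Here \<open>V\<close> does not drift to minus infinity, so \<open>kappa\<close> is
  \<open>0\<close> and \<open>W\<close> grows at most like \<open>exp (x / 2)\<close>. On a grid of
  mesh \<open>s\<close> the expected number of visits to \<open>(i, i + 1]\<close> is at most a
  multiple of \<open>W (i + 1)\<close>, and weighted by \<open>exp (- i)\<close> these numbers are
  summable.\<close>

lemma occupation_bound_pos:
  assumes P: "\<And>l. 0 < l \<Longrightarrow> 0 < \<Psi> l"
  shows "\<exists>s>0. \<exists>J. \<forall>m>0. \<forall>n. (\<Sum>k=1..n. ennreal (s / real m) * Kop (real k * (s / real m)) (\<lambda>z. ennreal (exp (- z))) 1) \<le> ennreal J"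
proof -
  obtain s where s: "0 < s" "0 < emeasure M {\<omega>\<in>space M. 2 \<le> V s \<omega> \<and> 0 < 1 + infV s \<omega>}"
    using escape_prob_pos by blast
  define p where "p = prob {\<omega>\<in>space M. 2 \<le> V s \<omega> \<and> 0 < 1 + infV s \<omega>}"
  define c where "c = p * W 1"
  have p: "0 < p" using s(2) by (simp add: p_def emeasure_eq_measure)
  have c: "0 < c" using p W_pos[of 1] by (simp add: c_def)
  have ec: "emeasure M {\<omega>\<in>space M. 2 \<le> V s \<omega> \<and> 0 < 1 + infV s \<omega>} * ennreal (W 1) = ennreal c"
    using p by (simp add: c_def p_def emeasure_eq_measure ennreal_mult')
  have "kappa M V \<Psi> = 0" using not_drift_to_bot_if_Psi_pos[OF P] by (simp add: kappa_def)
  define C where "C = exp (1/2) / \<Psi> (1/2)"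
  have C: "0 \<le> C" using P[of "1/2"] by (simp add: C_def)
  have Wle: "W x \<le> C * exp (1/2 * x)" if "0 \<le> x" for x
    unfolding C_def using P[of "1/2"] that \<open>kappa M V \<Psi> = 0\<close> by (intro W_le_exp) auto
  let ?f = "\<lambda>z. ennreal (exp (- z))" and ?f' = "\<lambda>z. ennreal (exp (- z)) * indicator {1<..} z"
  let ?A = "\<lambda>z t. {\<omega>\<in>space (N 2). z < Vup 2 t \<omega> \<and> Vup 2 t \<omega> \<le> z + 1}"
  let ?b = "\<lambda>i. exp (- real (Suc i)) * (W (real (Suc i) + 1) / c)"
  interpret U: up_markov M V \<Psi> W N Vup "N 2" "{0<..}" "up_kernel M V W" 2 "Vup 2" by (rule up_markov_pos) simp
  have b0: "0 \<le> ?b i" for i using c W_nonneg[of "real (Suc i) + 1"] by simp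
  have b_le: "?b i \<le> C / c * exp (1/2) * exp (- (1/2)) ^ i" for i
  proof -
    have "?b i \<le> exp (- real (Suc i)) * (C * exp (1/2 * (real (Suc i) + 1)) / c)"
      using c by (intro mult_left_mono divide_right_mono Wle) auto
    also have "\<dots> = C / c * (exp (- real (Suc i)) * exp (1/2 * (real (Suc i) + 1)))" by simp
    also have "exp (- real (Suc i)) * exp (1/2 * (real (Suc i) + 1)) = exp (- (1/2) * real i)"
      by (simp add: mult_exp_exp algebra_simps)
    also have "\<dots> = exp (- (1/2)) ^ i" by (simp add: exp_of_nat_mult[symmetric] mult.commute)
    also have "C / c * \<dots> \<le> C / c * exp (1/2) * \<dots>"
    proof (rule mult_right_mono)
      have "C / c * 1 \<le> C / c * exp (1/2)" using C c by (intro mult_left_mono) auto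
      then show "C / c \<le> C / c * exp (1/2)" by simp
    qed simp
    finally show ?thesis .
  qed
  have summ: "summable ?b"
  proof (rule summable_comparison_test')
    show "summable (\<lambda>i. C / c * exp (1/2) * exp (- (1/2::real)) ^ i)" by (intro summable_mult summable_geometric) simp
    show "norm (?b i) \<le> C / c * exp (1/2) * exp (- (1/2)) ^ i" if "0 \<le> i" for i using b_le[of i] b0[of i] by simp
  qed
  define B where "B = (\<Sum>i. ?b i)"
  have visits: "(\<Sum>j\<le>J. Kop (r + real j * s) ?f' 2) \<le> ennreal B" if r: "0 \<le> r" for r J
  proof -
    have rj: "0 \<le> r + real j * s" for j using r s by simp
    note [measurable] = U.Y_measurable[OF rj]
    have "(\<Sum>j\<le>J. Kop (r + real j * s) ?f' 2) = (\<Sum>j\<le>J. \<integral>\<^sup>+\<omega>. ?f' (Vup 2 (r + real j * s) \<omega>) \<partial>N 2)"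
      using rj by (intro sum.cong nn_integral_Vup[symmetric]) auto
    also have "\<dots> \<le> (\<Sum>j\<le>J. \<integral>\<^sup>+\<omega>. (\<Sum>i. ennreal (exp (- real (Suc i))) * indicator (?A (real (Suc i)) (r + real j * s)) \<omega>) \<partial>N 2)"
    proof (intro sum_mono nn_integral_mono)
      fix j \<omega> assume w: "\<omega> \<in> space (N 2)"
      show "?f' (Vup 2 (r + real j * s) \<omega>) \<le> (\<Sum>i. ennreal (exp (- real (Suc i))) * indicator (?A (real (Suc i)) (r + real j * s)) \<omega>)"
        using exp_shell_decomposition[of "Vup 2 (r + real j * s) \<omega>"] w by (simp add: indicator_def del: of_nat_Suc)
    qed
    also have "\<dots> = (\<Sum>j\<le>J. \<Sum>i. ennreal (exp (- real (Suc i))) * emeasure (N 2) (?A (real (Suc i)) (r + real j * s)))"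
    proof (intro sum.cong refl)
      fix j
      have Am: "?A z (r + real j * s) \<in> sets (N 2)" for z by measurable
      show "(\<integral>\<^sup>+\<omega>. (\<Sum>i. ennreal (exp (- real (Suc i))) * indicator (?A (real (Suc i)) (r + real j * s)) \<omega>) \<partial>N 2)
        = (\<Sum>i. ennreal (exp (- real (Suc i))) * emeasure (N 2) (?A (real (Suc i)) (r + real j * s)))"
        using Am by (subst nn_integral_suminf) (auto simp: nn_integral_cmult_indicator)
    qed
    also have "\<dots> = (\<Sum>i. \<Sum>j\<le>J. ennreal (exp (- real (Suc i))) * emeasure (N 2) (?A (real (Suc i)) (r + real j * s)))"
      by (rule suminf_sum[symmetric]) simp
    also have "\<dots> \<le> (\<Sum>i. ennreal (?b i))"
    proof (intro suminf_le allI)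
      fix i
      let ?z = "real (Suc i)"
      let ?S = "\<Sum>j\<le>J. emeasure (N 2) (?A ?z (r + real j * s))"
      have "ennreal c * ?S \<le> ennreal (W (?z + 1))"
        using sum_visits_le[OF less_imp_le[OF s(1)] r, of ?z J] ec by simp
      then have "ennreal (1 / c) * (ennreal c * ?S) \<le> ennreal (1 / c) * ennreal (W (?z + 1))" by (rule mult_left_mono) simp
      moreover have "ennreal (1 / c) * (ennreal c * ?S) = ?S"
        using c by (simp add: mult.assoc[symmetric] ennreal_mult'[symmetric])
      moreover have "ennreal (1 / c) * ennreal (W (?z + 1)) = ennreal (W (?z + 1) / c)"
        using c by (simp add: ennreal_mult'[symmetric])
      ultimately have "?S \<le> ennreal (W (?z + 1) / c)" by simp
      then have "ennreal (exp (- ?z)) * ?S \<le> ennreal (exp (- ?z)) * ennreal (W (?z + 1) / c)" by (rule mult_left_mono) simp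
      then show "(\<Sum>j\<le>J. ennreal (exp (- ?z)) * emeasure (N 2) (?A ?z (r + real j * s))) \<le> ennreal (?b i)"
        unfolding sum_distrib_left[symmetric] by (subst ennreal_mult') auto
    qed auto
    also have "\<dots> = ennreal B" unfolding B_def using b0 summ by (intro suminf_ennreal2) auto
    finally show ?thesis .
  qed
  \<comment> \<open>Raising the start from \<open>1\<close> to \<open>2\<close> keeps surviving
    paths above \<open>1\<close>, where the shells apply; it changes \<open>exp (- z)\<close> by the
    factor \<open>exp 1\<close>.\<close>
  have comp: "Kop t ?f 1 \<le> ennreal (exp 1 * W 2 / W 1) * Kop t ?f' 2" if t: "0 \<le> t" for t
  proof -
    note [measurable] = V_measurable[OF t] infV_measurable[OF t]
    have "Q t (\<lambda>z. Wp z * ?f z) 1 \<le> (\<integral>\<^sup>+\<omega>. ennreal (exp 1) * (Wp (2 + V t \<omega>) * ?f' (2 + V t \<omega>) * indicator {0<..} (2 + infV t \<omega>)) \<partial>M)"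
      unfolding Q_def
    proof (intro nn_integral_mono)
      fix \<omega> assume w: "\<omega> \<in> space M"
      show "Wp (1 + V t \<omega>) * ?f (1 + V t \<omega>) * indicator {0<..} (1 + infV t \<omega>)
         \<le> ennreal (exp 1) * (Wp (2 + V t \<omega>) * ?f' (2 + V t \<omega>) * indicator {0<..} (2 + infV t \<omega>))"
      proof (cases "0 < 1 + infV t \<omega>")
        case True
        then have p: "0 < 1 + V t \<omega>" using infV_le[OF w t order_refl] by linarith
        have "Wp (1 + V t \<omega>) \<le> Wp (2 + V t \<omega>)" by (rule monoD[OF Wp_mono]) simp
        then have le: "Wp (1 + V t \<omega>) * ?f (1 + V t \<omega>) \<le> Wp (2 + V t \<omega>) * ?f (1 + V t \<omega>)" by (rule mult_right_mono) simp
        have e: "?f (1 + V t \<omega>) = ennreal (exp 1) * ?f (2 + V t \<omega>)"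
          by (simp add: ennreal_mult'[symmetric] mult_exp_exp)
        have "Wp (2 + V t \<omega>) * ?f (1 + V t \<omega>) = ennreal (exp 1) * (Wp (2 + V t \<omega>) * ?f (2 + V t \<omega>))"
          unfolding e by (simp only: mult_ac)
        with le have "Wp (1 + V t \<omega>) * ?f (1 + V t \<omega>) \<le> ennreal (exp 1) * (Wp (2 + V t \<omega>) * ?f (2 + V t \<omega>))" by simp
        then show ?thesis using True p by simp
      qed simp
    qed
    also have "\<dots> = ennreal (exp 1) * Q t (\<lambda>z. Wp z * ?f' z) 2"
      unfolding Q_def by (rule nn_integral_cmult) measurable
    also have "\<dots> = ennreal (exp 1) * (ennreal (W 2) * Kop t ?f' 2)" by (simp add: W_Kop)
    finally have "Kop t ?f 1 \<le> (ennreal (exp 1) * (ennreal (W 2) * Kop t ?f' 2)) / ennreal (W 1)"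
      by (simp add: Kop_def[of t ?f] divide_right_mono_ennreal)
    also have "\<dots> = ennreal (exp 1) * ennreal (W 2) * (1 / ennreal (W 1)) * Kop t ?f' 2"
      by (simp add: ennreal_times_divide mult_ac divide_ennreal_def)
    also have "ennreal (exp 1) * ennreal (W 2) * (1 / ennreal (W 1)) = ennreal (exp 1 * W 2 / W 1)"
    proof -
      have "1 / ennreal (W 1) = ennreal (1 / W 1)" using W_pos[of 1] divide_ennreal[of 1 "W 1"] by simp
      then show ?thesis using W_pos[of 1] W_pos[of 2] by (simp add: ennreal_mult'[symmetric])
    qed
    finally show ?thesis .
  qed
  define D where "D = exp 1 * W 2 / W 1"
  have D: "0 \<le> D" using W_pos[of 1] W_pos[of 2] by (simp add: D_def)
  have B0: "0 \<le> B" unfolding B_def using b0 summ by (intro suminf_nonneg)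
  show ?thesis
  proof (rule exI[of _ s], rule conjI, rule s(1), rule exI[of _ "s * D * B"], intro allI impI)
    fix m n :: nat assume m: "0 < m"
    define h where "h = s / real m"
    have h: "0 < h" using s m by (simp add: h_def)
    have hm: "real m * h = s" using m by (simp add: h_def)
    have "(\<Sum>k=1..n. ennreal h * Kop (real k * h) ?f 1) \<le> (\<Sum>k=1..n. ennreal h * (ennreal D * Kop (real k * h) ?f' 2))"
      unfolding D_def using h by (intro sum_mono mult_left_mono comp) auto
    also have "\<dots> = ennreal h * ennreal D * (\<Sum>k=1..n. Kop (real k * h) ?f' 2)"
      by (simp add: sum_distrib_left mult.assoc)
    also have "\<dots> \<le> ennreal h * ennreal D * (\<Sum>r=1..m. \<Sum>j\<le>n. Kop (real (r + j * m) * h) ?f' 2)"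
      by (intro mult_left_mono sum_le_sum_residues m) simp
    also have "\<dots> = ennreal h * ennreal D * (\<Sum>r=1..m. \<Sum>j\<le>n. Kop (real r * h + real j * s) ?f' 2)"
      by (simp add: hm[symmetric] algebra_simps)
    also have "\<dots> \<le> ennreal h * ennreal D * (\<Sum>r=1..m. ennreal B)"
      using h by (intro mult_left_mono sum_mono visits) auto
    also have "\<dots> = ennreal (s * D * B)"
      using h D B0 by (simp add: ennreal_mult'[symmetric] hm[symmetric] ennreal_of_nat_eq_real_of_nat mult_ac)
    finally show "(\<Sum>k=1..n. ennreal (s / real m) * Kop (real k * (s / real m)) ?f 1) \<le> ennreal (s * D * B)"
      by (simp only: h_def)
  qed
qed

text \<open>The two cases are distinguished by the sign of \<open>\<Psi>\<close>. The meshes have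
  the form \<open>s / m\<close> because counting visits requires a mesh that divides
  \<open>s\<close>.\<close>

lemma occupation_bound:
  obtains s J where "0 < s" "0 \<le> J" "\<And>m n. 0 < m \<Longrightarrow>
    (\<Sum>k=1..n. ennreal (s / real m) * Kop (real k * (s / real m)) (\<lambda>z. ennreal (exp (- z))) 1) \<le> ennreal J"
proof -
  have "\<exists>s>0. \<exists>J. \<forall>m>0. \<forall>n. (\<Sum>k=1..n. ennreal (s / real m) * Kop (real k * (s / real m)) (\<lambda>z. ennreal (exp (- z))) 1) \<le> ennreal J"
  proof (cases "\<forall>l>0. 0 < \<Psi> l")
    case True
    then show ?thesis by (intro occupation_bound_pos) auto
  next
    case False
    then obtain l where "0 < l" "\<Psi> l \<le> 0" by (auto simp: not_less)
    from occupation_bound_neg[OF this] obtain J where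
      J: "\<And>h n. 0 < h \<Longrightarrow> (\<Sum>k=1..n. ennreal h * Kop (real k * h) (\<lambda>z. ennreal (exp (- z))) 1) \<le> ennreal J" by blast
    show ?thesis by (rule exI[of _ 1], intro conjI zero_less_one, rule exI[of _ J], intro allI impI, rule J, simp)
  qed
  then obtain s J where sJ: "0 < s" "\<And>m n. 0 < m \<Longrightarrow>
    (\<Sum>k=1..n. ennreal (s / real m) * Kop (real k * (s / real m)) (\<lambda>z. ennreal (exp (- z))) 1) \<le> ennreal J" by blast
  show thesis
  proof (rule that[of s "max 0 J"])
    fix m n :: nat assume "0 < m"
    from sJ(2)[OF this] show "(\<Sum>k=1..n. ennreal (s / real m) * Kop (real k * (s / real m)) (\<lambda>z. ennreal (exp (- z))) 1) \<le> ennreal (max 0 J)"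
      by (rule order_trans) (simp add: ennreal_leI)
  qed (use sJ in auto)
qed

end

section \<open>From chains to the exponential functional\<close>

lemma right_continuous_measurable:
  fixes g :: "real \<Rightarrow> real"
  assumes g: "\<And>s. s \<ge> 0 \<Longrightarrow> (g \<longlongrightarrow> g s) (at_right s)"
  shows "(\<lambda>s. g s * indicator {0..} s) \<in> borel_measurable borel"
proof (rule borel_measurable_LIMSEQ_real)
  let ?h = "\<lambda>n. 1 / real (Suc n)"
  show "(\<lambda>n. g (of_int \<lceil>s / ?h n\<rceil> * ?h n) * indicator {0..} s) \<longlonglongrightarrow> g s * indicator {0..} s" for s
  proof (cases "0 \<le> s")
    case True
    have "?h \<longlonglongrightarrow> 0" by real_asymp
    then have "(\<lambda>n. g (of_int \<lceil>s / ?h n\<rceil> * ?h n)) \<longlonglongrightarrow> g s"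
      using g[OF True] by (intro tendsto_ceiling_grid) auto
    then show ?thesis using True by simp
  qed simp
  fix n
  have "(\<lambda>s. \<lceil>s / ?h n\<rceil>) \<in> measurable borel (count_space UNIV)" by measurable
  moreover have "(\<lambda>i::int. g (of_int i * ?h n)) \<in> measurable (count_space UNIV) borel" by simp
  ultimately have "(\<lambda>s. g (of_int \<lceil>s / ?h n\<rceil> * ?h n)) \<in> borel_measurable borel" by (rule measurable_compose)
  then show "(\<lambda>s. g (of_int \<lceil>s / ?h n\<rceil> * ?h n) * indicator {0..} s) \<in> borel_measurable borel" by measurable
qed

lemma exp_cadlag_right_continuous:
  "cadlag f \<Longrightarrow> 0 \<le> t \<Longrightarrow> 0 \<le> s \<Longrightarrow> ((\<lambda>r. exp (- f (t + r))) \<longlongrightarrow> exp (- f (t + s))) (at_right s)"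
proof -
  assume f: "cadlag f" and ts: "0 \<le> t" "0 \<le> s"
  have "filterlim (\<lambda>r. t + r) (at_right (t + s)) (at_right s)"
    by (auto simp: filterlim_at eventually_at_filter intro!: tendsto_eq_intros)
  moreover have "(f \<longlongrightarrow> f (t + s)) (at_right (t + s))" using f ts by (auto simp: cadlag_def)
  ultimately have "((\<lambda>r. f (t + r)) \<longlongrightarrow> f (t + s)) (at_right s)" by (rule filterlim_compose[rotated])
  then show ?thesis by (intro tendsto_intros)
qed

lemma exp_integral_measurable:
  assumes f: "cadlag f" and t: "0 \<le> t"
  shows "(\<lambda>r. ennreal (exp (- f (t + r))) * indicator {0..} r) \<in> borel_measurable borel"
proof -
  have "(\<lambda>r. exp (- f (t + r)) * indicator {0..} r) \<in> borel_measurable borel"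
    using exp_cadlag_right_continuous[OF f t] by (intro right_continuous_measurable)
  then have "(\<lambda>r. ennreal (exp (- f (t + r)) * indicator {0..} r)) \<in> borel_measurable borel" by measurable
  moreover have "ennreal (exp (- f (t + r)) * indicator {0..} r) = ennreal (exp (- f (t + r))) * indicator {0..} r" for r
    by (auto simp: indicator_def)
  ultimately show ?thesis by simp
qed

lemma exp_integral_eq_SUP:
  assumes f: "cadlag f" and t: "0 \<le> t" and s: "0 < s"
  shows "(\<integral>\<^sup>+r\<in>{0..}. ennreal (exp (- f (t + r))) \<partial>lborel) = (SUP i. \<integral>\<^sup>+r\<in>{0..s * real (Suc i)}. ennreal (exp (- f (t + r))) \<partial>lborel)"
proof -
  let ?F = "\<lambda>i r. ennreal (exp (- f (t + r))) * indicator {0..s * real (Suc i)} r"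
  have meas: "?F i \<in> borel_measurable lborel" for i
  proof -
    have eq: "?F i r = ennreal (exp (- f (t + r))) * indicator {0..} r * indicator {0..s * real (Suc i)} r" for r
      by (auto simp: indicator_def)
    show ?thesis using exp_integral_measurable[OF f t] unfolding eq by measurable
  qed
  have inc: "incseq ?F"
  proof (intro incseq_SucI le_funI mult_left_mono)
    fix i r
    have "s * real (Suc i) \<le> s * real (Suc (Suc i))" using s by (intro mult_left_mono) auto
    then show "(indicator {0..s * real (Suc i)} r :: ennreal) \<le> indicator {0..s * real (Suc (Suc i))} r"
      by (auto simp: indicator_def simp del: of_nat_Suc)
  qed simp
  have sup: "(SUP i. ?F i r) = ennreal (exp (- f (t + r))) * indicator {0..} r" for r
  proof (rule antisym)
    show "(SUP i. ?F i r) \<le> ennreal (exp (- f (t + r))) * indicator {0..} r"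
      by (intro SUP_least mult_left_mono) (auto simp: indicator_def)
    obtain i where "r / s < real i" using reals_Archimedean2 by blast
    then have "r < s * real i" using s by (simp add: field_simps)
    also have "\<dots> \<le> s * real (Suc i)" using s by simp
    finally show "ennreal (exp (- f (t + r))) * indicator {0..} r \<le> (SUP i. ?F i r)"
      by (intro SUP_upper2[of i]) (auto simp: indicator_def simp del: of_nat_Suc)
  qed
  have "(\<integral>\<^sup>+r\<in>{0..}. ennreal (exp (- f (t + r))) \<partial>lborel) = (\<integral>\<^sup>+r. (SUP i. ?F i r) \<partial>lborel)" by (simp only: sup)
  also have "\<dots> = (SUP i. \<integral>\<^sup>+r. ?F i r \<partial>lborel)" using inc meas by (rule nn_integral_monotone_convergence_SUP)
  finally show ?thesis .
qed

lemma exp_integral_le_shift: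
  assumes f: "cadlag f" and pos: "\<And>r. 0 \<le> r \<Longrightarrow> 0 \<le> f r" and t: "0 \<le> t"
  shows "(\<integral>\<^sup>+r\<in>{0..}. ennreal (exp (- f r)) \<partial>lborel) \<le> ennreal t + (\<integral>\<^sup>+r\<in>{0..}. ennreal (exp (- f (t + r))) \<partial>lborel)"
proof -
  have m0: "(\<lambda>r. ennreal (exp (- f r)) * indicator {0..} r) \<in> borel_measurable borel"
    using exp_integral_measurable[OF f, of 0] by simp
  have m: "(\<lambda>r. ennreal (exp (- f r)) * indicator {t..} r) \<in> borel_measurable borel"
  proof -
    have "ennreal (exp (- f r)) * indicator {t..} r = ennreal (exp (- f r)) * indicator {0..} r * indicator {t..} r" for r
      using t by (auto simp: indicator_def)
    then show ?thesis using m0 by simp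
  qed
  have "(\<integral>\<^sup>+r\<in>{0..}. ennreal (exp (- f r)) \<partial>lborel) \<le> (\<integral>\<^sup>+r. indicator {0..t} r + ennreal (exp (- f r)) * indicator {t..} r \<partial>lborel)"
    using pos by (intro nn_integral_mono) (auto simp: indicator_def)
  also have "\<dots> = (\<integral>\<^sup>+r. indicator {0..t} r \<partial>lborel) + (\<integral>\<^sup>+r. ennreal (exp (- f r)) * indicator {t..} r \<partial>lborel)"
    using m by (intro nn_integral_add) auto
  also have "(\<integral>\<^sup>+r. indicator {0..t} r \<partial>lborel) = ennreal t" using t by simp
  also have "(\<integral>\<^sup>+r. ennreal (exp (- f r)) * indicator {t..} r \<partial>lborel)
     = (\<integral>\<^sup>+r. ennreal (exp (- f (t + r))) * indicator {t..} (t + r) \<partial>lborel)"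
    using nn_integral_real_affine[OF m, of 1 t] by simp
  also have "(\<lambda>r. ennreal (exp (- f (t + r))) * indicator {t..} (t + r)) = (\<lambda>r. ennreal (exp (- f (t + r))) * indicator {0..} r)"
    by (auto simp: indicator_def fun_eq_iff)
  finally show ?thesis .
qed

context conditioned_levy begin

text \<open>If the path stays at most \<open>2\<close> on \<open>(0, 16 * x)\<close>, the functional
  is at least \<open>16 * x * exp (- 2)\<close>, which exceeds \<open>x\<close> because
  \<open>exp 2 \<le> 9\<close>. The level \<open>2\<close> is \<open>L + 1\<close> with
  \<open>L = 1\<close>, and right continuity passes from the dyadic grids to all times.\<close>

lemma prob_exp_functional_le:
  assumes x: "0 < x" and l: "0 \<le> l" "0 \<le> \<Psi> l"
  shows "measure (N 0) {\<omega>\<in>space (N 0). exp_functional (Vup 0) \<omega> \<le> ennreal x} \<le> hit_bound l 1 (16 * x)"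
proof -
  interpret Z: up_markov M V \<Psi> W N Vup "N 0" "{0..}" P0 0 "Vup 0" by (rule up_markov_0)
  define t where "t = 16 * x"
  have t: "0 < t" using x by (simp add: t_def)
  let ?t = "\<lambda>n k. real k * (t / real (2 ^ n))"
  let ?H = "\<lambda>n. {\<omega>\<in>space (N 0). \<exists>k\<in>{1..2 ^ n}. 1 + 1 \<le> Vup 0 (?t n k) \<omega>}"
  have Hm: "?H n \<in> sets (N 0)" for n
  proof -
    have [measurable]: "Vup 0 (?t n k) \<in> borel_measurable (N 0)" for k using t by (intro Z.Y_measurable) auto
    show ?thesis by measurable
  qed
  have inc: "incseq ?H"
  proof (rule incseq_SucI, safe)
    fix n \<omega> k assume k: "k \<in> {1..2 ^ n}" "1 + 1 \<le> Vup 0 (?t n k) \<omega>"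
    have "2 * k \<in> {1..2 ^ Suc n}" using k by auto
    moreover have "?t (Suc n) (2 * k) = ?t n k" by simp
    ultimately show "\<exists>k\<in>{1..2 ^ Suc n}. 1 + 1 \<le> Vup 0 (?t (Suc n) k) \<omega>" using k(2) by metis
  qed
  have "{\<omega>\<in>space (N 0). exp_functional (Vup 0) \<omega> \<le> ennreal x} \<subseteq> (\<Union>n. ?H n)"
  proof (rule subsetI, rule ccontr)
    fix \<omega> assume w: "\<omega> \<in> {\<omega>\<in>space (N 0). exp_functional (Vup 0) \<omega> \<le> ennreal x}" and nH: "\<omega> \<notin> (\<Union>n. ?H n)"
    have sp: "\<omega> \<in> space (N 0)" using w by simp
    have lt: "Vup 0 (?t n k) \<omega> < 2" if "k \<in> {1..2 ^ n}" for n k using nH sp that by (auto simp: not_le)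
    have le2: "Vup 0 s \<omega> \<le> 2" if s: "0 < s" "s < t" for s
    proof -
      let ?h = "\<lambda>n. t / real (2 ^ n)"
      have "?h \<longlonglongrightarrow> 0" by real_asymp
      then have "(\<lambda>n. Vup 0 (of_int \<lceil>s / ?h n\<rceil> * ?h n) \<omega>) \<longlonglongrightarrow> Vup 0 s \<omega>"
        using t s Z.Y_cadlag[OF sp] by (intro tendsto_ceiling_grid) (auto simp: cadlag_def)
      moreover have "Vup 0 (of_int \<lceil>s / ?h n\<rceil> * ?h n) \<omega> \<le> 2" for n
      proof -
        let ?k = "nat \<lceil>s / ?h n\<rceil>"
        have p: "0 < s / ?h n" using s t by simp
        have "s / ?h n \<le> 2 ^ n" using s t by (simp add: field_simps)
        then have "real ?k = of_int \<lceil>s / ?h n\<rceil>" "?k \<in> {1..2 ^ n}"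
          using p by (auto simp: nat_le_iff ceiling_le_iff Suc_le_eq)
        then show ?thesis using lt[of ?k n] by simp
      qed
      ultimately show ?thesis by (intro LIMSEQ_le_const2) auto
    qed
    have "ennreal (exp (- 2) * t) = (\<integral>\<^sup>+s. ennreal (exp (- 2)) * indicator {0<..<t} s \<partial>lborel)"
      using t by (subst nn_integral_cmult_indicator) (auto simp: ennreal_mult')
    also have "\<dots> \<le> exp_functional (Vup 0) \<omega>"
      unfolding exp_functional_def using le2 by (intro nn_integral_mono) (auto simp: indicator_def intro!: ennreal_leI)
    also have "\<dots> \<le> ennreal x" using w by simp
    finally have "exp (- 2) * t \<le> x" using x by simp
    moreover have "exp 2 \<le> (9::real)"
    proof -
      have "exp 2 = exp 1 * exp (1::real)" by (simp add: mult_exp_exp)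
      also have "\<dots> \<le> 3 * 3" by (intro mult_mono exp_le) auto
      finally show ?thesis by simp
    qed
    ultimately show False using x by (simp add: t_def exp_minus field_simps)
  qed
  then have "measure (N 0) {\<omega>\<in>space (N 0). exp_functional (Vup 0) \<omega> \<le> ennreal x} \<le> measure (N 0) (\<Union>n. ?H n)"
    using Hm by (intro Z.N.finite_measure_mono) auto
  also have "\<dots> \<le> hit_bound l 1 t"
  proof (rule LIMSEQ_le_const2)
    show "(\<lambda>n. measure (N 0) (?H n)) \<longlonglongrightarrow> measure (N 0) (\<Union>n. ?H n)"
      using Hm inc by (intro Z.N.finite_Lim_measure_incseq) auto
    show "\<exists>n0. \<forall>n\<ge>n0. measure (N 0) (?H n) \<le> hit_bound l 1 t"
      using hit_grid_0[OF t l order_refl, of "2 ^ _"] by auto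
  qed
  finally show ?thesis by (simp add: t_def)
qed

end

section \<open>Smallness of the functional after a given height is reached\<close>

lemma one_le_prod_exp_plus_sum:
  assumes "\<And>k. k \<in> A \<Longrightarrow> 0 \<le> a k" "finite A"
  shows "1 \<le> (\<Prod>k\<in>A. ennreal (exp (- a k))) + (\<Sum>k\<in>A. ennreal (a k))"
proof -
  have "1 + - (\<Sum>k\<in>A. a k) \<le> exp (- (\<Sum>k\<in>A. a k))" by (rule exp_ge_add_one_self)
  then have "1 \<le> exp (- (\<Sum>k\<in>A. a k)) + (\<Sum>k\<in>A. a k)" by simp
  also have "exp (- (\<Sum>k\<in>A. a k)) = (\<Prod>k\<in>A. exp (- a k))" using assms(2) by (simp add: exp_sum sum_negf[symmetric])
  finally have "1 \<le> ennreal ((\<Prod>k\<in>A. exp (- a k)) + (\<Sum>k\<in>A. a k))" by (simp only: ennreal_ge_1)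
  also have "\<dots> = (\<Prod>k\<in>A. ennreal (exp (- a k))) + (\<Sum>k\<in>A. ennreal (a k))"
    using assms by (simp add: ennreal_plus[OF prod_nonneg sum_nonneg] prod_ennreal)
  finally show ?thesis .
qed

context conditioned_levy begin

text \<open>By \<open>chainG_domination\<close> the start \<open>y\<close> is replaced by
  \<open>1\<close> with the path raised by \<open>y - 1\<close>, at the cost
  \<open>W 1 / W K\<close>. Along that path \<open>q\<close> times the Riemann sum has expectation
  at most \<open>q * exp (1 - b) * J \<le> 1/2\<close>, so \<open>exp (- a) \<ge> 1 - a\<close>
  leaves a Laplace transform of at least \<open>1/2\<close>.\<close>

lemma chainG_exp_ge:
  assumes s: "0 < s" and J: "0 \<le> J" and m: "0 < m"
    and occ: "\<And>n. (\<Sum>k=1..n. ennreal (s / real m) * Kop (real k * (s / real m)) (\<lambda>z. ennreal (exp (- z))) 1) \<le> ennreal J"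
    and b: "1 < b" "b \<le> y" "y \<le> K" and q: "0 \<le> q" "q * exp (1 - b) * J \<le> 1/2"
  shows "ennreal (W 1 / (2 * W K)) \<le> chainG (\<lambda>z. exp (- (q * (s / real m) * exp (- z)))) (s / real m) n y"
proof -
  define h where "h = s / real m"
  have h: "0 < h" using s m by (simp add: h_def)
  let ?f = "\<lambda>z. ennreal (exp (- z))"
  let ?\<psi> = "\<lambda>z. exp (- (q * h * exp (- z)))"
  let ?\<psi>' = "\<lambda>z. ?\<psi> (y - 1 + z)"
  have psi01: "0 \<le> ?\<psi> z \<and> ?\<psi> z \<le> 1" for z using q h by simp
  interpret U: up_markov M V \<Psi> W N Vup "N 1" "{0<..}" "up_kernel M V W" 1 "Vup 1" by (rule up_markov_pos) simp
  have kh: "0 \<le> real k * h" for k using h by simp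
  note [measurable] = U.Y_measurable[OF kh]
  let ?a = "\<lambda>k \<omega>. q * h * exp (- (y - 1 + Vup 1 (real k * h) \<omega>))"
  have "1 = (\<integral>\<^sup>+\<omega>. 1 \<partial>N 1)" by (simp add: U.N.emeasure_space_1)
  also have "\<dots> \<le> (\<integral>\<^sup>+\<omega>. (\<Prod>k=1..n. ennreal (exp (- ?a k \<omega>))) + (\<Sum>k=1..n. ennreal (?a k \<omega>)) \<partial>N 1)"
    using q h by (intro nn_integral_mono one_le_prod_exp_plus_sum) auto
  also have "\<dots> = (\<integral>\<^sup>+\<omega>. (\<Prod>k=1..n. ennreal (?\<psi>' (Vup 1 (real k * h) \<omega>))) \<partial>N 1) + (\<integral>\<^sup>+\<omega>. (\<Sum>k=1..n. ennreal (?a k \<omega>)) \<partial>N 1)"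
    by (rule nn_integral_add) measurable
  also have "(\<integral>\<^sup>+\<omega>. (\<Prod>k=1..n. ennreal (?\<psi>' (Vup 1 (real k * h) \<omega>))) \<partial>N 1) = chainG ?\<psi>' h n 1"
    by (rule chainG_eq_expectation[OF zero_less_one less_imp_le[OF h] _ psi01]) measurable
  also have "(\<integral>\<^sup>+\<omega>. (\<Sum>k=1..n. ennreal (?a k \<omega>)) \<partial>N 1) = (\<Sum>k=1..n. \<integral>\<^sup>+\<omega>. ennreal (?a k \<omega>) \<partial>N 1)"
    by (rule nn_integral_sum) measurable
  also have "\<dots> = (\<Sum>k=1..n. ennreal (q * exp (1 - y)) * (ennreal h * Kop (real k * h) ?f 1))"
  proof (intro sum.cong refl)
    fix k
    have eq: "ennreal (?a k \<omega>) = ennreal (q * exp (1 - y) * h) * ?f (Vup 1 (real k * h) \<omega>)" for \<omega>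
    proof -
      have "exp (- (y - 1 + Vup 1 (real k * h) \<omega>)) = exp (1 - y) * exp (- Vup 1 (real k * h) \<omega>)"
        by (simp add: mult_exp_exp)
      then show ?thesis using q h by (simp add: ennreal_mult'[symmetric] mult_ac)
    qed
    have "(\<integral>\<^sup>+\<omega>. ennreal (?a k \<omega>) \<partial>N 1) = ennreal (q * exp (1 - y) * h) * (\<integral>\<^sup>+\<omega>. ?f (Vup 1 (real k * h) \<omega>) \<partial>N 1)"
      unfolding eq by (rule nn_integral_cmult) measurable
    also have "(\<integral>\<^sup>+\<omega>. ?f (Vup 1 (real k * h) \<omega>) \<partial>N 1) = Kop (real k * h) ?f 1"
      using h by (intro nn_integral_Vup) auto
    finally show "(\<integral>\<^sup>+\<omega>. ennreal (?a k \<omega>) \<partial>N 1) = ennreal (q * exp (1 - y)) * (ennreal h * Kop (real k * h) ?f 1)"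
      using q h by (simp add: ennreal_mult' mult.assoc)
  qed
  also have "\<dots> = ennreal (q * exp (1 - y)) * (\<Sum>k=1..n. ennreal h * Kop (real k * h) ?f 1)"
    by (rule sum_distrib_left[symmetric])
  finally have "1 \<le> chainG ?\<psi>' h n 1 + ennreal (q * exp (1 - y)) * (\<Sum>k=1..n. ennreal h * Kop (real k * h) ?f 1)" .
  moreover have "ennreal (q * exp (1 - y)) * (\<Sum>k=1..n. ennreal h * Kop (real k * h) ?f 1) \<le> ennreal (1/2)"
  proof -
    have "ennreal (q * exp (1 - y)) * (\<Sum>k=1..n. ennreal h * Kop (real k * h) ?f 1) \<le> ennreal (q * exp (1 - b)) * ennreal J"
      using b q occ[of n] by (intro mult_mono ennreal_leI mult_left_mono) (auto simp: h_def)
    also have "\<dots> = ennreal (q * exp (1 - b) * J)" using q J by (simp add: ennreal_mult')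
    also have "\<dots> \<le> ennreal (1/2)" using q by (intro ennreal_leI)
    finally show ?thesis .
  qed
  ultimately have "1 \<le> chainG ?\<psi>' h n 1 + ennreal (1/2)" by (meson add_left_mono order_trans)
  then have half: "ennreal (1/2) \<le> chainG ?\<psi>' h n 1"
  proof (cases "chainG ?\<psi>' h n 1")
    case (real r)
    then have "1 \<le> ennreal (r + 1/2)" using \<open>1 \<le> chainG ?\<psi>' h n 1 + ennreal (1/2)\<close> by simp
    then have "1 \<le> r + 1/2" by (simp only: ennreal_ge_1)
    then have "1/2 \<le> r" by simp
    from ennreal_leI[OF this] show ?thesis by (simp only: real)
  qed simp
  have WK: "0 < W K" "0 < W 1" using b by (auto intro: W_pos)
  have "ennreal (W 1) * ennreal (1/2) \<le> ennreal (W 1) * chainG ?\<psi>' h n 1" by (intro mult_left_mono half) simp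
  also have "\<dots> \<le> ennreal (W y) * chainG ?\<psi> h n y"
    using chainG_domination[of h ?\<psi> "y - 1" y n] h b by simp
  also have "\<dots> \<le> ennreal (W K) * chainG ?\<psi> h n y" using b by (intro mult_right_mono ennreal_leI W_mono) auto
  finally have "ennreal (1 / W K) * (ennreal (W 1) * ennreal (1/2)) \<le> ennreal (1 / W K) * (ennreal (W K) * chainG ?\<psi> h n y)"
    by (rule mult_left_mono) simp
  moreover have "ennreal (1 / W K) * (ennreal (W 1) * ennreal (1/2)) = ennreal (W 1 / (2 * W K))"
  proof -
    have "ennreal (W 1) * ennreal (1/2) = ennreal (W 1 * (1/2))" using WK by (intro ennreal_mult'[symmetric]) simp
    moreover have "ennreal (1 / W K) * ennreal (W 1 * (1/2)) = ennreal (1 / W K * (W 1 * (1/2)))"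
      using WK by (intro ennreal_mult'[symmetric]) simp
    ultimately show ?thesis by (simp add: mult.commute)
  qed
  moreover have "ennreal (1 / W K) * (ennreal (W K) * chainG ?\<psi> h n y) = chainG ?\<psi> h n y"
    using WK by (simp add: mult.assoc[symmetric] ennreal_mult'[symmetric])
  ultimately show ?thesis by (simp only: h_def)
qed

text \<open>The Laplace transform of a Riemann sum is a product over grid points, hence a
  \<open>chainG\<close>; it leads back to probabilities because \<open>exp (- q * I)\<close> is at
  most \<open>exp (- q * u)\<close> unless \<open>I \<le> u\<close>. The mesh is refined on a finite
  horizon before the horizon is sent to infinity. The time before \<open>t\<close> adds at most
  \<open>t\<close>.\<close>

lemma prob_exp_functional_ge:
  assumes s: "0 < s" and J: "0 \<le> J"
    and occ: "\<And>m n. 0 < m \<Longrightarrow> (\<Sum>k=1..n. ennreal (s / real m) * Kop (real k * (s / real m)) (\<lambda>z. ennreal (exp (- z))) 1) \<le> ennreal J"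
    and b: "1 < b" "b \<le> K" and q: "0 \<le> q" "q * exp (1 - b) * J \<le> 1/2" and t: "0 \<le> t" and u: "0 \<le> u"
  shows "W 1 / (2 * W K) * measure (N 0) {\<omega>\<in>space (N 0). b \<le> Vup 0 t \<omega> \<and> Vup 0 t \<omega> \<le> K}
    \<le> measure (N 0) {\<omega>\<in>space (N 0). exp_functional (Vup 0) \<omega> \<le> ennreal (t + u)} + exp (- (q * u))"
proof -
  interpret Z: up_markov M V \<Psi> W N Vup "N 0" "{0..}" P0 0 "Vup 0" by (rule up_markov_0)
  let ?B = "{\<omega>\<in>space (N 0). b \<le> Vup 0 t \<omega> \<and> Vup 0 t \<omega> \<le> K}"
  let ?c = "W 1 / (2 * W K)"
  have c: "0 \<le> ?c" using W_nonneg[of 1] W_nonneg[of K] b by simp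
  let ?Z = "\<lambda>\<omega>. indicat_real {b..K} (Vup 0 t \<omega>)"
  note [measurable] = Z.Y_measurable[OF t]
  have Bm[measurable]: "?B \<in> sets (N 0)" by measurable
  have Zm: "?Z \<in> borel_measurable (natural_sigma (N 0) (Vup 0) t)"
    using measurable_natural_sigma[of t t "Vup 0" "N 0"] t by measurable
  let ?h = "\<lambda>n. s / real (Suc n)"
  define R where "R = (\<lambda>\<tau> i n \<omega>. \<Sum>k=1..Suc i * Suc n. exp (- Vup 0 (\<tau> + real k * ?h n) \<omega>) * ?h n)"
  define I where "I = (\<lambda>\<tau> i \<omega>. \<integral>\<^sup>+r\<in>{0..s * real (Suc i)}. ennreal (exp (- Vup 0 (\<tau> + r) \<omega>)) \<partial>lborel)"
  have h: "0 < ?h n" for n using s by simp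
  have R_meas: "R \<tau> i n \<in> borel_measurable (N 0)" if "0 \<le> \<tau>" for \<tau> i n
  proof -
    have [measurable]: "Vup 0 (\<tau> + real k * ?h n) \<in> borel_measurable (N 0)" for k
      using that s by (intro Z.Y_measurable) auto
    show ?thesis unfolding R_def by measurable
  qed
  have R_tendsto: "(\<lambda>n. ennreal (R \<tau> i n \<omega>)) \<longlonglongrightarrow> I \<tau> i \<omega>" if "0 \<le> \<tau>" "\<omega> \<in> space (N 0)" for \<tau> i \<omega>
  proof -
    have "(\<lambda>n. ennreal (\<Sum>k=1..Suc i * Suc n. exp (- Vup 0 (\<tau> + real k * (s * real (Suc i) / real (Suc i * Suc n))) \<omega>) * (s * real (Suc i) / real (Suc i * Suc n))))
       \<longlonglongrightarrow> I \<tau> i \<omega>"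
      unfolding I_def
    proof (rule riemann_sum_tendsto[where B=1])
      show "filterlim (\<lambda>n. Suc i * Suc n) at_top sequentially"
        by (rule filterlim_subseq) (auto simp: strict_mono_def simp del: mult_Suc mult_Suc_right)
      show "((\<lambda>r. exp (- Vup 0 (\<tau> + r) \<omega>)) \<longlongrightarrow> exp (- Vup 0 (\<tau> + r) \<omega>)) (at_right r)" if "0 \<le> r" for r
        using Z.Y_cadlag[OF \<open>\<omega> \<in> space (N 0)\<close>] \<open>0 \<le> \<tau>\<close> that by (rule exp_cadlag_right_continuous)
      show "0 \<le> exp (- Vup 0 (\<tau> + r) \<omega>) \<and> exp (- Vup 0 (\<tau> + r) \<omega>) \<le> 1" if "0 \<le> r" for r
        using Z.Y_in[of "\<tau> + r" \<omega>] \<open>0 \<le> \<tau>\<close> \<open>\<omega> \<in> space (N 0)\<close> that by simp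
    qed (use s in simp_all)
    moreover have E: "s * real (Suc i) / real (Suc i * Suc n) = ?h n" for n
      unfolding of_nat_mult using s by (simp add: divide_simps del: of_nat_Suc)
    ultimately show ?thesis unfolding R_def E by (simp only:)
  qed
  have I_meas: "I \<tau> i \<in> borel_measurable (N 0)" if "0 \<le> \<tau>" for \<tau> i
  proof (rule borel_measurable_LIMSEQ_order)
    show "(\<lambda>n. ennreal (R \<tau> i n \<omega>)) \<longlonglongrightarrow> I \<tau> i \<omega>" if "\<omega> \<in> space (N 0)" for \<omega>
      by (rule R_tendsto[OF \<open>0 \<le> \<tau>\<close> that])
    show "(\<lambda>\<omega>. ennreal (R \<tau> i n \<omega>)) \<in> borel_measurable (N 0)" for n
      by (intro measurable_compose[OF R_meas[OF that]] measurable_ennreal)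
  qed
  \<comment> \<open>\<open>enn2real\<close> sends infinity to \<open>0\<close>, so the limit inside
    the Laplace weight needs finite values; the finite horizon provides them.\<close>
  have I_fin: "I \<tau> i \<omega> < \<infinity>" if "0 \<le> \<tau>" "\<omega> \<in> space (N 0)" for \<tau> i \<omega>
  proof -
    have "I \<tau> i \<omega> \<le> (\<integral>\<^sup>+r. indicator {0..s * real (Suc i)} r \<partial>lborel)"
      unfolding I_def using Z.Y_in[OF _ that(2)] that(1) by (intro nn_integral_mono) (auto simp: indicator_def)
    also have "\<dots> < \<infinity>" using s by simp
    finally show ?thesis .
  qed
  have ef: "exp_functional (Vup 0) \<omega> = (SUP i. I 0 i \<omega>)" if "\<omega> \<in> space (N 0)" for \<omega>
    using exp_integral_eq_SUP[OF Z.Y_cadlag[OF that] order_refl s] by (simp add: exp_functional_def I_def)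
  have ef_le: "exp_functional (Vup 0) \<omega> \<le> ennreal t + (SUP i. I t i \<omega>)" if "\<omega> \<in> space (N 0)" for \<omega>
    using exp_integral_le_shift[OF Z.Y_cadlag[OF that] _ t] Z.Y_in[OF _ that] exp_integral_eq_SUP[OF Z.Y_cadlag[OF that] t s]
    by (simp add: exp_functional_def I_def)
  have Em: "{\<omega>\<in>space (N 0). exp_functional (Vup 0) \<omega> \<le> ennreal (t + u)} \<in> sets (N 0)"
  proof -
    have [measurable]: "I 0 i \<in> borel_measurable (N 0)" for i by (rule I_meas) simp
    have "{\<omega>\<in>space (N 0). exp_functional (Vup 0) \<omega> \<le> ennreal (t + u)} = {\<omega>\<in>space (N 0). (SUP i. I 0 i \<omega>) \<le> ennreal (t + u)}"
      using ef by auto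
    also have "\<dots> \<in> sets (N 0)" by measurable
    finally show ?thesis .
  qed
  let ?A = "\<lambda>i. {\<omega>\<in>?B. I t i \<omega> \<le> ennreal u}"
  have [measurable]: "I t i \<in> borel_measurable (N 0)" for i by (rule I_meas[OF t])
  have Am: "?A i \<in> sets (N 0)" for i
  proof -
    have "?A i = ?B \<inter> {\<omega>\<in>space (N 0). I t i \<omega> \<le> ennreal u}" by auto
    also have "\<dots> \<in> sets (N 0)" by measurable
    finally show ?thesis .
  qed
  have main: "?c * measure (N 0) ?B \<le> measure (N 0) (?A i) + exp (- (q * u))" for i
  proof -
    let ?e = "\<lambda>x. ennreal (exp (- (q * enn2real x)))"
    have low: "ennreal ?c * emeasure (N 0) ?B \<le> (\<integral>\<^sup>+\<omega>. ennreal (?Z \<omega>) * ?e (ennreal (R t i n \<omega>)) \<partial>N 0)" for n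
    proof -
      let ?\<psi> = "\<lambda>z. exp (- (q * ?h n * exp (- z)))"
      have psi01: "0 \<le> ?\<psi> z \<and> ?\<psi> z \<le> 1" for z
      proof -
        have "0 \<le> q * ?h n * exp (- z)" using q(1) h[of n] by (intro mult_nonneg_nonneg) auto
        then show ?thesis by (simp only: exp_ge_zero exp_le_one_iff neg_le_0_iff_le simp_thms)
      qed
      have Gm[measurable]: "chainG ?\<psi> (?h n) (Suc i * Suc n) \<in> borel_measurable borel"
        using h[of n] by (intro chainG_measurable) auto
      have "ennreal ?c * emeasure (N 0) ?B = (\<integral>\<^sup>+\<omega>. ennreal ?c * indicator ?B \<omega> \<partial>N 0)"
        by (rule nn_integral_cmult_indicator[symmetric]) measurable
      also have "\<dots> \<le> (\<integral>\<^sup>+\<omega>. ennreal (?Z \<omega>) * chainG ?\<psi> (?h n) (Suc i * Suc n) (Vup 0 t \<omega>) \<partial>N 0)"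
      proof (intro nn_integral_mono)
        fix \<omega>
        show "ennreal ?c * indicator ?B \<omega> \<le> ennreal (?Z \<omega>) * chainG ?\<psi> (?h n) (Suc i * Suc n) (Vup 0 t \<omega>)"
        proof (cases "\<omega> \<in> ?B")
          case True
          then have "ennreal ?c \<le> chainG ?\<psi> (?h n) (Suc i * Suc n) (Vup 0 t \<omega>)"
            using b q by (intro chainG_exp_ge[OF s J _ occ, of "Suc n" b "Vup 0 t \<omega>" K q]) auto
          then show ?thesis using True by simp
        qed simp
      qed
      also have "\<dots> = (\<integral>\<^sup>+\<omega>. ennreal (?Z \<omega>) * (\<Prod>k=1..Suc i * Suc n. ennreal (?\<psi> (Vup 0 (t + real k * ?h n) \<omega>))) \<partial>N 0)"
        using b h[of n] psi01 by (intro Z.nn_integral_chain[OF _ _ _ t Zm, symmetric]) (auto simp: indicator_def)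
      also have "\<dots> = (\<integral>\<^sup>+\<omega>. ennreal (?Z \<omega>) * ?e (ennreal (R t i n \<omega>)) \<partial>N 0)"
      proof (intro nn_integral_cong)
        fix \<omega>
        have R0: "0 \<le> R t i n \<omega>" unfolding R_def using h[of n] by (intro sum_nonneg mult_nonneg_nonneg) auto
        have "(\<Prod>k=1..Suc i * Suc n. ennreal (?\<psi> (Vup 0 (t + real k * ?h n) \<omega>)))
          = ennreal (\<Prod>k=1..Suc i * Suc n. exp (- (q * ?h n * exp (- Vup 0 (t + real k * ?h n) \<omega>))))"
          by (rule prod_ennreal) simp
        also have "(\<Prod>k=1..Suc i * Suc n. exp (- (q * ?h n * exp (- Vup 0 (t + real k * ?h n) \<omega>))))
          = exp (\<Sum>k=1..Suc i * Suc n. - (q * ?h n * exp (- Vup 0 (t + real k * ?h n) \<omega>)))"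
          by (rule exp_sum[symmetric]) simp
        also have "(\<Sum>k=1..Suc i * Suc n. - (q * ?h n * exp (- Vup 0 (t + real k * ?h n) \<omega>))) = - (q * R t i n \<omega>)"
          unfolding R_def sum_negf sum_distrib_left by (simp only: mult_ac)
        finally show "ennreal (?Z \<omega>) * (\<Prod>k=1..Suc i * Suc n. ennreal (?\<psi> (Vup 0 (t + real k * ?h n) \<omega>)))
           = ennreal (?Z \<omega>) * ?e (ennreal (R t i n \<omega>))" using R0 by (simp only: enn2real_ennreal)
      qed
      finally show ?thesis .
    qed
    have "(\<lambda>n. \<integral>\<^sup>+\<omega>. ennreal (?Z \<omega>) * ?e (ennreal (R t i n \<omega>)) \<partial>N 0) \<longlonglongrightarrow> (\<integral>\<^sup>+\<omega>. ennreal (?Z \<omega>) * ?e (I t i \<omega>) \<partial>N 0)"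
    proof (rule nn_integral_dominated_convergence[where w="\<lambda>_. 1"])
      show "(\<lambda>\<omega>. ennreal (?Z \<omega>) * ?e (ennreal (R t i n \<omega>))) \<in> borel_measurable (N 0)" for n
        using R_meas[OF t, of i n] by measurable
      show "AE \<omega> in N 0. (\<lambda>n. ennreal (?Z \<omega>) * ?e (ennreal (R t i n \<omega>))) \<longlonglongrightarrow> ennreal (?Z \<omega>) * ?e (I t i \<omega>)"
      proof (rule AE_I2)
        fix \<omega> assume w: "\<omega> \<in> space (N 0)"
        have "(\<lambda>n. ennreal (R t i n \<omega>)) \<longlonglongrightarrow> ennreal (enn2real (I t i \<omega>))"
          using R_tendsto[OF t w, of i] I_fin[OF t w, of i] by (simp add: less_top[symmetric])
        then have "(\<lambda>n. enn2real (ennreal (R t i n \<omega>))) \<longlonglongrightarrow> enn2real (I t i \<omega>)"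
          by (rule tendsto_enn2real) simp
        then have "(\<lambda>n. ?e (ennreal (R t i n \<omega>))) \<longlonglongrightarrow> ?e (I t i \<omega>)"
          by (intro tendsto_ennrealI tendsto_exp tendsto_minus tendsto_mult_left)
        then show "(\<lambda>n. ennreal (?Z \<omega>) * ?e (ennreal (R t i n \<omega>))) \<longlonglongrightarrow> ennreal (?Z \<omega>) * ?e (I t i \<omega>)"
          by (rule ennreal_tendsto_cmult[rotated]) simp
      qed
      show "AE \<omega> in N 0. ennreal (?Z \<omega>) * ?e (ennreal (R t i n \<omega>)) \<le> 1" for n
        using q by (intro AE_I2) (auto simp: indicator_def)
    qed (auto simp: Z.N.emeasure_space_1)
    then have "ennreal ?c * emeasure (N 0) ?B \<le> (\<integral>\<^sup>+\<omega>. ennreal (?Z \<omega>) * ?e (I t i \<omega>) \<partial>N 0)"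
      using low by (intro LIMSEQ_le_const) auto
    also have "\<dots> \<le> (\<integral>\<^sup>+\<omega>. indicator (?A i) \<omega> + ennreal (exp (- (q * u))) \<partial>N 0)"
    proof (intro nn_integral_mono)
      fix \<omega> assume w: "\<omega> \<in> space (N 0)"
      show "ennreal (?Z \<omega>) * ?e (I t i \<omega>) \<le> indicator (?A i) \<omega> + ennreal (exp (- (q * u)))"
      proof (cases "\<omega> \<in> ?A i")
        case True
        have "ennreal (?Z \<omega>) * ?e (I t i \<omega>) \<le> 1 * 1" using q by (intro mult_mono) (auto simp: indicator_def)
        then show ?thesis using True by (simp add: add_increasing2)
      next
        case False
        show ?thesis
        proof (cases "\<omega> \<in> ?B")
          case True
          then have "\<not> I t i \<omega> \<le> ennreal u" using False by simp
          then have "u \<le> enn2real (I t i \<omega>)" using I_fin[OF t w, of i] u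
            by (cases "I t i \<omega>") (auto simp: ennreal_le_iff not_le)
          then have "exp (- (q * enn2real (I t i \<omega>))) \<le> exp (- (q * u))" using q by (simp add: mult_left_mono)
          then have "ennreal (?Z \<omega>) * ?e (I t i \<omega>) \<le> 1 * ennreal (exp (- (q * u)))"
            by (intro mult_mono ennreal_leI) (auto simp: indicator_def)
          then show ?thesis by (simp add: add_increasing)
        qed (use w in \<open>auto simp: indicator_def\<close>)
      qed
    qed
    also have "\<dots> = emeasure (N 0) (?A i) + ennreal (exp (- (q * u)))"
      using Am[of i] by (subst nn_integral_add) (auto simp: Z.N.emeasure_space_1)
    finally have "ennreal ?c * ennreal (measure (N 0) ?B) \<le> ennreal (measure (N 0) (?A i)) + ennreal (exp (- (q * u)))"
      by (simp only: Z.N.emeasure_eq_measure)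
    then have "ennreal (?c * measure (N 0) ?B) \<le> ennreal (measure (N 0) (?A i) + exp (- (q * u)))"
      using c by (simp only: ennreal_mult'[OF c] ennreal_plus[OF measure_nonneg exp_ge_zero])
    then show ?thesis by (subst (asm) ennreal_le_iff) (auto intro!: add_nonneg_nonneg)
  qed
  have dec: "decseq ?A"
  proof (rule decseq_SucI, safe)
    fix i \<omega> assume "I t (Suc i) \<omega> \<le> ennreal u"
    moreover have "I t i \<omega> \<le> I t (Suc i) \<omega>"
    proof -
      have "s * real (Suc i) \<le> s * real (Suc (Suc i))" using s by (intro mult_left_mono) auto
      then show ?thesis unfolding I_def by (intro nn_integral_mono mult_left_mono) (auto simp: indicator_def simp del: of_nat_Suc)
    qed
    ultimately show "I t i \<omega> \<le> ennreal u" by (rule order_trans[rotated])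
  qed
  have "?c * measure (N 0) ?B \<le> measure (N 0) (\<Inter>i. ?A i) + exp (- (q * u))"
  proof (rule LIMSEQ_le_const)
    show "(\<lambda>i. measure (N 0) (?A i) + exp (- (q * u))) \<longlonglongrightarrow> measure (N 0) (\<Inter>i. ?A i) + exp (- (q * u))"
      using Am dec by (intro tendsto_add tendsto_const Z.N.finite_Lim_measure_decseq) auto
  qed (use main in auto)
  also have "measure (N 0) (\<Inter>i. ?A i) \<le> measure (N 0) {\<omega>\<in>space (N 0). exp_functional (Vup 0) \<omega> \<le> ennreal (t + u)}"
  proof (rule Z.N.finite_measure_mono[OF _ Em], safe)
    fix \<omega> assume "\<omega> \<in> (\<Inter>i. ?A i)"
    then have w: "\<omega> \<in> space (N 0)" and I: "\<And>i. I t i \<omega> \<le> ennreal u" by auto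
    show "\<omega> \<in> space (N 0)" by (rule w)
    have "exp_functional (Vup 0) \<omega> \<le> ennreal t + (SUP i. I t i \<omega>)" by (rule ef_le[OF w])
    also have "\<dots> \<le> ennreal t + ennreal u" using I by (intro add_left_mono SUP_least)
    finally show "exp_functional (Vup 0) \<omega> \<le> ennreal (t + u)" using t u by simp
  qed
  finally show ?thesis by simp
qed

text \<open>Domination holds for every start \<open>x > 0\<close>, and a piecewise linear test
  function carries it to the limit \<open>x \<rightarrow> 0\<close> at the loss of one unit of
  height.\<close>

lemma prob_Vup_0_ge:
  assumes t: "0 < t"
  shows "prob {\<omega>\<in>space M. a \<le> V t \<omega>} \<le> measure (N 0) {\<omega>\<in>space (N 0). a - 1 \<le> Vup 0 t \<omega>}"
proof -
  interpret Z: up_markov M V \<Psi> W N Vup "N 0" "{0..}" P0 0 "Vup 0" by (rule up_markov_0)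
  note [measurable] = V_measurable[OF less_imp_le[OF t]] Z.Y_measurable[OF less_imp_le[OF t]]
  define f where "f u = max 0 (min 1 (u t - (a - 1)))" for u :: "real \<Rightarrow> real"
  have f01: "0 \<le> f u \<and> f u \<le> 1" for u by (simp add: f_def)
  have cont: "continuous_on UNIV f" unfolding f_def by (intro continuous_intros continuous_on_coordinate)
  have bd: "bounded (range f)" using f01 by (intro boundedI[of _ 1]) (metis abs_of_nonneg imageE real_norm_def)
  have fr: "f (\<lambda>s\<in>{t}. Y s \<omega>) = f (\<lambda>s. Y s \<omega>)" for Y :: "real \<Rightarrow> 'c \<Rightarrow> real" and \<omega> by (simp add: f_def)
  have low: "prob {\<omega>\<in>space M. a \<le> V t \<omega>} \<le> (\<integral>\<omega>. f (\<lambda>s\<in>{t}. Vup x s \<omega>) \<partial>N x)" if x: "0 < x" for x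
  proof -
    interpret U: up_markov M V \<Psi> W N Vup "N x" "{0<..}" "up_kernel M V W" x "Vup x" by (rule up_markov_pos[OF x])
    note [measurable] = U.Y_measurable[OF less_imp_le[OF t]]
    let ?E = "{\<omega>\<in>space (N x). a \<le> Vup x t \<omega>}"
    have Em: "?E \<in> sets (N x)" by measurable
    have "emeasure M {\<omega>\<in>space M. a \<le> V t \<omega>} \<le> emeasure M {\<omega>\<in>space M. a \<le> x + V t \<omega>}"
      using x by (intro emeasure_mono) auto
    also have "\<dots> \<le> Kop t (indicator {a..}) x" by (rule Kop_tail_ge[OF t x])
    also have "\<dots> = (\<integral>\<^sup>+\<omega>. indicator {a..} (Vup x t \<omega>) \<partial>N x)"
      using t by (intro nn_integral_Vup[OF x, symmetric]) auto
    also have "\<dots> = (\<integral>\<^sup>+\<omega>. indicator ?E \<omega> \<partial>N x)" by (intro nn_integral_cong) (auto simp: indicator_def)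
    also have "\<dots> = emeasure (N x) ?E" by (rule nn_integral_indicator[OF Em])
    finally have "prob {\<omega>\<in>space M. a \<le> V t \<omega>} \<le> U.N.prob ?E"
      by (simp add: emeasure_eq_measure U.N.emeasure_eq_measure)
    also have "\<dots> = (\<integral>\<omega>. indicat_real ?E \<omega> \<partial>N x)" by (rule integral_indicator_sets[OF Em, symmetric])
    also have "\<dots> \<le> (\<integral>\<omega>. f (\<lambda>s. Vup x s \<omega>) \<partial>N x)"
    proof (rule integral_mono)
      show "integrable (N x) (indicat_real ?E)" by (rule U.N.integrable_indicator_sets[OF Em])
      show "integrable (N x) (\<lambda>\<omega>. f (\<lambda>s. Vup x s \<omega>))"
      proof (rule U.N.integrable_const_bound[of _ 1])
        show "(\<lambda>\<omega>. f (\<lambda>s. Vup x s \<omega>)) \<in> borel_measurable (N x)" unfolding f_def by measurable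
      qed (use f01 in auto)
      show "indicat_real ?E \<omega> \<le> f (\<lambda>s. Vup x s \<omega>)" for \<omega> by (auto simp: f_def indicator_def)
    qed
    finally show ?thesis by (simp only: fr)
  qed
  have "prob {\<omega>\<in>space M. a \<le> V t \<omega>} \<le> (\<integral>\<omega>. f (\<lambda>s\<in>{t}. Vup 0 s \<omega>) \<partial>N 0)"
  proof (rule tendsto_lowerbound[OF fdd_limit[OF _ _ cont bd]])
    show "eventually (\<lambda>x. prob {\<omega>\<in>space M. a \<le> V t \<omega>} \<le> (\<integral>\<omega>. f (\<lambda>s\<in>{t}. Vup x s \<omega>) \<partial>N x)) (at_right 0)"
      using eventually_at_right_less[of 0] by eventually_elim (rule low)
  qed (use t in auto)
  also have "\<dots> = (\<integral>\<omega>. f (\<lambda>s. Vup 0 s \<omega>) \<partial>N 0)" by (simp only: fr)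
  also have "\<dots> \<le> (\<integral>\<omega>. indicat_real {\<omega>\<in>space (N 0). a - 1 \<le> Vup 0 t \<omega>} \<omega> \<partial>N 0)"
  proof (rule integral_mono)
    show "integrable (N 0) (indicat_real {\<omega>\<in>space (N 0). a - 1 \<le> Vup 0 t \<omega>})"
      by (rule Z.N.integrable_indicator_sets) measurable
    show "integrable (N 0) (\<lambda>\<omega>. f (\<lambda>s. Vup 0 s \<omega>))"
    proof (rule Z.N.integrable_const_bound[of _ 1])
      show "(\<lambda>\<omega>. f (\<lambda>s. Vup 0 s \<omega>)) \<in> borel_measurable (N 0)" unfolding f_def by measurable
    qed (use f01 in auto)
    show "f (\<lambda>s. Vup 0 s \<omega>) \<le> indicat_real {\<omega>\<in>space (N 0). a - 1 \<le> Vup 0 t \<omega>} \<omega>" if "\<omega> \<in> space (N 0)" for \<omega>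
      using that by (auto simp: f_def indicator_def)
  qed
  also have "\<dots> = measure (N 0) {\<omega>\<in>space (N 0). a - 1 \<le> Vup 0 t \<omega>}" by (rule integral_indicator_sets) measurable
  finally show ?thesis .
qed

text \<open>In \<open>hit_bound\<close> the growth \<open>exp (c * L)\<close> of \<open>W\<close> is
  beaten by \<open>exp (- l * L)\<close> with \<open>l \<ge> c + 1\<close>, which leaves decay at
  rate at least \<open>1\<close>. The grid is the single time \<open>t\<close>.\<close>

lemma prob_Vup_0_large:
  obtains D where "0 < D" "\<And>t K. 0 < t \<Longrightarrow> t \<le> 1 \<Longrightarrow> 2 \<le> K \<Longrightarrow>
    measure (N 0) {\<omega>\<in>space (N 0). K \<le> Vup 0 t \<omega>} \<le> D * exp (- K)"
proof -
  obtain c C where c: "c > 0" "C > 0" "\<And>x. 0 \<le> x \<Longrightarrow> W x \<le> C * exp (c * x)" using W_exp_growth by blast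
  obtain a l0 where a: "a > 0" "l0 > 0" "\<And>l. l \<ge> l0 \<Longrightarrow> a * l \<le> \<Psi> l" using Psi_ge_linear by blast
  define l where "l = max l0 (c + 1)"
  have l: "0 \<le> l" "c + 1 \<le> l" using c by (auto simp: l_def)
  have Pl: "0 \<le> \<Psi> l"
  proof -
    have "0 \<le> a * l" using a l by simp
    also have "\<dots> \<le> \<Psi> l" using a by (simp add: l_def)
    finally show ?thesis .
  qed
  have Wh: "0 < W (1/2)" using W_pos by simp
  let ?D = "C / W (1/2) * exp (c + l + \<Psi> l + 1)"
  have "measure (N 0) {\<omega>\<in>space (N 0). K \<le> Vup 0 t \<omega>} \<le> ?D * exp (- K)" if t: "0 < t" "t \<le> 1" and K: "2 \<le> K" for t K
  proof -
    define L where "L = K - 1"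
    have L: "1 \<le> L" using K by (simp add: L_def)
    have "measure (N 0) {\<omega>\<in>space (N 0). K \<le> Vup 0 t \<omega>} \<le> hit_bound l L t"
      using hit_grid_0[OF t(1) l(1) Pl L, of 1] by (simp add: L_def)
    also have "\<dots> \<le> C * exp (c * (L + 1/4)) / W (1/2) * exp (l * (3/4 - L) + t * \<Psi> l)"
      unfolding hit_bound_def using L Wh by (intro mult_right_mono divide_right_mono c) auto
    also have "\<dots> = C / W (1/2) * (exp (c * (L + 1/4)) * exp (l * (3/4 - L) + t * \<Psi> l))" by simp
    also have "exp (c * (L + 1/4)) * exp (l * (3/4 - L) + t * \<Psi> l) \<le> exp (c + l + \<Psi> l + 1) * exp (- K)"
    proof -
      have "t * \<Psi> l \<le> 1 * \<Psi> l" using t Pl by (intro mult_right_mono) auto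
      moreover have "1 * L \<le> (l - c) * L" using l L by (intro mult_right_mono) auto
      moreover have "c * (L + 1/4) + (l * (3/4 - L) + t * \<Psi> l) = c / 4 + 3 / 4 * l - (l - c) * L + t * \<Psi> l"
        by (simp add: algebra_simps)
      moreover have "c + l + \<Psi> l + 1 - K = c + l + \<Psi> l - L" by (simp add: L_def)
      moreover have "c / 4 \<le> c" "3 / 4 * l \<le> l" using c(1) l(1) by auto
      ultimately have "c * (L + 1/4) + (l * (3/4 - L) + t * \<Psi> l) \<le> c + l + \<Psi> l + 1 - K" by linarith
      then show ?thesis by (simp add: mult_exp_exp)
    qed
    then have "C / W (1/2) * (exp (c * (L + 1/4)) * exp (l * (3/4 - L) + t * \<Psi> l)) \<le> C / W (1/2) * (exp (c + l + \<Psi> l + 1) * exp (- K))"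
      using c Wh by (intro mult_left_mono) auto
    finally show ?thesis by (simp add: mult.assoc)
  qed
  moreover have "0 < ?D" using c Wh by simp
  ultimately show thesis using that by blast
qed

section \<open>Logarithmic asymptotics\<close>

text \<open>With \<open>b\<close> strictly between \<open>beta_exponent \<Psi>\<close> and
  \<open>b'\<close>, the exponent obtained is of order \<open>x powr (- 1 / (b - 1))\<close>, which
  outgrows what the normalisation \<open>x powr (1 / (b' - 1))\<close> can compensate.\<close>

lemma log_prob_exp_functional_upper:
  assumes b: "beta_exponent \<Psi> < b'"
  shows "((\<lambda>x. ereal (x powr (1 / (b' - 1))) * log0 (measure (N 0) {\<omega> \<in> space (N 0). exp_functional (Vup 0) \<omega> \<le> ennreal x})) \<longlongrightarrow> - \<infinity>) (at_right 0)"
proof -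
  define p where "p x = measure (N 0) {\<omega> \<in> space (N 0). exp_functional (Vup 0) \<omega> \<le> ennreal x}" for x
  obtain b where b: "beta_exponent \<Psi> < b" "b < b'" using dense[OF assms] by blast
  have b1: "1 < b" using b exponent_bounds by linarith
  define e1 where "e1 = 1 / (b' - 1)"
  define e2 where "e2 = 1 / (b - 1)"
  have e: "0 < e1" "e1 < e2" using b b1 by (auto simp: e1_def e2_def field_simps)
  define A where "A = W (1 + 1/4) / W (1/2)"
  have A: "0 < A" using W_pos by (simp add: A_def)
  obtain a l0 where a: "a > 0" "l0 > 0" "\<And>l. l \<ge> l0 \<Longrightarrow> a * l \<le> \<Psi> l" using Psi_ge_linear by blast
  obtain l1 where l1: "\<And>u. u \<ge> l1 \<Longrightarrow> \<Psi> u \<le> u powr b"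
    using beta_exponent_greater[OF b(1)] by (auto simp: eventually_at_top_linorder)
  \<comment> \<open>This choice solves \<open>16 * x * l powr b = l / 8\<close>, half of the gain
    \<open>l / 4\<close> in the exponent of \<open>hit_bound\<close> with
    \<open>L = 1\<close>.\<close>
  let ?l = "\<lambda>x. (128 * x) powr (- e2)"
  have E1: "eventually (\<lambda>x. max 1 (max l0 l1) \<le> ?l x) (at_right 0)"
    using e by real_asymp
  have pbound: "eventually (\<lambda>x. p x \<le> A * exp (- (?l x / 8))) (at_right 0)"
    using E1 eventually_at_right_less[of 0]
  proof eventually_elim
    case (elim x)
    have l: "1 \<le> ?l x" "l0 \<le> ?l x" "l1 \<le> ?l x" using elim by auto
    have "0 \<le> a * ?l x" using a l by simp
    then have P: "0 \<le> \<Psi> (?l x)" using a(3)[OF l(2)] by linarith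
    have "?l x powr b = ?l x * ?l x powr (b - 1)" using l by (simp add: powr_diff)
    also have "?l x powr (b - 1) = 1 / (128 * x)"
    proof -
      have "- e2 * (b - 1) = - 1" using b1 by (simp add: e2_def)
      then have "?l x powr (b - 1) = (128 * x) powr (- 1)" by (simp only: powr_powr)
      also have "\<dots> = 1 / (128 * x)" using elim by (simp add: powr_minus_divide)
      finally show ?thesis .
    qed
    finally have "16 * x * (?l x powr b) = ?l x / 8" using elim by simp
    moreover have "16 * x * \<Psi> (?l x) \<le> 16 * x * (?l x powr b)" using elim l1[OF l(3)] by (intro mult_left_mono) auto
    ultimately have X: "?l x * (3/4 - 1) + 16 * x * \<Psi> (?l x) \<le> - (?l x / 8)" by (simp add: algebra_simps)
    have "p x \<le> hit_bound (?l x) 1 (16 * x)"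
      unfolding p_def using elim l P by (intro prob_exp_functional_le) auto
    also have "\<dots> = A * exp (?l x * (3/4 - 1) + 16 * x * \<Psi> (?l x))" by (simp add: hit_bound_def A_def)
    also have "\<dots> \<le> A * exp (- (?l x / 8))" using A X by (intro mult_left_mono) auto
    finally show ?case .
  qed
  have lim: "filterlim (\<lambda>x. x powr e1 * (ln A - ?l x / 8)) at_bot (at_right 0)"
    using e by real_asymp
  show ?thesis
    unfolding p_def[symmetric] e1_def[symmetric] tendsto_MInfty
  proof
    fix r :: real
    have "eventually (\<lambda>x. x powr e1 * (ln A - ?l x / 8) < r) (at_right 0)"
      using lim by (simp add: filterlim_at_bot_dense)
    then show "eventually (\<lambda>x. ereal (x powr e1) * log0 (p x) < ereal r) (at_right 0)"
      using pbound eventually_at_right_less[of 0]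
    proof eventually_elim
      case (elim x)
      show ?case
      proof (cases "p x = 0")
        case True
        have "0 < x powr e1" using elim by simp
        then show ?thesis using True by (simp add: log0_def)
      next
        case False
        then have p: "0 < p x" by (simp add: p_def zero_less_measure_iff)
        have "ln (p x) \<le> ln (A * exp (- (?l x / 8)))" using p elim A by (subst ln_le_cancel_iff) auto
        also have "\<dots> = ln A - ?l x / 8" using A by (simp add: ln_mult)
        finally have "x powr e1 * ln (p x) \<le> x powr e1 * (ln A - ?l x / 8)" by (rule mult_left_mono) simp
        then have "x powr e1 * ln (p x) < r" using elim by linarith
        then show ?thesis using False by (simp add: log0_def)
      qed
    qed
  qed
qed

text \<open>Besides reaching a logarithmic height at time \<open>t\<close>, the process is required
  to stay below the cap \<open>K\<close> at that time, since the later transform costs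
  \<open>1 / W K\<close>; as \<open>W\<close> grows at most like \<open>exp (c * x)\<close>, a cap
  of order \<open>t powr (- g)\<close> keeps this cost on the scale of the climb itself.\<close>

lemma prob_exp_functional_lower:
  assumes s: "1 < s'" "s' < sigma_exponent \<Psi>" and g: "1 / (s' - 1) < g"
  shows "\<exists>B>0. \<exists>D. eventually (\<lambda>x. B * exp (- (D * x powr (- g)))
     \<le> measure (N 0) {\<omega> \<in> space (N 0). exp_functional (Vup 0) \<omega> \<le> ennreal x}) (at_right 0)"
proof -
  interpret Z: up_markov M V \<Psi> W N Vup "N 0" "{0..}" P0 0 "Vup 0" by (rule up_markov_0)
  obtain s J where sJ: "0 < s" "0 \<le> J" "\<And>m n. 0 < m \<Longrightarrow>
    (\<Sum>k=1..n. ennreal (s / real m) * Kop (real k * (s / real m)) (\<lambda>z. ennreal (exp (- z))) 1) \<le> ennreal J"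
    using occupation_bound by blast
  obtain c C where c: "c > 0" "C > 0" "\<And>x. 0 \<le> x \<Longrightarrow> W x \<le> C * exp (c * x)" using W_exp_growth by blast
  obtain D where D: "0 < D" "\<And>t K. 0 < t \<Longrightarrow> t \<le> 1 \<Longrightarrow> 2 \<le> K \<Longrightarrow>
    measure (N 0) {\<omega>\<in>space (N 0). K \<le> Vup 0 t \<omega>} \<le> D * exp (- K)" using prob_Vup_0_large by blast
  have g0: "0 < g" using g s by (smt (verit) divide_pos_pos)
  define A where "A = g + 3"
  have A: "0 < A" using g0 by (simp add: A_def)
  let ?p = "\<lambda>x. measure (N 0) {\<omega> \<in> space (N 0). exp_functional (Vup 0) \<omega> \<le> ennreal x}"
  \<comment> \<open>With \<open>A = g + 3\<close> the product of \<open>?q t\<close> and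
    \<open>exp (1 - ?b t)\<close> is \<open>exp 2 * t\<close>, which is small;
    \<open>?q t * t = t powr (- g - 1)\<close> makes the Laplace error negligible against
    \<open>exp (- E * t powr (- g))\<close>; and the factor \<open>2\<close> in \<open>?K\<close>
    makes the tail above the cap at most half of the lower bound for reaching
    \<open>?b t\<close>.\<close>
  let ?b = "\<lambda>t. A * ln (1 / t) - 1" and ?K = "\<lambda>t. 2 * t powr (- g)" and ?q = "\<lambda>t. t powr (- g - 2)"
  have W1: "0 < W 1" using W_pos by simp
  \<comment> \<open>The \<open>8\<close> collects three factors \<open>2\<close>: one from
    \<open>2 * W K\<close>, one for the cap, and one to absorb the Laplace error.\<close>
  define B where "B = W 1 / (8 * C)"
  define E where "E = 2 * c + 1"
  have B: "0 < B" using W1 c by (simp add: B_def)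
  have E: "0 < E" using c by (simp add: E_def)
  have e0: "eventually (\<lambda>t::real. 0 < t \<and> t \<le> 1) (at_right 0)" by (intro eventually_conj) real_asymp+
  have e1: "eventually (\<lambda>t. 1 < ?b t) (at_right 0)" using A by real_asymp
  have e2: "eventually (\<lambda>t. max 2 (?b t) \<le> ?K t) (at_right 0)"
  proof -
    have "eventually (\<lambda>t. 2 \<le> ?K t) (at_right 0)" using g0 by real_asymp
    moreover have "eventually (\<lambda>t. ?b t \<le> ?K t) (at_right 0)" using g0 A by real_asymp
    ultimately show ?thesis by eventually_elim simp
  qed
  have e3: "eventually (\<lambda>t. D * exp (- ?K t) \<le> 1/2 * exp (- (t powr (- g)))) (at_right 0)"
    using g0 D(1) by real_asymp
  have e4: "eventually (\<lambda>t. exp (- (?q t * t)) \<le> B * exp (- (E * t powr (- g)))) (at_right 0)"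
    using g0 B E by real_asymp
  have e5: "eventually (\<lambda>t. exp 2 * J * t \<le> 1/2) (at_right 0)" by real_asymp
  have e6: "eventually (\<lambda>t. exp (- (t powr (- g))) \<le> prob {\<omega>\<in>space M. A * ln (1 / t) \<le> V t \<omega>}) (at_right 0)"
    by (rule prob_V_ge_log[OF s(1) sigma_exponent_less[OF s(2)] g A])
  have ev: "eventually (\<lambda>t. B * exp (- (E * t powr (- g))) \<le> ?p (t + t)) (at_right 0)"
    using e0 e1 e2 e3 e4 e5 e6
  proof eventually_elim
    case (elim t)
    have t: "0 < t" "t \<le> 1" using elim by auto
    note [measurable] = Z.Y_measurable[OF less_imp_le[OF t(1)]]
    let ?x = "exp (- (t powr (- g)))"
    have bK: "1 < ?b t" "?b t \<le> ?K t" "2 \<le> ?K t" using elim by auto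
    have "?x \<le> measure (N 0) {\<omega>\<in>space (N 0). ?b t \<le> Vup 0 t \<omega>}"
      using elim prob_Vup_0_ge[OF t(1), of "A * ln (1 / t)"] by linarith
    also have "\<dots> \<le> measure (N 0) ({\<omega>\<in>space (N 0). ?b t \<le> Vup 0 t \<omega> \<and> Vup 0 t \<omega> \<le> ?K t} \<union> {\<omega>\<in>space (N 0). ?K t \<le> Vup 0 t \<omega>})"
      by (rule Z.N.finite_measure_mono) (auto, measurable)
    also have "\<dots> \<le> measure (N 0) {\<omega>\<in>space (N 0). ?b t \<le> Vup 0 t \<omega> \<and> Vup 0 t \<omega> \<le> ?K t} + measure (N 0) {\<omega>\<in>space (N 0). ?K t \<le> Vup 0 t \<omega>}"
      by (rule measure_Un_le) measurable
    also have "measure (N 0) {\<omega>\<in>space (N 0). ?K t \<le> Vup 0 t \<omega>} \<le> 1/2 * ?x"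
      using D(2)[OF t bK(3)] elim by linarith
    finally have mid: "1/2 * ?x \<le> measure (N 0) {\<omega>\<in>space (N 0). ?b t \<le> Vup 0 t \<omega> \<and> Vup 0 t \<omega> \<le> ?K t}" by linarith
    have q: "?q t * exp (1 - ?b t) * J \<le> 1/2"
    proof -
      have "exp (1 - ?b t) = exp 2 * exp (A * ln t)" using t by (simp add: mult_exp_exp ln_div algebra_simps)
      also have "exp (A * ln t) = t powr A" using t by (simp add: powr_def)
      finally have "?q t * exp (1 - ?b t) * J = exp 2 * J * (t powr (- g - 2) * t powr A)" by simp
      also have "t powr (- g - 2) * t powr A = t" using t by (simp add: powr_add[symmetric] A_def)
      finally have "?q t * exp (1 - ?b t) * J = exp 2 * J * t" .
      then show ?thesis using elim by linarith
    qed
    have WK: "0 < W (?K t)" using bK by (intro W_pos) linarith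
    have "W 1 / (2 * W (?K t)) * measure (N 0) {\<omega>\<in>space (N 0). ?b t \<le> Vup 0 t \<omega> \<and> Vup 0 t \<omega> \<le> ?K t}
      \<le> ?p (t + t) + exp (- (?q t * t))"
      using bK t q by (intro prob_exp_functional_ge[OF sJ]) auto
    moreover have "2 * (B * exp (- (E * t powr (- g)))) \<le> W 1 / (2 * W (?K t)) * measure (N 0) {\<omega>\<in>space (N 0). ?b t \<le> Vup 0 t \<omega> \<and> Vup 0 t \<omega> \<le> ?K t}"
    proof -
      have "exp (- (E * t powr (- g))) = 1 / exp (c * ?K t) * ?x"
        by (simp add: E_def exp_minus[symmetric] mult_exp_exp divide_inverse algebra_simps)
      moreover have "2 * (B * (1 / y * z)) = W 1 / (2 * (C * y)) * (1/2 * z)" for y z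
        by (simp add: B_def)
      ultimately have "2 * (B * exp (- (E * t powr (- g)))) = W 1 / (2 * (C * exp (c * ?K t))) * (1/2 * ?x)"
        by (simp only:)
      also have "\<dots> \<le> W 1 / (2 * W (?K t)) * (1/2 * ?x)"
        using c(2) c(3)[of "?K t"] WK W1 bK by (intro mult_right_mono divide_left_mono mult_left_mono) auto
      also have "\<dots> \<le> W 1 / (2 * W (?K t)) * measure (N 0) {\<omega>\<in>space (N 0). ?b t \<le> Vup 0 t \<omega> \<and> Vup 0 t \<omega> \<le> ?K t}"
        using WK W1 by (intro mult_left_mono mid) auto
      finally show ?thesis .
    qed
    ultimately show ?case using elim by linarith
  qed
  \<comment> \<open>Half of \<open>x\<close> is the time for the climb and half the budget of the
    functional afterwards, hence \<open>t = x / 2\<close>.\<close>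
  have "filterlim (\<lambda>x::real. x / 2) (at_right 0) (at_right 0)" by real_asymp
  from eventually_compose_filterlim[OF ev this]
  have "eventually (\<lambda>x. B * exp (- (E * (x / 2) powr (- g))) \<le> ?p x) (at_right 0)" by simp
  moreover have "eventually (\<lambda>x::real. (x / 2) powr (- g) = 2 powr g * x powr (- g)) (at_right 0)"
    using eventually_at_right_less[of 0] by eventually_elim (simp add: powr_divide powr_minus field_simps)
  ultimately have "eventually (\<lambda>x. B * exp (- ((E * 2 powr g) * x powr (- g))) \<le> ?p x) (at_right 0)"
    by eventually_elim (simp add: mult.assoc)
  then show ?thesis using B by blast
qed

text \<open>Two strict gaps are inserted, \<open>s' < s''\<close> and
  \<open>1 / (s'' - 1) < g < 1 / (s' - 1)\<close>, so that \<open>x powr (- g)\<close> times the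
  normalisation tends to \<open>0\<close>. From above, the logarithm of a probability is at most
  \<open>0\<close>.\<close>

lemma log_prob_exp_functional_lower:
  assumes s: "1 < s'" "s' < sigma_exponent \<Psi>"
  shows "((\<lambda>x. ereal (x powr (1 / (s' - 1))) * log0 (measure (N 0) {\<omega> \<in> space (N 0). exp_functional (Vup 0) \<omega> \<le> ennreal x})) \<longlongrightarrow> 0) (at_right 0)"
proof -
  interpret Z: up_markov M V \<Psi> W N Vup "N 0" "{0..}" P0 0 "Vup 0" by (rule up_markov_0)
  define p where "p x = measure (N 0) {\<omega> \<in> space (N 0). exp_functional (Vup 0) \<omega> \<le> ennreal x}" for x
  obtain s'' where s'': "s' < s''" "s'' < sigma_exponent \<Psi>" using dense[OF s(2)] by blast
  define e1 where "e1 = 1 / (s' - 1)"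
  have e1: "0 < e1" using s by (simp add: e1_def)
  have "1 / (s'' - 1) < e1" using s s'' by (simp add: e1_def field_simps)
  then obtain g where g: "1 / (s'' - 1) < g" "g < e1" using dense by blast
  obtain B D where BD: "0 < B" "eventually (\<lambda>x. B * exp (- (D * x powr (- g))) \<le> p x) (at_right 0)"
    using prob_exp_functional_lower[of s'' g] s s'' g unfolding p_def by auto
  have lim: "((\<lambda>x. x powr e1 * (ln B - D * x powr (- g))) \<longlongrightarrow> 0) (at_right 0)"
  proof -
    have "((\<lambda>x. x powr e1 * ln B - D * x powr (e1 - g)) \<longlongrightarrow> 0 * ln B - D * 0) (at_right 0)"
      using e1 g by (intro tendsto_intros) real_asymp+
    moreover have "eventually (\<lambda>x. x powr e1 * ln B - D * x powr (e1 - g) = x powr e1 * (ln B - D * x powr (- g))) (at_right (0::real))"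
      using eventually_at_right_less[of 0] by eventually_elim (simp add: powr_diff powr_minus field_simps)
    ultimately show ?thesis by (simp add: filterlim_cong)
  qed
  have lo: "eventually (\<lambda>x. ereal (x powr e1 * (ln B - D * x powr (- g))) \<le> ereal (x powr e1) * log0 (p x)) (at_right 0)"
    using BD(2)
  proof eventually_elim
    case (elim x)
    have "0 < B * exp (- (D * x powr (- g)))" using BD(1) by simp
    then have p: "0 < p x" using elim by linarith
    have "ln (B * exp (- (D * x powr (- g)))) \<le> ln (p x)" using p elim BD(1) by (subst ln_le_cancel_iff) auto
    moreover have "ln (B * exp (- (D * x powr (- g)))) = ln B - D * x powr (- g)" using BD(1) by (simp add: ln_mult)
    ultimately have "x powr e1 * (ln B - D * x powr (- g)) \<le> x powr e1 * ln (p x)" by (intro mult_left_mono) auto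
    then show ?case using p by (simp add: log0_def)
  qed
  have hi: "eventually (\<lambda>x. ereal (x powr e1) * log0 (p x) \<le> 0) (at_right 0)"
    using BD(2)
  proof eventually_elim
    case (elim x)
    have "0 < B * exp (- (D * x powr (- g)))" using BD(1) by simp
    then have p: "0 < p x" using elim by linarith
    have "p x \<le> 1" unfolding p_def by (rule Z.N.prob_le_1)
    then have "x powr e1 * ln (p x) \<le> 0" using p by (intro mult_nonneg_nonpos) auto
    then show ?case using p by (simp add: log0_def zero_ereal_def)
  qed
  have "((\<lambda>x. ereal (x powr e1) * log0 (p x)) \<longlongrightarrow> 0) (at_right 0)"
  proof (rule tendsto_sandwich[OF lo hi])
    show "((\<lambda>x. ereal (x powr e1 * (ln B - D * x powr (- g)))) \<longlongrightarrow> 0) (at_right 0)"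
      using lim by (simp add: zero_ereal_def)
  qed simp
  then show ?thesis by (simp only: p_def e1_def)
qed

end

theorem theorem1p4:
  fixes M :: "'a measure" and V :: "real \<Rightarrow> 'a \<Rightarrow> real"
    and \<Psi> W :: "real \<Rightarrow> real"
    and N :: "real \<Rightarrow> 'b measure" and Vup :: "real \<Rightarrow> real \<Rightarrow> 'b \<Rightarrow> real"
  assumes "spectrally_negative_levy M V"
    and "\<not> subordinator M (\<lambda>t \<omega>. - V t \<omega>)"
    and "laplace_exponent M V \<Psi>"
    and "scale_function M V \<Psi> W"
    and "conditioned_to_stay_positive M V W N Vup"
  defines "\<sigma> \<equiv> sigma_exponent \<Psi>" and "\<beta> \<equiv> beta_exponent \<Psi>"
    and "p \<equiv> (\<lambda>x::real. measure (N 0) {\<omega> \<in> space (N 0). exp_functional (Vup 0) \<omega> \<le> ennreal x})"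
  shows "1 \<le> \<sigma> \<and> \<sigma> \<le> \<beta> \<and> \<beta> \<le> 2 \<and>
    (\<forall>\<beta>'>\<beta>. ((\<lambda>x. ereal (x powr (1 / (\<beta>' - 1))) * log0 (p x)) \<longlongrightarrow> - \<infinity>) (at_right 0)) \<and>
    (\<sigma> > 1 \<longrightarrow>
      (\<forall>\<sigma>'\<in>{1<..<\<sigma>}. ((\<lambda>x. ereal (x powr (1 / (\<sigma>' - 1))) * log0 (p x)) \<longlongrightarrow> 0) (at_right 0)))"
proof -
  have "prob_space M"
    using assms(1) by (simp add: spectrally_negative_levy_def levy_process_def)
  then interpret prob_space M .
  interpret conditioned_levy M V \<Psi> W N Vup
    using assms(1-5) by unfold_locales
  show ?thesis
    unfolding \<sigma>_def \<beta>_def p_def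
    using exponent_bounds log_prob_exp_functional_upper log_prob_exp_functional_lower by auto
qed

end
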